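(* For all $\epsilon>0$ and all integers $n\ge1$ there exists a constant $C_{n,\epsilon}$ such that the following holds for every integer $N\ge 2$: for every choice of a line $L(u)\subseteq(\mathbb{Z}/N\mathbb{Z})^n$ in direction $u$ for each $u\in\mathbb{P}(\mathbb{Z}/N\mathbb{Z})^{n-1}$, $$\left\|\sum_{u\in\mathbb{P}(\mathbb{Z}/N\mathbb{Z})^{n-1}}\mathbf{1}_{L(u)}\right\|_{\ell^{n/(n-1)}}\ \le\ C_{n,\epsilon}\,N^{\epsilon}\left(\sum_{u\in\mathbb{P}(\mathbb{Z}/N\mathbb{Z})^{n-1}}|L(u)|\right)^{(n-1)/n}.$$
   Context: For $N=p_1^{k_1}\cdots p_r^{k_r}$ ($p_i$ distinct primes), the projective space $\mathbb{P}(\mathbb{Z}/N\mathbb{Z})^{n-1}$ consists of the vectors $u\in(\mathbb{Z}/N\mathbb{Z})^n$ such that, for every $i$, $u\bmod p_i^{k_i}$ has at least one coordinate that is a unit, taken up to multiplication by units in $(\mathbb{Z}/N\mathbb{Z})^\times$; one representative in $(\mathbb{Z}/N\mathbb{Z})^n$ is fixed for each element. A line in direction $u$ is a set $\{a+tu:t\in\mathbb{Z}/N\mathbb{Z}\}$ with $a\in(\mathbb{Z}/N\mathbb{Z})^n$. $\mathbf{1}_{L}$ is the indicator function of $L$ on $(\mathbb{Z}/N\mathbb{Z})^n$. The norm is $\|h\|_{\ell^s}=\left(\sum_{x\in(\mathbb{Z}/N\mathbb{Z})^n}|h(x)|^s\right)^{1/s}$ (counting measure); for $n=1$, $n/(n-1)$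 is read as $\infty$ and the norm is the sup norm. *)

theory Defs
  imports
    "HOL-Number_Theory.Residues"
    "HOL-Library.FuncSet"
    "HOL-Library.Indicator_Function"
    "HOL-Library.Extended_Real"
begin

text \<open>
  The ring \<open>\<int>/N\<int>\<close> is the library's \<^const>\<open>residue_ring\<close>, with carrier \<open>{0..N - 1}\<close>.
  A vector of length \<open>n\<close> over it is an extensional function on \<open>{..<n}\<close>.
\<close>

abbreviation ZN :: "nat \<Rightarrow> int ring" where
  "ZN N \<equiv> residue_ring (int N)"

definition vecs :: "nat \<Rightarrow> nat \<Rightarrow> (nat \<Rightarrow> int) set" where
  "vecs N n = {..<n} \<rightarrow>\<^sub>E carrier (ZN N)"

definition vadd :: "nat \<Rightarrow> nat \<Rightarrow> (nat \<Rightarrow> int) \<Rightarrow> (nat \<Rightarrow> int) \<Rightarrow> (nat \<Rightarrow> int)" where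
  "vadd N n a b = (\<lambda>i\<in>{..<n}. a i \<oplus>\<^bsub>ZN N\<^esub> b i)"

definition vscale :: "nat \<Rightarrow> nat \<Rightarrow> int \<Rightarrow> (nat \<Rightarrow> int) \<Rightarrow> (nat \<Rightarrow> int)" where
  "vscale N n t u = (\<lambda>i\<in>{..<n}. t \<otimes>\<^bsub>ZN N\<^esub> u i)"

definition proj_vecs :: "nat \<Rightarrow> nat \<Rightarrow> (nat \<Rightarrow> int) set" where
  "proj_vecs N n = {u \<in> vecs N n.
     \<forall>p \<in> prime_factors N. \<exists>i<n.
       u i mod int (p ^ multiplicity p N) \<in> Units (ZN (p ^ multiplicity p N))}"

definition proj_rel :: "nat \<Rightarrow> nat \<Rightarrow> ((nat \<Rightarrow> int) \<times> (nat \<Rightarrow> int)) set" where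
  "proj_rel N n = {(u, v). u \<in> proj_vecs N n \<and> v \<in> proj_vecs N n \<and>
     (\<exists>c \<in> Units (ZN N). v = vscale N n c u)}"

text \<open>
  The projective space of dimension \<open>n - 1\<close>; the argument \<open>n\<close> is the number of coordinates.
\<close>

definition proj_space :: "nat \<Rightarrow> nat \<Rightarrow> (nat \<Rightarrow> int) set set" where
  "proj_space N n = proj_vecs N n // proj_rel N n"

definition lines :: "nat \<Rightarrow> nat \<Rightarrow> (nat \<Rightarrow> int) \<Rightarrow> (nat \<Rightarrow> int) set set" where
  "lines N n u =
     {{vadd N n a (vscale N n t u) | t. t \<in> carrier (ZN N)} | a. a \<in> vecs N n}"

definition ell_norm :: "ereal \<Rightarrow> 'a set \<Rightarrow> ('a \<Rightarrow> real) \<Rightarrow> real" where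
  "ell_norm s A h =
     (if s = \<infinity> then (SUP x\<in>A. \<bar>h x\<bar>)
      else (\<Sum>x\<in>A. \<bar>h x\<bar> powr real_of_ereal s) powr (1 / real_of_ereal s))"

definition maximal_exponent :: "nat \<Rightarrow> ereal" where
  "maximal_exponent n = (if n = 1 then \<infinity> else ereal (real n / (real n - 1)))"

end

(*
  By duality and Hoelder, the theorem follows from the bound
    sum_u (f^* u)^n <= K(N) phi(N) N^(n-1) sum_x f(x)^n
  for the maximal function f^* u = max_a sum_t f(a + t u), with u ranging over all unimodular
  vectors. The Chinese remainder theorem turns a line modulo N1 N2 into a product of lines, so that
  f^*(u1,u2) <= (g_{u1})^*(u2) with g_{u1}(x2) = (f(.,x2))^*(u1), and K is submultiplicative on coprime
  moduli. Hence K(q) = O(polylog q) for prime powers q = p^k suffices.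

  For a prime power, let E contain m points of a line in every direction u with u_i = 1. Put z = 1 + X.
  By pigeonhole there are coefficients c_v, not all 0 modulo (p, X), such that
  P = sum_v c_v x^v (with 0 <= v_j <= d and (d+1)^n > 2|E|) vanishes modulo (p, X^q) at all points
  (z^(x_1), ..., z^(x_n)), x in E; note that z^q = 1 modulo (p, X^q). On the line a + t u, Newton
  interpolation at greedily chosen nodes z^t shows that the polynomial Q(w) = P(z^a w^u) is, modulo
  (p, X), divisible by (w - 1)^m', where m' is m up to a factor k + 1. The nodes are controlled by
  z^s - z^t having order gcd(s - t, q), and sum_(s<q) gcd(s, q) <= (k + 1) q. So the reduction of P
  vanishes to order m' on every curve y -> ((1 + y)^(u_j))_j; a second interpolation, in the variables
  u_j, forces P = 0 modulo (p, X) unless m <= 2 n (k + 1)^2 d.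

  A set of directions of density alpha is reduced to all directions by covering them with
  O(log q / alpha) translates, which are realised by shears.
*)
theory Submission
  imports Defs "HOL-Computational_Algebra.Formal_Power_Series" "HOL-Computational_Algebra.Polynomial"
    "HOL-Analysis.Harmonic_Numbers"
begin

text \<open>For k >= 2 the polynomial p^(k-1) (x^p - x) vanishes on all of \<int>/p^k, so counting
  zeros against degrees fails there. The map t -> z^t repairs this: it embeds \<int>/q into the
  units of F_p[X]/(X^q), a quotient of a domain in which the X-adic order measures closeness, and it
  turns a + t u into the curve w -> (z^(a_j) w^(u_j))_j with w = z^t. The price is that the nodes
  z^t are X-adically close to each other, so interpolation spends order at every node; the gcd sum
  says that an earlier node costs at most k + 1 on average over \<int>/q. When X is finally put to
  0, the base point disappears, because z^(a_j) becomes 1: all lines then give conditions at the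
  single point (1, ..., 1), along curves that depend on the direction only. This is why the
  arbitrary position of the lines does no harm. The maximal bound is proved for all nonnegative
  functions and not only for sets, since the product argument feeds the maximal function of one
  factor into that of the other.\<close>

unbundle no vec_syntax
unbundle fps_syntax

section \<open>Vanishing order modulo a prime\<close>

text \<open>
  Order of vanishing at least \<open>R\<close> in the power series ring over the field with \<open>p\<close> elements.
  Integer series represent that ring, because this field is not available as a type for variable \<open>p\<close>.
\<close>

definition van :: "nat \<Rightarrow> nat \<Rightarrow> int fps \<Rightarrow> bool" where
  "van p R f \<longleftrightarrow> (\<forall>j<R. int p dvd fps_nth f j)"

definition exact_order :: "nat \<Rightarrow> nat \<Rightarrow> int fps \<Rightarrow> bool" where
  "exact_order p r f \<longleftrightarrow> van p r f \<and> \<not> int p dvd fps_nth f r"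

lemma van_0 [simp]: "van p R 0" "van p 0 f"
  by (auto simp: van_def)

lemma van_add: "van p R f \<Longrightarrow> van p R g \<Longrightarrow> van p R (f + g)"
  by (auto simp: van_def)

lemma van_diff: "van p R f \<Longrightarrow> van p R g \<Longrightarrow> van p R (f - g)"
  by (auto simp: van_def)

lemma van_sum: "(\<And>x. x \<in> A \<Longrightarrow> van p R (f x)) \<Longrightarrow> van p R (sum f A)"
  by (induction A rule: infinite_finite_induct) (auto intro: van_add)

lemma van_mono: "van p R f \<Longrightarrow> S \<le> R \<Longrightarrow> van p S f"
  by (auto simp: van_def)

lemma van_mult: "van p R f \<Longrightarrow> van p S g \<Longrightarrow> van p (R + S) (f * g)"
  unfolding van_def fps_mult_nth
proof (intro allI impI dvd_sum)
  fix j i assume "\<forall>j<R. int p dvd f $ j" "\<forall>j<S. int p dvd g $ j" "j < R + S" "i \<in> {0..j}"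
  then show "int p dvd f $ i * g $ (j - i)"
    by (cases "i < R") auto
qed

lemma van_mult_right: "van p R f \<Longrightarrow> van p R (f * g)"
  using van_mult[of p R f 0 g] by simp

lemma van_mult_left: "van p R g \<Longrightarrow> van p R (f * g)"
  using van_mult[of p 0 f R g] by simp

lemma exact_order_mult:
  assumes "prime p" "exact_order p r f" "exact_order p s g"
  shows "exact_order p (r + s) (f * g)"
proof -
  have "(f * g) $ (r + s) = (\<Sum>i=0..r+s. f $ i * g $ (r + s - i))"
    by (simp add: fps_mult_nth)
  also have "\<dots> = f $ r * g $ s + (\<Sum>i\<in>{0..r+s} - {r}. f $ i * g $ (r + s - i))"
    by (subst sum.remove[of _ r]) auto
  finally have eq: "(f * g) $ (r + s) = f $ r * g $ s + (\<Sum>i\<in>{0..r+s} - {r}. f $ i * g $ (r + s - i))" .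
  have "int p dvd (\<Sum>i\<in>{0..r+s} - {r}. f $ i * g $ (r + s - i))"
  proof (rule dvd_sum)
    fix i assume i: "i \<in> {0..r+s} - {r}"
    show "int p dvd f $ i * g $ (r + s - i)"
    proof (cases "i < r")
      case True then show ?thesis using assms by (auto simp: exact_order_def van_def)
    next
      case False
      then have "r + s - i < s" using i by auto
      then show ?thesis using assms by (auto simp: exact_order_def van_def)
    qed
  qed
  moreover have "\<not> int p dvd f $ r * g $ s"
    using assms by (auto simp: exact_order_def prime_dvd_mult_iff)
  ultimately show ?thesis
    using assms van_mult[of p r f s g] unfolding exact_order_def eq
    by (metis dvd_add_left_iff)
qed

lemma exact_order_1: "prime p \<Longrightarrow> exact_order p 0 1"
  by (auto simp: exact_order_def)

lemma exact_order_prod: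
  assumes "prime p" "\<And>x. x \<in> A \<Longrightarrow> exact_order p (r x) (f x)"
  shows "exact_order p (sum r A) (prod f A)"
  using assms(2)
  by (induction A rule: infinite_finite_induct)
     (auto intro: exact_order_mult exact_order_1 assms(1))

text \<open>Leading coefficients modulo \<open>p\<close> have a nonzero product, so orders add
  exactly and a known order can be cancelled.\<close>

lemma van_cancel:
  assumes "prime p" "exact_order p r f" "van p (r + s) (f * g)"
  shows "van p s g"
proof (rule ccontr)
  assume "\<not> van p s g"
  then have ex: "\<exists>j. j < s \<and> \<not> int p dvd g $ j" by (auto simp: van_def)
  define j where "j = (LEAST j. j < s \<and> \<not> int p dvd g $ j)"
  have j: "j < s \<and> \<not> int p dvd g $ j" unfolding j_def using ex by (rule LeastI_ex)
  have "int p dvd g $ i" if "i < j" for i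
    using not_less_Least[of i "\<lambda>j. j < s \<and> \<not> int p dvd g $ j"] that j unfolding j_def[symmetric]
    by auto
  then have "exact_order p j g" using j by (auto simp: exact_order_def van_def)
  from exact_order_mult[OF assms(1,2) this] have "\<not> int p dvd (f * g) $ (r + j)"
    by (auto simp: exact_order_def)
  then show False using assms(3) j by (auto simp: van_def)
qed

section \<open>Orders of differences of powers of 1 + X\<close>

abbreviation zfps :: "int fps" where "zfps \<equiv> 1 + fps_X"

lemma exact_order_unit: "prime p \<Longrightarrow> exact_order p 0 (zfps ^ t)"
  by (auto simp: exact_order_def fps_power_zeroth)

lemma zfps_power_nth: "(zfps ^ t) $ j = int (t choose j)"
proof (induction t arbitrary: j)
  case (Suc t)
  then show ?case
    by (cases j) (simp_all add: algebra_simps)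
qed (auto simp: binomial_eq_0)

text \<open>Frobenius: modulo \<open>p\<close>, \<open>h ^ p - 1\<close> is
  \<open>(h - 1) ^ p\<close>, because the inner binomial coefficients vanish.\<close>

lemma exact_order_power_prime:
  assumes p: "prime p" and o: "exact_order p r (h - 1)"
  shows "exact_order p (p * r) (h ^ p - 1)"
proof -
  define g where "g = h - 1"
  have "h ^ p = (g + 1) ^ p" by (simp add: g_def)
  also have "\<dots> = (\<Sum>k\<le>p. of_nat (p choose k) * g ^ k)"
    by (subst binomial_ring) simp
  also have "\<dots> = g ^ p + (\<Sum>k<p. of_nat (p choose k) * g ^ k)"
    by (simp flip: lessThan_Suc_atMost)
  also have "(\<Sum>k<p. of_nat (p choose k) * g ^ k) = 1 + (\<Sum>k\<in>{1..<p}. of_nat (p choose k) * g ^ k)"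
    using prime_gt_0_nat[OF p]
    by (simp add: lessThan_atLeast0 sum.atLeast_Suc_lessThan)
  finally have eq: "h ^ p - 1 = g ^ p + (\<Sum>k\<in>{1..<p}. of_nat (p choose k) * g ^ k)" by simp
  have v: "int p dvd (\<Sum>k\<in>{1..<p}. of_nat (p choose k) * g ^ k) $ j" for j
  proof -
    have "int p dvd (of_nat (p choose k) * g ^ k) $ j" if "k \<in> {1..<p}" for k
    proof -
      have "p dvd p choose k" using that p by (intro dvd_choose_prime) auto
      then have "int p dvd int (p choose k)" by simp
      then show ?thesis by (simp add: fps_of_nat[symmetric])
    qed
    then show ?thesis by (auto simp: fps_sum_nth intro!: dvd_sum)
  qed
  have "exact_order p (\<Sum>i<p. r) (\<Prod>i<p. g)"
    using o by (intro exact_order_prod p) (auto simp: g_def)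
  then have "exact_order p (p * r) (g ^ p)" by simp
  then show ?thesis unfolding eq exact_order_def van_def fps_add_nth
    using v by (auto simp: dvd_add_left_iff)
qed

text \<open>For the exponent \<open>b\<close> the coefficient of \<open>X\<close> is
  \<open>b\<close>, which is prime to \<open>p\<close>; each further factor \<open>p\<close> of the
  exponent multiplies the order by \<open>p\<close>.\<close>

lemma exact_order_zfps_power:
  assumes p: "prime p" and "\<not> p dvd b"
  shows "exact_order p (p ^ v) (zfps ^ (p ^ v * b) - 1)"
proof (induction v)
  case 0
  show ?case using assms by (auto simp: exact_order_def van_def zfps_power_nth)
next
  case (Suc v)
  have "zfps ^ (p ^ Suc v * b) = (zfps ^ (p ^ v * b)) ^ p"
    by (simp flip: power_mult add: ac_simps)
  then show ?case using exact_order_power_prime[OF p Suc.IH] by simp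
qed

lemma gcd_prime_power_decompose:
  fixes b :: nat
  assumes p: "prime p" and b: "0 < b" "b < p ^ k"
  obtains v c where "b = p ^ v * c" "\<not> p dvd c" "gcd b (p ^ k) = p ^ v"
proof -
  define v where "v = multiplicity p b"
  obtain c where c: "b = p ^ v * c" "\<not> p dvd c"
    unfolding v_def using b p by (metis multiplicity_decompose' not_prime_unit neq0_conv)
  have "p ^ v \<le> b" using c b by (intro dvd_imp_le) auto
  then have "p ^ v < p ^ k" using b by simp
  then have "v < k" using power_less_imp_less_exp[OF prime_gt_1_nat[OF p]] by blast
  then obtain w where w: "k = v + w" using less_imp_add_positive by blast
  have "coprime c (p ^ w)" using c p by (metis coprime_commute coprime_power_left_iff prime_imp_coprime)
  then have "gcd b (p ^ k) = p ^ v"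
    unfolding c w power_add gcd_mult_left by simp
  then show ?thesis using that c by blast
qed

text \<open>
  The value on the diagonal is \<open>q\<close>, which exceeds every order that occurs; this is what prevents
  the greedy choice of interpolation nodes from repeating a node.
\<close>

definition gdist :: "nat \<Rightarrow> nat \<Rightarrow> nat \<Rightarrow> nat" where
  "gdist q s t = nat (gcd (int s - int t) (int q))"

text \<open>After the unit \<open>zfps ^ t\<close> is factored out, only the power of
  \<open>p\<close> in \<open>s - t\<close> counts; as \<open>s - t\<close> is nonzero and smaller
  than \<open>q\<close>, this power is the gcd with \<open>q\<close>.\<close>

lemma exact_order_zfps_diff:
  assumes p: "prime p" and "s < p ^ k" "t < p ^ k" "s \<noteq> t"
  shows "exact_order p (gdist (p ^ k) s t) (zfps ^ s - zfps ^ t)"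
proof -
  have *: "exact_order p (gdist (p ^ k) s t) (zfps ^ s - zfps ^ t)
         \<and> exact_order p (gdist (p ^ k) t s) (zfps ^ t - zfps ^ s)"
    if st: "t < s" "s < p ^ k" for s t
  proof -
    have "0 < s - t" "s - t < p ^ k" using st by auto
    from gcd_prime_power_decompose[OF p this] obtain v c
      where c: "s - t = p ^ v * c" "\<not> p dvd c" "gcd (s - t) (p ^ k) = p ^ v" by metis
    have s: "s = t + p ^ v * c" using c st by simp
    have g1: "gdist (p ^ k) s t = p ^ v"
    proof -
      have "int s - int t = int (s - t)" using st by simp
      then show ?thesis unfolding gdist_def using c(3) by (simp only: gcd_int_int_eq nat_int)
    qed
    have g2: "gdist (p ^ k) t s = gdist (p ^ k) s t"
      using gcd_neg1_int[of "int s - int t" "int (p ^ k)"] by (simp only: gdist_def minus_diff_eq)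
    have "exact_order p (0 + p ^ v) (zfps ^ t * (zfps ^ (p ^ v * c) - 1))"
      by (intro exact_order_mult exact_order_unit exact_order_zfps_power p c)
    moreover have "zfps ^ t * (zfps ^ (p ^ v * c) - 1) = zfps ^ s - zfps ^ t"
      unfolding s power_add by (simp add: algebra_simps)
    ultimately have 1: "exact_order p (p ^ v) (zfps ^ s - zfps ^ t)" by simp
    then have "exact_order p (p ^ v) (zfps ^ t - zfps ^ s)"
      by (auto simp: exact_order_def van_def dvd_diff_commute)
    with 1 show ?thesis by (simp add: g1 g2)
  qed
  from assms show ?thesis using *[of s t] *[of t s] by (cases s t rule: linorder_cases) auto
qed

text \<open>The gcd is itself one of the powers \<open>p ^ i\<close> that divide
  \<open>s - t\<close>, so it is at most their sum. Each of the \<open>k + 1\<close> exponents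
  \<open>i\<close> contributes at most \<open>p ^ k\<close>, since a residue class modulo
  \<open>p ^ i\<close> has \<open>p ^ (k - i)\<close> members below \<open>p ^ k\<close>.\<close>

lemma sum_gdist_le:
  assumes p: "prime p" and t: "t < p ^ k"
  shows "(\<Sum>s<p ^ k. gdist (p ^ k) s t) \<le> (k + 1) * p ^ k"
proof -
  have "gdist (p ^ k) s t \<le> (\<Sum>i\<le>k. if int (p ^ i) dvd int s - int t then p ^ i else 0)" for s
  proof -
    have "gdist (p ^ k) s t dvd p ^ k"
      by (simp add: gdist_def nat_dvd_iff flip: of_nat_power)
    then obtain i where i: "i \<le> k" "gdist (p ^ k) s t = p ^ i"
      using p divides_primepow_nat by blast
    have "int (gdist (p ^ k) s t) dvd int s - int t" by (simp add: gdist_def)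
    then have "gdist (p ^ k) s t = (if int (p ^ i) dvd int s - int t then p ^ i else 0)" using i by simp
    also have "\<dots> \<le> (\<Sum>i\<le>k. if int (p ^ i) dvd int s - int t then p ^ i else 0)"
      using i by (intro member_le_sum) auto
    finally show ?thesis .
  qed
  then have "(\<Sum>s<p ^ k. gdist (p ^ k) s t)
      \<le> (\<Sum>s<p ^ k. \<Sum>i\<le>k. if int (p ^ i) dvd int s - int t then p ^ i else 0)"
    by (intro sum_mono) auto
  also have "\<dots> = (\<Sum>i\<le>k. \<Sum>s<p ^ k. if int (p ^ i) dvd int s - int t then p ^ i else 0)"
    by (rule sum.swap)
  also have "\<dots> \<le> (\<Sum>i\<le>k. p ^ k)"
  proof (rule sum_mono)
    fix i assume "i \<in> {..k}"
    then obtain j where k: "k = i + j" using le_Suc_ex by auto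
    have pi0: "p ^ i > 0" using p by (simp add: prime_gt_0_nat)
    have "(\<Sum>s<p ^ k. if int (p ^ i) dvd int s - int t then p ^ i else 0)
        = card {s. s < p ^ k \<and> int (p ^ i) dvd int s - int t} * p ^ i"
      by (subst sum.inter_filter[symmetric]) (auto simp: )
    also have "card {s. s < p ^ k \<and> int (p ^ i) dvd int s - int t} \<le> card {..<p ^ j}"
    proof (rule card_inj_on_le[where f = "\<lambda>s. s div p ^ i"])
      show "inj_on (\<lambda>s. s div p ^ i) {s. s < p ^ k \<and> int (p ^ i) dvd int s - int t}"
      proof (rule inj_onI)
        fix x y assume x: "x \<in> {s. s < p ^ k \<and> int (p ^ i) dvd int s - int t}"
          and y: "y \<in> {s. s < p ^ k \<and> int (p ^ i) dvd int s - int t}"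
          and e: "x div p ^ i = y div p ^ i"
        have "int (p ^ i) dvd int x - int t" "int (p ^ i) dvd int y - int t" using x y by blast+
        then have "int (p ^ i) dvd (int x - int t) - (int y - int t)" by (rule dvd_diff)
        then have "int (p ^ i) dvd int x - int y" by simp
        then have "int x mod int (p ^ i) = int y mod int (p ^ i)" by (metis mod_eq_dvd_iff)
        then have "x mod p ^ i = y mod p ^ i" by (metis of_nat_eq_iff zmod_int)
        with e show "x = y" by (metis div_mult_mod_eq)
      qed
      show "(\<lambda>s. s div p ^ i) ` {s. s < p ^ k \<and> int (p ^ i) dvd int s - int t} \<subseteq> {..<p ^ j}"
        using pi0 by (auto simp: k power_add div_less_iff_less_mult ac_simps)
    qed auto
    also have "card {..<p ^ j} * p ^ i = p ^ k" by (simp add: k power_add)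
    finally show "(\<Sum>s<p ^ k. if int (p ^ i) dvd int s - int t then p ^ i else 0) \<le> p ^ k"
      by this auto
  qed
  finally show ?thesis by simp
qed

section \<open>Interpolation\<close>

text \<open>Computing a Newton coefficient means dividing by the product of the differences to the
  earlier nodes, which costs the order of that product. The hypothesis on \<open>d\<close> says that
  the average of this cost over \<open>T\<close> is at most \<open>R - r\<close>; at a cheap node
  the coefficient therefore keeps order \<open>r\<close>, and its term can be moved into
  \<open>Q\<close>.\<close>

lemma newton_expansion:
  fixes f :: "int fps poly"
  assumes p: "prime p" and T: "T \<subseteq> {..<p ^ k}" "T \<noteq> {}"
    and R: "R \<le> p ^ k" and r: "1 \<le> r" "r \<le> R"
    and f: "\<And>t. t \<in> T \<Longrightarrow> van p R (poly f (zfps ^ t))"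
    and d: "\<And>i. i < d \<Longrightarrow> i * ((k + 1) * p ^ k) \<le> (R - r) * card T"
  shows "\<exists>\<tau> H Q. f = (\<Prod>i<d. [:- (zfps ^ \<tau> i), 1:]) * H + Q \<and>
    (\<forall>j. van p r (coeff Q j)) \<and> (H = 0 \<or> degree H + d \<le> degree f)"
proof -
  \<comment> \<open>The induction also carries that the nodes lie in \<open>T\<close> and that the
    part divisible by the node factors still vanishes to order \<open>R\<close> on \<open>T\<close>.
    The latter gives the order of the next Newton coefficient.\<close>
  have "\<exists>\<tau> H Q. f = (\<Prod>i<d. [:- (zfps ^ \<tau> i), 1:]) * H + Q \<and>
    (\<forall>j. van p r (coeff Q j)) \<and> (H = 0 \<or> degree H + d \<le> degree f) \<and> (\<forall>i<d. \<tau> i \<in> T) \<and>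
    (\<forall>t\<in>T. van p R (poly ((\<Prod>i<d. [:- (zfps ^ \<tau> i), 1:]) * H) (zfps ^ t)))"
    using d
  proof (induction d)
    case 0
    show ?case
    proof (rule exI[of _ "\<lambda>_. 0"], rule exI[of _ f], rule exI[of _ 0], intro conjI allI ballI impI)
      show "f = (\<Prod>i<0::nat. [:- (zfps ^ (\<lambda>_. 0::nat) i), 1:]) * f + 0"
        by (simp only: lessThan_0 prod.empty mult_1 add_0_right)
      show "van p r (coeff 0 j)" for j by simp
      show "f = 0 \<or> degree f + 0 \<le> degree f" by simp
      show "(\<lambda>_::nat. 0) i \<in> T" if "i < 0" for i using that by blast
      show "van p R (poly ((\<Prod>i<0::nat. [:- (zfps ^ (\<lambda>_. 0::nat) i), 1:]) * f) (zfps ^ t))" if "t \<in> T" for t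
        using f[OF that] by (simp only: lessThan_0 prod.empty mult_1)
    qed
  next
    case (Suc d)
    define q where "q = p ^ k"
    have "\<And>i. i < d \<Longrightarrow> i * ((k + 1) * p ^ k) \<le> (R - r) * card T"
      by (rule Suc.prems) simp
    from Suc.IH[OF this] obtain \<tau> H Q where
      fe: "f = (\<Prod>i<d. [:- (zfps ^ \<tau> i), 1:]) * H + Q" and
      Q: "\<And>j. van p r (coeff Q j)" and dg: "H = 0 \<or> degree H + d \<le> degree f" and
      \<tau>: "\<And>i. i < d \<Longrightarrow> \<tau> i \<in> T" and
      v: "\<And>t. t \<in> T \<Longrightarrow> van p R (poly ((\<Prod>i<d. [:- (zfps ^ \<tau> i), 1:]) * H) (zfps ^ t))"
      by blast
    define W where "W t = (\<Prod>i<d. zfps ^ t - zfps ^ \<tau> i)" for t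
    define P where "P = (\<Prod>i<d. [:- (zfps ^ \<tau> i), 1:])"
    have PW: "poly P (zfps ^ t) = W t" for t
      by (simp add: P_def W_def poly_prod)
    define S where "S t = (\<Sum>i<d. gdist q t (\<tau> i))" for t
    have finT: "finite T" using T finite_subset by blast
    \<comment> \<open>By minimality of \<open>S t0\<close>, \<open>W\<close> vanishes to order \<open>S t0\<close> at all of \<open>T\<close>, so subtracting the new
      Newton term keeps the vanishing on \<open>T\<close>.\<close>
    from ex_is_arg_min_if_finite[OF this T(2)] obtain t0 where t0: "t0 \<in> T" "\<And>t. t \<in> T \<Longrightarrow> S t0 \<le> S t"
      unfolding is_arg_min_def by (metis leI)
    \<comment> \<open>The minimum is at most the mean over \<open>T\<close>, and the gcd sum around
      each earlier node bounds the mean.\<close>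
    have "card T * S t0 \<le> (\<Sum>t\<in>T. S t)"
      using t0(2) sum_bounded_below[of T "S t0" S] by simp
    also have "\<dots> = (\<Sum>i<d. \<Sum>t\<in>T. gdist q t (\<tau> i))"
      unfolding S_def by (rule sum.swap)
    also have "\<dots> \<le> (\<Sum>i<d. (k + 1) * q)"
    proof (rule sum_mono)
      fix i assume "i \<in> {..<d}"
      then have "\<tau> i < p ^ k" using \<tau> T by auto
      from sum_gdist_le[OF p this] have "(\<Sum>t<q. gdist q t (\<tau> i)) \<le> (k + 1) * q" by (simp add: q_def)
      moreover have "(\<Sum>t\<in>T. gdist q t (\<tau> i)) \<le> (\<Sum>t<q. gdist q t (\<tau> i))"
        using T by (intro sum_mono2) (auto simp: q_def)
      ultimately show "(\<Sum>t\<in>T. gdist q t (\<tau> i)) \<le> (k + 1) * q" by simp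
    qed
    also have "\<dots> \<le> (R - r) * card T" using Suc.prems[of d] by (simp add: q_def)
    finally have S0: "S t0 \<le> R - r"
      using finT T(2) by (simp add: mult.commute[of "card T"] card_gt_0_iff)
    have S_notin: "t \<notin> \<tau> ` {..<d}" if "S t < q" for t
    proof
      assume "t \<in> \<tau> ` {..<d}"
      then obtain i where i: "i < d" "t = \<tau> i" by auto
      have "gdist q t (\<tau> i) = q" using i by (simp add: gdist_def)
      moreover have "gdist q t (\<tau> i) \<le> S t" unfolding S_def using i by (intro member_le_sum) auto
      ultimately show False using that by simp
    qed
    have exW: "exact_order p (S t) (W t)" if "t \<in> T" "t \<notin> \<tau> ` {..<d}" for t
      unfolding S_def W_def q_def
    proof (rule exact_order_prod[OF p])
      fix i assume i: "i \<in> {..<d}"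
      then have "\<tau> i < p ^ k" "t < p ^ k" "t \<noteq> \<tau> i" using \<tau> that T by auto
      then show "exact_order p (gdist (p ^ k) t (\<tau> i)) (zfps ^ t - zfps ^ \<tau> i)"
        by (intro exact_order_zfps_diff p)
    qed
    have vW: "van p (S t0) (W t)" if "t \<in> T" for t
    proof (cases "t \<in> \<tau> ` {..<d}")
      case True
      then have "W t = 0" by (auto simp: W_def)
      then show ?thesis by simp
    next
      case False
      then show ?thesis using exW[OF that] t0(2)[OF that] by (auto simp: exact_order_def intro: van_mono)
    qed
    define h0 where "h0 = poly H (zfps ^ t0)"
    define H' where "H' = synthetic_div H (zfps ^ t0)"
    have H: "H = [:- (zfps ^ t0), 1:] * H' + [:h0:]"
      unfolding h0_def H'_def by (rule synthetic_div_correct'[symmetric])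
    \<comment> \<open>Here \<open>1 \<le> r\<close> matters: an order strictly below
      \<open>q\<close> shows that \<open>t0\<close> is none of the earlier nodes, so the order of
      \<open>W t0\<close> is exact and can be cancelled.\<close>
    have "S t0 < q" using S0 r R by (simp add: q_def)
    then have ex0: "exact_order p (S t0) (W t0)" using exW[OF t0(1)] S_notin by auto
    have SR: "S t0 + (R - S t0) = R" using S0 by simp
    have "van p (S t0 + (R - S t0)) (W t0 * h0)"
      using v[OF t0(1)] unfolding SR P_def[symmetric] h0_def by (simp add: PW)
    then have vh: "van p (R - S t0) h0" by (rule van_cancel[OF p ex0])
    have vh': "van p r h0" by (rule van_mono[OF vh]) (use S0 r in simp)
    define \<tau>' where "\<tau>' = \<tau>(d := t0)"
    have P': "(\<Prod>i<Suc d. [:- (zfps ^ \<tau>' i), 1:]) = P * [:- (zfps ^ t0), 1:]"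
      by (simp add: \<tau>'_def P_def)
    show ?case
    proof (intro exI conjI allI ballI impI)
      have "f = P * ([:- (zfps ^ t0), 1:] * H' + [:h0:]) + Q" using fe H unfolding P_def[symmetric] by metis
      also have "\<dots> = (\<Prod>i<Suc d. [:- (zfps ^ \<tau>' i), 1:]) * H' + (Q + smult h0 P)"
        unfolding P' by (simp add: algebra_simps)
      finally show "f = (\<Prod>i<Suc d. [:- (zfps ^ \<tau>' i), 1:]) * H' + (Q + smult h0 P)" .
      show "van p r (coeff (Q + smult h0 P) j)" for j
        using Q vh' by (auto intro: van_add van_mult_right)
      show "H' = 0 \<or> degree H' + Suc d \<le> degree f"
      proof (cases "degree H = 0")
        case True then show ?thesis by (simp add: H'_def synthetic_div_eq_0_iff)
      next
        case False then show ?thesis using dg by (auto simp: H'_def degree_synthetic_div)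
      qed
      show "\<tau>' i \<in> T" if "i < Suc d" for i using that \<tau> t0 by (auto simp: \<tau>'_def less_Suc_eq)
      show "van p R (poly ((\<Prod>i<Suc d. [:- (zfps ^ \<tau>' i), 1:]) * H') (zfps ^ t))" if "t \<in> T" for t
      proof -
        have "poly ((\<Prod>i<Suc d. [:- (zfps ^ \<tau>' i), 1:]) * H') (zfps ^ t) =
              poly (P * H) (zfps ^ t) - W t * h0"
          unfolding P' H by (simp add: PW[symmetric] algebra_simps)
        moreover have "van p R (W t * h0)" using van_mult[OF vW[OF that] vh] by (simp only: SR)
        ultimately show ?thesis using v[OF that] by (auto simp: P_def intro: van_diff)
      qed
    qed
  qed
  then show ?thesis by blast
qed

text \<open>With \<open>d + 1\<close> nodes and degree at most \<open>d\<close> the quotient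
  \<open>H\<close> is 0, so \<open>f\<close> is the remainder \<open>Q\<close>. With all residues
  available as nodes, up to \<open>d\<close> earlier nodes cost at most \<open>d * (k + 1)\<close>
  on average, and this is the loss of order.\<close>

lemma coeffs_van_interpolation:
  fixes f :: "int fps poly"
  assumes p: "prime p" and R: "R \<le> p ^ k" "d * (k + 1) < R" and dg: "degree f \<le> d"
    and f: "\<And>t. t < p ^ k \<Longrightarrow> van p R (poly f (zfps ^ t))"
  shows "van p (R - d * (k + 1)) (coeff f j)"
proof -
  have "\<exists>\<tau> H Q. f = (\<Prod>i<Suc d. [:- (zfps ^ \<tau> i), 1:]) * H + Q \<and>
    (\<forall>j. van p (R - d * (k + 1)) (coeff Q j)) \<and> (H = 0 \<or> degree H + Suc d \<le> degree f)"
  proof (rule newton_expansion[where T = "{..<p ^ k}" and R = R and k = k])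
    show "i * ((k + 1) * p ^ k) \<le> (R - (R - d * (k + 1))) * card {..<p ^ k}" if "i < Suc d" for i
    proof -
      have "R - (R - d * (k + 1)) = d * (k + 1)" using R by simp
      moreover have "i * ((k + 1) * p ^ k) \<le> d * ((k + 1) * p ^ k)" using that by (intro mult_right_mono) auto
      ultimately show ?thesis by (simp only: card_lessThan mult.assoc)
    qed
    have "0 < p ^ k" using prime_gt_0_nat[OF p] by simp
    then show "{..<p ^ k} \<noteq> {}" by blast
  qed (use assms in auto)
  then show ?thesis using dg by auto
qed

text \<open>One variable at a time: with the others frozen, the sum is a polynomial in
  \<open>zfps ^ t\<close>, and passing to its coefficients costs \<open>d * (k + 1)\<close>.\<close>

lemma coeffs_van_interpolation_multi:
  assumes p: "prime p" and J: "finite J"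
  shows "R \<le> p ^ k \<Longrightarrow> card J * (d * (k + 1)) < R \<Longrightarrow>
    (\<And>u. u \<in> J \<rightarrow>\<^sub>E {..<p ^ k} \<Longrightarrow>
       van p R (\<Sum>v\<in>J \<rightarrow>\<^sub>E {..d}. A v * (\<Prod>j\<in>J. zfps ^ (u j * v j)))) \<Longrightarrow>
    v \<in> J \<rightarrow>\<^sub>E {..d} \<Longrightarrow> van p (R - card J * (d * (k + 1))) (A v)"
  using J
proof (induction J arbitrary: R A v rule: finite_induct)
  case empty
  then show ?case by auto
next
  case (insert i J)
  define R' where "R' = R - d * (k + 1)"
  have R': "R' \<le> p ^ k" "card J * (d * (k + 1)) < R'" "d * (k + 1) < R"
    using insert.prems(1,2) insert.hyps by (auto simp: R'_def)
  from insert.prems(4) obtain v' e where v: "v = v'(i := e)" "v' \<in> J \<rightarrow>\<^sub>E {..d}" "e \<le> d"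
    unfolding PiE_insert_eq by auto
  have split: "(\<Sum>v\<in>insert i J \<rightarrow>\<^sub>E {..d}. F v) = (\<Sum>e\<le>d. \<Sum>v\<in>J \<rightarrow>\<^sub>E {..d}. F (v(i := e)))"
    for F :: "_ \<Rightarrow> int fps"
    unfolding PiE_insert_eq sum.cartesian_product
    by (subst sum.reindex[OF inj_combinator[OF insert.hyps(2)]]) (simp add: case_prod_unfold)
  have "van p R' (\<Sum>v\<in>J \<rightarrow>\<^sub>E {..d}. A (v(i := e)) * (\<Prod>j\<in>J. zfps ^ (u j * v j)))"
    if u: "u \<in> J \<rightarrow>\<^sub>E {..<p ^ k}" for u
  proof -
    define B where "B e = (\<Sum>v\<in>J \<rightarrow>\<^sub>E {..d}. A (v(i := e)) * (\<Prod>j\<in>J. zfps ^ (u j * v j)))" for e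
    define f where "f = (\<Sum>e\<le>d. monom (B e) e)"
    have dg: "degree f \<le> d" unfolding f_def
      by (intro degree_sum_le) (auto intro: order.trans[OF degree_monom_le])
    have "van p R (poly f (zfps ^ t))" if t: "t < p ^ k" for t
    proof -
      have "u(i := t) \<in> insert i J \<rightarrow>\<^sub>E {..<p ^ k}" using u t by (intro PiE_fun_upd) auto
      from insert.prems(3)[OF this] have "van p R (\<Sum>e\<le>d. \<Sum>v\<in>J \<rightarrow>\<^sub>E {..d}.
         A (v(i := e)) * (\<Prod>j\<in>insert i J. zfps ^ ((u(i := t)) j * (v(i := e)) j)))"
        unfolding split .
      also have "(\<Sum>e\<le>d. \<Sum>v\<in>J \<rightarrow>\<^sub>E {..d}.
         A (v(i := e)) * (\<Prod>j\<in>insert i J. zfps ^ ((u(i := t)) j * (v(i := e)) j))) = poly f (zfps ^ t)"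
        unfolding f_def poly_sum poly_monom B_def sum_distrib_right
      proof (intro sum.cong refl)
        fix e v
        have "(\<Prod>j\<in>J. zfps ^ ((u(i := t)) j * (v(i := e)) j)) = (\<Prod>j\<in>J. zfps ^ (u j * v j))"
          using insert.hyps by (intro prod.cong) auto
        then show "A (v(i := e)) * (\<Prod>j\<in>insert i J. zfps ^ ((u(i := t)) j * (v(i := e)) j)) =
           A (v(i := e)) * (\<Prod>j\<in>J. zfps ^ (u j * v j)) * (zfps ^ t) ^ e"
          using insert.hyps by (simp add: power_mult)
      qed
      finally show ?thesis .
    qed
    from coeffs_van_interpolation[OF p insert.prems(1) R'(3) dg this]
    have "van p R' (coeff f e)" by (simp add: R'_def)
    moreover have "coeff f e = B e" using v(3) by (simp add: f_def coeff_sum)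
    ultimately show ?thesis by (simp add: B_def)
  qed
  from insert.IH[OF R'(1,2) this v(2)] have "van p (R' - card J * (d * (k + 1))) (A v)"
    by (simp only: v(1))
  then show ?case using insert.hyps by (simp add: R'_def)
qed

section \<open>Reduction to multiplicity at one\<close>

text \<open>Siegel's lemma by counting: \<open>p ^ (card V * q)\<close> coefficient vectors,
  truncated at \<open>X ^ q\<close>, have at most \<open>p ^ (card E * (2 * q))\<close> value
  vectors. The doubled precision is the origin of the 2 in
  \<open>2 * card E < card V\<close>.\<close>

lemma siegel_fps:
  fixes M :: "'x \<Rightarrow> 'v \<Rightarrow> int fps"
  assumes fin: "finite V" "finite E" and c: "2 * card E < card V" and p: "2 \<le> p" and q: "1 \<le> q"
  shows "\<exists>c. (\<forall>x\<in>E. van p q (\<Sum>v\<in>V. c v * M x v)) \<and> (\<exists>v\<in>V. \<not> int p dvd c v $ 0)"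
proof -
  define \<Gamma> where "\<Gamma> = V \<times> {..<q} \<rightarrow>\<^sub>E {0..<int p}"
  define Out where "Out = E \<times> {..<2 * q} \<rightarrow>\<^sub>E {0..<int p}"
  define C where "C \<gamma> v = Abs_fps (\<lambda>j. if j < q then \<gamma> (v, j) else 0)" for \<gamma> :: "'v \<times> nat \<Rightarrow> int" and v
  \<comment> \<open>Precision \<open>2 * q\<close>, because a power of \<open>X\<close> below \<open>q\<close> is divided out of the solution.\<close>
  define \<Phi> where "\<Phi> \<gamma> = (\<lambda>(x, j)\<in>E \<times> {..<2 * q}. (\<Sum>v\<in>V. C \<gamma> v * M x v) $ j mod int p)" for \<gamma>
  have fO: "finite Out" unfolding Out_def using fin by (intro finite_PiE) auto
  have "card Out = p ^ (card E * (2 * q))"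
    unfolding Out_def using fin by (subst card_funcsetE) (auto simp: card_cartesian_product)
  also have "\<dots> < p ^ (card V * q)" using c p q by (intro power_strict_increasing) auto
  also have "\<dots> = card \<Gamma>"
    unfolding \<Gamma>_def using fin by (subst card_funcsetE) (auto simp: card_cartesian_product)
  finally have card: "card Out < card \<Gamma>" .
  have "\<Phi> ` \<Gamma> \<subseteq> Out" unfolding \<Phi>_def Out_def case_prod_unfold using p
    by (intro image_subsetI restrict_PiE_iff[THEN iffD2]) auto
  then have "card (\<Phi> ` \<Gamma>) \<le> card Out" using fO by (rule card_mono[rotated])
  then have "\<not> inj_on \<Phi> \<Gamma>" using card by (auto dest: card_image)
  then obtain \<gamma> \<gamma>' where g: "\<gamma> \<in> \<Gamma>" "\<gamma>' \<in> \<Gamma>" "\<Phi> \<gamma> = \<Phi> \<gamma>'" "\<gamma> \<noteq> \<gamma>'" by (auto simp: inj_on_def)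
  from g(1,2,4) obtain w where "w \<in> V \<times> {..<q}" "\<gamma> w \<noteq> \<gamma>' w" unfolding \<Gamma>_def by (metis PiE_ext)
  then have ex: "\<exists>j. j < q \<and> (\<exists>v\<in>V. \<gamma> (v, j) \<noteq> \<gamma>' (v, j))" by (cases w) auto
  \<comment> \<open>The lowest power of \<open>X\<close> at which the two colliding vectors differ.
    Dividing the difference by \<open>fps_X ^ s\<close> moves this place to the constant term, where
    two distinct digits below \<open>p\<close> differ by a non-multiple of \<open>p\<close>.\<close>
  define s where "s = (LEAST j. j < q \<and> (\<exists>v\<in>V. \<gamma> (v, j) \<noteq> \<gamma>' (v, j)))"
  have s: "s < q \<and> (\<exists>v\<in>V. \<gamma> (v, s) \<noteq> \<gamma>' (v, s))" unfolding s_def using ex by (rule LeastI_ex)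
  have small: "\<gamma> (v, j) = \<gamma>' (v, j)" if "j < s" "v \<in> V" for j v
    using not_less_Least[of j "\<lambda>j. j < q \<and> (\<exists>v\<in>V. \<gamma> (v, j) \<noteq> \<gamma>' (v, j))"] that s
    unfolding s_def[symmetric] by auto
  define c where "c v = Abs_fps (\<lambda>j. if s + j < q then \<gamma> (v, s + j) - \<gamma>' (v, s + j) else 0)" for v
  have eq: "C \<gamma> v - C \<gamma>' v = fps_X ^ s * c v" if "v \<in> V" for v
    using small that by (auto simp: fps_eq_iff C_def c_def fps_X_power_mult_nth)
  have "van p q (\<Sum>v\<in>V. c v * M x v)" if x: "x \<in> E" for x
    unfolding van_def
  proof (intro allI impI)
    fix j assume j: "j < q"
    have sum: "fps_X ^ s * (\<Sum>v\<in>V. c v * M x v) = (\<Sum>v\<in>V. C \<gamma> v * M x v) - (\<Sum>v\<in>V. C \<gamma>' v * M x v)"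
      unfolding sum_distrib_left sum_subtractf[symmetric]
      by (intro sum.cong) (simp_all add: mult.assoc[symmetric] eq[symmetric] left_diff_distrib)
    have "\<Phi> \<gamma> (x, s + j) = \<Phi> \<gamma>' (x, s + j)" using g by simp
    then have "int p dvd (\<Sum>v\<in>V. C \<gamma> v * M x v) $ (s + j) - (\<Sum>v\<in>V. C \<gamma>' v * M x v) $ (s + j)"
      using x j s by (simp add: \<Phi>_def mod_eq_dvd_iff)
    also have "\<dots> = (fps_X ^ s * (\<Sum>v\<in>V. c v * M x v)) $ (s + j)" by (simp add: sum)
    also have "\<dots> = (\<Sum>v\<in>V. c v * M x v) $ j" by (simp add: fps_X_power_mult_nth)
    finally show "int p dvd (\<Sum>v\<in>V. c v * M x v) $ j" .
  qed
  moreover obtain v where v: "v \<in> V" "\<gamma> (v, s) \<noteq> \<gamma>' (v, s)" using s by auto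
  have "\<gamma> (v, s) \<in> {0..<int p}" "\<gamma>' (v, s) \<in> {0..<int p}"
    using g(1,2) v s unfolding \<Gamma>_def by (blast intro: PiE_mem)+
  then have "\<not> int p dvd c v $ 0"
    using v s dvd_imp_le_int[of "\<gamma> (v, s) - \<gamma>' (v, s)" "int p"] by (auto simp: c_def)
  ultimately show ?thesis using v by blast
qed

text \<open>Once the coefficients are taken at \<open>X = 0\<close>, the symbol \<open>X\<close> is
  free and is reused for \<open>w - 1\<close>, where \<open>w\<close> is the polynomial variable. So
  \<open>van p D (red f)\<close> says that \<open>(w - 1) ^ D\<close> divides the reduction of
  \<open>f\<close> modulo \<open>p\<close> and \<open>X\<close>.\<close>

definition red :: "int fps poly \<Rightarrow> int fps" where
  "red f = poly (map_poly (\<lambda>g. fps_const (g $ 0)) f) zfps"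

lemma red_0 [simp]: "red 0 = 0" by (simp add: red_def)

lemma red_pCons: "red (pCons a f) = fps_const (a $ 0) + zfps * red f"
  by (simp add: red_def map_poly_pCons)

lemma red_add: "red (f + g) = red f + red g"
proof (induction f g rule: poly_induct2)
  case (pCons a p b q)
  have "red (pCons a p + pCons b q) = fps_const (a $ 0 + b $ 0) + zfps * red (p + q)"
    by (simp only: add_pCons red_pCons fps_add_nth)
  also have "\<dots> = red (pCons a p) + red (pCons b q)"
    unfolding pCons red_pCons by (simp only: fps_const_add[symmetric] distrib_left add_ac)
  finally show ?case .
qed simp

lemma red_sum: "red (sum f A) = (\<Sum>x\<in>A. red (f x))"
  by (induction A rule: infinite_finite_induct) (auto simp: red_add)

lemma red_smult: "red (smult a f) = fps_const (a $ 0) * red f"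
proof (induction f)
  case (pCons b f)
  have "red (smult a (pCons b f)) = fps_const (a $ 0 * b $ 0) + zfps * (fps_const (a $ 0) * red f)"
    by (simp only: smult_pCons red_pCons fps_mult_nth_0 pCons)
  then show ?case
    unfolding red_pCons by (simp only: fps_const_mult[symmetric] distrib_left mult.left_commute)
qed simp

lemma red_mult: "red (f * g) = red f * red g"
proof (induction f)
  case (pCons a f)
  have "red (pCons a f * g) = red (smult a g) + red (pCons 0 (f * g))"
    by (simp only: mult_pCons_left red_add)
  then show ?case
    unfolding red_pCons red_smult pCons by (simp add: distrib_right mult.assoc)
qed simp

lemma red_prod: "red (prod f A) = (\<Prod>x\<in>A. red (f x))"
  by (induction A rule: infinite_finite_induct) (auto simp: red_mult one_pCons red_pCons)

lemma red_monom: "red (monom a e) = fps_const (a $ 0) * zfps ^ e"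
  by (induction e) (auto simp: monom_0 monom_Suc red_pCons)

lemma dvd_red:
  assumes "\<And>j. van p 1 (coeff f j)"
  shows "int p dvd red f $ i"
  using assms
proof (induction f arbitrary: i)
  case (pCons a f)
  have "int p dvd a $ 0" using pCons.prems[of 0] by (simp add: van_def)
  moreover have "int p dvd red f $ j" for j
    by (rule pCons.IH) (metis coeff_pCons_Suc pCons.prems)
  ultimately show ?case by (cases i) (simp_all add: red_pCons algebra_simps)
qed simp

text \<open>All nodes \<open>zfps ^ \<tau> i\<close> become 1 at \<open>X = 0\<close>, so whichever
  nodes were chosen, each Newton factor turns into one factor \<open>w - 1\<close>.\<close>

lemma van_red:
  assumes p: "prime p" and k: "1 \<le> k" and T: "T \<subseteq> {..<p ^ k}" "T \<noteq> {}"
    and f: "\<And>t. t \<in> T \<Longrightarrow> van p (p ^ k) (poly f (zfps ^ t))"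
    and D: "2 * (D - 1) * (k + 1) \<le> card T"
  shows "van p D (red f)"
proof -
  define q where "q = p ^ k"
  have q2: "2 \<le> q" unfolding q_def using p k
    by (metis power_increasing power_one_right prime_ge_2_nat le_trans prime_ge_1_nat)
  have "\<exists>\<tau> H Q. f = (\<Prod>i<D. [:- (zfps ^ \<tau> i), 1:]) * H + Q \<and>
    (\<forall>j. van p 1 (coeff Q j)) \<and> (H = 0 \<or> degree H + D \<le> degree f)"
  proof (rule newton_expansion[OF p T, where R = q])
    fix i assume "i < D"
    then have "(2 * i) * (k + 1) \<le> (2 * (D - 1)) * (k + 1)" by (intro mult_right_mono) auto
    then have i: "2 * (i * (k + 1)) \<le> card T" using D by (simp only: mult.assoc)
    have "i * ((k + 1) * p ^ k) = (i * (k + 1)) * q" by (simp only: q_def mult.assoc)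
    \<comment> \<open>Order 1 must remain out of \<open>q\<close>, so only \<open>q - 1\<close> can
      be spent; the 2 in the hypothesis on \<open>D\<close> compensates through
      \<open>q \<le> 2 * (q - 1)\<close>.\<close>
    also have "\<dots> \<le> (i * (k + 1)) * (2 * (q - 1))" using q2 by (intro mult_left_mono) auto
    also have "\<dots> = (q - 1) * (2 * (i * (k + 1)))" by simp
    also have "\<dots> \<le> (q - 1) * card T" using i by (intro mult_left_mono) auto
    finally show "i * ((k + 1) * p ^ k) \<le> (q - 1) * card T" .
  qed (use f q2 in \<open>auto simp: q_def\<close>)
  then obtain \<tau> H Q where fe: "f = (\<Prod>i<D. [:- (zfps ^ \<tau> i), 1:]) * H + Q"
    and Q: "\<And>j. van p 1 (coeff Q j)" by blast
  have "red [:- (zfps ^ t), 1:] = fps_X" for t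
    by (simp add: red_pCons fps_power_zeroth flip: fps_const_neg)
  then have "red f = fps_X ^ D * red H + red Q"
    unfolding fe by (simp add: red_add red_mult red_prod)
  moreover have "van p D (fps_X ^ D * red H)" by (auto simp: van_def fps_X_power_mult_nth)
  moreover have "van p D (red Q)" using dvd_red[OF Q] by (auto simp: van_def)
  ultimately show ?thesis by (simp add: van_add)
qed

lemma van_prod_diff:
  assumes "\<And>j. j \<in> J \<Longrightarrow> van p R (f j - g j)"
  shows "van p R (prod f J - prod g J)"
  using assms
proof (induction J rule: infinite_finite_induct)
  case (insert x J)
  have "prod f (insert x J) - prod g (insert x J) = (f x - g x) * prod f J + g x * (prod f J - prod g J)"
    using insert.hyps by (simp add: algebra_simps)
  moreover have "van p R (f x - g x)" "van p R (prod f J - prod g J)" using insert by blast+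
  ultimately show ?case by (metis van_add van_mult_left van_mult_right)
qed auto

text \<open>Allows the coordinates of a point on a line to be reduced modulo \<open>p ^ k\<close>
  before evaluation.\<close>

lemma van_zfps_power_mod:
  assumes p: "prime p"
  shows "van p (p ^ k) (zfps ^ s - zfps ^ (s mod p ^ k))"
proof -
  define q b where "q = p ^ k" and "b = s div q"
  have s: "s = q * b + s mod q" by (simp add: b_def)
  have "\<not> p dvd 1" using p by auto
  from exact_order_zfps_power[OF p this, of k] have v: "van p q (zfps ^ q - 1)"
    by (simp add: exact_order_def q_def)
  have "zfps ^ s - zfps ^ (s mod q) = zfps ^ (q * b + s mod q) - zfps ^ (s mod q)" using s by metis
  also have "\<dots> = (\<Prod>i<b. zfps ^ q) * zfps ^ (s mod q) - zfps ^ (s mod q)"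
    by (simp add: power_add power_mult)
  also have "\<dots> = ((\<Prod>i<b. zfps ^ q) - (\<Prod>i<b. 1)) * zfps ^ (s mod q)"
    by (simp add: algebra_simps)
  finally show ?thesis unfolding q_def[symmetric]
    using van_prod_diff[of "{..<b}" p q "\<lambda>_. zfps ^ q" "\<lambda>_. 1"] v by (simp only: van_mult_right)
qed

text \<open>The powers of \<open>1 + X\<close> are unitriangular in the powers of \<open>X\<close>:
  at the largest \<open>m\<close> with \<open>b m\<close> nonzero modulo \<open>p\<close>, the
  coefficient of \<open>X ^ m\<close> is \<open>b m\<close> up to multiples of
  \<open>p\<close>.\<close>

lemma dvd_coeffs_zfps_expansion:
  assumes "van p (d + 1) (\<Sum>e\<le>d. fps_const (b e) * zfps ^ e)" "e \<le> d"
  shows "int p dvd b e"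
proof (rule ccontr)
  assume "\<not> int p dvd b e"
  define M where "M = {e. e \<le> d \<and> \<not> int p dvd b e}"
  have M: "finite M" "M \<noteq> {}" using assms(2) \<open>\<not> int p dvd b e\<close> by (auto simp: M_def)
  define m where "m = Max M"
  have m: "m \<le> d" "\<not> int p dvd b m" using Max_in[OF M] by (auto simp: m_def M_def)
  have big: "int p dvd b e" if "m < e" "e \<le> d" for e
    using Max_ge[OF M(1), of e] that unfolding m_def M_def by fastforce
  have "int p dvd (\<Sum>e\<le>d. fps_const (b e) * zfps ^ e) $ m"
    using assms(1) m(1) by (auto simp: van_def)
  also have "(\<Sum>e\<le>d. fps_const (b e) * zfps ^ e) $ m = (\<Sum>e\<le>d. b e * int (e choose m))"
    by (simp add: fps_sum_nth zfps_power_nth)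
  also have "\<dots> = b m + (\<Sum>e\<in>{..d} - {m}. b e * int (e choose m))"
    using m(1) by (subst sum.remove[of _ m]) auto
  finally have *: "int p dvd b m + (\<Sum>e\<in>{..d} - {m}. b e * int (e choose m))" .
  have "int p dvd (\<Sum>e\<in>{..d} - {m}. b e * int (e choose m))"
  proof (rule dvd_sum)
    fix e assume "e \<in> {..d} - {m}"
    then show "int p dvd b e * int (e choose m)" using big
      by (cases "m < e") (auto simp: binomial_eq_0 not_less nat_less_le)
  qed
  with * m(2) show False by (simp add: dvd_add_left_iff)
qed

section \<open>Kakeya sets over prime powers\<close>

lemma vecs_eq: "vecs N n = {..<n} \<rightarrow>\<^sub>E {0..<int N}"
proof -
  have "{0..int N - 1} = {0..<int N}" by auto
  then show ?thesis by (simp add: vecs_def residue_ring_def)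
qed

definition pt :: "nat \<Rightarrow> nat \<Rightarrow> (nat \<Rightarrow> int) \<Rightarrow> int \<Rightarrow> (nat \<Rightarrow> int) \<Rightarrow> nat \<Rightarrow> int" where
  "pt N n a t u = (\<lambda>i\<in>{..<n}. (a i + t * u i) mod int N)"

text \<open>The value \<open>c = 1\<close> gives the directions normalised at coordinate
  \<open>i\<close>, and \<open>c = 0\<close> the translations between them.\<close>

definition chart :: "nat \<Rightarrow> nat \<Rightarrow> nat \<Rightarrow> int \<Rightarrow> (nat \<Rightarrow> int) set" where
  "chart N n i c = PiE {..<n} (\<lambda>j. if j = i then {c} else {0..<int N})"

lemma prime_power_ge_2:
  assumes "prime (p :: nat)" "1 \<le> k"
  shows "2 \<le> p ^ k"
proof -
  have "2 \<le> p" using assms by (simp add: prime_ge_2_nat)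
  also have "p ^ 1 \<le> p ^ k" using assms prime_ge_1_nat by (intro power_increasing) auto
  finally show ?thesis by simp
qed

lemma prod_zfps_nth_0: "(\<Prod>j\<in>J. zfps ^ g j) $ 0 = 1"
  by (simp only: power_sum[symmetric] zfps_power_nth binomial_n_0 of_nat_1)

lemma kakeya_box_aux:
  assumes p: "prime p" and k: "1 \<le> k" and i: "i < n" and E: "E \<subseteq> vecs (p ^ k) n"
    and card: "2 * card E < (d + 1) ^ n" and m: "1 \<le> m"
    and D: "2 * ((n - 1) * (d * (k + 1)) + d) * (k + 1) \<le> m"
    and line: "\<And>u. u \<in> chart (p ^ k) n i 1 \<Longrightarrow>
      \<exists>a\<in>vecs (p ^ k) n. m \<le> card {t\<in>{0..<int (p ^ k)}. pt (p ^ k) n a t u \<in> E}"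
  shows False
proof -
  define q where "q = p ^ k"
  \<comment> \<open>The \<open>n - 1\<close> interpolations lose \<open>d * (k + 1)\<close> each,
    and order \<open>d + 1\<close> must survive to separate the \<open>d + 1\<close> powers of
    \<open>zfps\<close> that belong to coordinate \<open>i\<close>.\<close>
  define D where "D = (n - 1) * (d * (k + 1)) + d + 1"
  define I where "I = {..<n}"
  define J where "J = I - {i}"
  define V where "V = I \<rightarrow>\<^sub>E {..d}"
  define M where "M x v = (\<Prod>j\<in>I. zfps ^ (nat (x j) * v j))" for x :: "nat \<Rightarrow> int" and v :: "nat \<Rightarrow> nat"
  have q2: "2 \<le> q" unfolding q_def using p k by (rule prime_power_ge_2)
  have finV: "finite V" unfolding V_def I_def by (intro finite_PiE) auto
  have cardV: "card V = (d + 1) ^ n" unfolding V_def I_def by (subst card_funcsetE) auto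
  have finE: "finite E"
    using E unfolding vecs_eq by (rule finite_subset) (intro finite_PiE, auto)
  have q1: "1 \<le> q" and p2: "2 \<le> p" using q2 prime_ge_2_nat[OF p] by auto
  have cardEV: "2 * card E < card V" using card cardV by simp
  from siegel_fps[OF finV finE cardEV p2 q1, of M] obtain c
    where c1: "\<And>x. x \<in> E \<Longrightarrow> van p q (\<Sum>v\<in>V. c v * M x v)"
      and c2: "\<exists>v\<in>V. \<not> int p dvd c v $ 0" by blast
  \<comment> \<open>The bound \<open>m \<le> q\<close> is proved along with it, because it needs a
    direction with its line; later it yields \<open>D \<le> q\<close>, which the interpolation
    requires.\<close>
  have redv: "van p D (\<Sum>v\<in>V. fps_const (c v $ 0) * zfps ^ (\<Sum>j\<in>I. nat (u j) * v j)) \<and> m \<le> q"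
    if u: "u \<in> chart q n i 1" for u
  proof -
    from line[OF u[unfolded q_def], folded q_def] obtain a where a: "a \<in> vecs q n"
      and ma: "m \<le> card {t\<in>{0..<int q}. pt q n a t u \<in> E}" by blast
    define T where "T = {t. t < q \<and> pt q n a (int t) u \<in> E}"
    have "{t\<in>{0..<int q}. pt q n a t u \<in> E} = int ` T"
    proof (intro subset_antisym subsetI)
      fix t assume "t \<in> {t\<in>{0..<int q}. pt q n a t u \<in> E}"
      then have "nat t \<in> T" "int (nat t) = t" by (auto simp: T_def nat_less_iff)
      then show "t \<in> int ` T" by (metis imageI)
    next
      fix t assume "t \<in> int ` T"
      then obtain s where "s \<in> T" "t = int s" by blast
      then show "t \<in> {t\<in>{0..<int q}. pt q n a t u \<in> E}" by (simp add: T_def)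
    qed
    then have mT: "m \<le> card T" using ma by (simp add: card_image)
    have Tq: "T \<subseteq> {..<p ^ k}" by (auto simp: T_def q_def)
    have T0: "T \<noteq> {}" using mT m by auto
    have mq: "m \<le> q" using mT card_mono[OF finite_lessThan Tq] unfolding card_lessThan q_def by (rule le_trans)
    define f where "f = (\<Sum>v\<in>V. monom (c v * (\<Prod>j\<in>I. zfps ^ (nat (a j) * v j))) (\<Sum>j\<in>I. nat (u j) * v j))"
    have "van p (p ^ k) (poly f (zfps ^ t))" if t: "t \<in> T" for t
    proof -
      have nonneg: "0 \<le> a j" "0 \<le> u j" if "j \<in> I" for j
      proof -
        have "a j \<in> {0..<int q}" using a that unfolding vecs_eq I_def by (rule PiE_mem)
        moreover have "u j \<in> (if j = i then {1} else {0..<int q})"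
          using u that unfolding chart_def I_def by (rule PiE_mem)
        ultimately show "0 \<le> a j" "0 \<le> u j" by (auto split: if_splits)
      qed
      have nat_pt: "nat (pt q n a (int t) u j) = (nat (a j) + t * nat (u j)) mod q" if "j \<in> I" for j
      proof -
        have "pt q n a (int t) u j = int ((nat (a j) + t * nat (u j)) mod q)"
        proof -
          have "pt q n a (int t) u j = (a j + int t * u j) mod int q"
            using that by (simp add: pt_def I_def)
          also have "a j + int t * u j = int (nat (a j) + t * nat (u j))"
            using nonneg[OF that] by simp
          finally show ?thesis by (simp only: zmod_int)
        qed
        then show ?thesis by simp
      qed
      have pf: "poly f (zfps ^ t) = (\<Sum>v\<in>V. c v * (\<Prod>j\<in>I. zfps ^ ((nat (a j) + t * nat (u j)) * v j)))"
        unfolding f_def poly_sum poly_monom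
      proof (intro sum.cong refl)
        fix v
        have "(zfps ^ t) ^ (\<Sum>j\<in>I. nat (u j) * v j) = (\<Prod>j\<in>I. zfps ^ (t * nat (u j) * v j))"
          by (simp only: power_mult[symmetric] sum_distrib_left power_sum mult.assoc)
        then have "c v * (\<Prod>j\<in>I. zfps ^ (nat (a j) * v j)) * (zfps ^ t) ^ (\<Sum>j\<in>I. nat (u j) * v j)
           = c v * (\<Prod>j\<in>I. zfps ^ (nat (a j) * v j) * zfps ^ (t * nat (u j) * v j))"
          by (simp only: prod.distrib mult.assoc)
        then show "c v * (\<Prod>j\<in>I. zfps ^ (nat (a j) * v j)) * (zfps ^ t) ^ (\<Sum>j\<in>I. nat (u j) * v j)
           = c v * (\<Prod>j\<in>I. zfps ^ ((nat (a j) + t * nat (u j)) * v j))"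
          by (simp only: power_add[symmetric] distrib_right)
      qed
      \<comment> \<open>Substituting the line gives unreduced exponents; reducing them modulo
        \<open>q\<close> changes each monomial only in order \<open>q\<close>, so vanishing on
        \<open>E\<close> carries over to \<open>f\<close>.\<close>
      have "van p q (poly f (zfps ^ t) - (\<Sum>v\<in>V. c v * M (pt q n a (int t) u) v))"
        unfolding pf M_def sum_subtractf[symmetric] right_diff_distrib[symmetric]
      proof (intro van_sum van_mult_left van_prod_diff)
        fix v :: "nat \<Rightarrow> nat" and j assume j: "j \<in> I"
        let ?s = "nat (a j) + t * nat (u j)"
        have "van p q ((\<Prod>_<v j. zfps ^ ?s) - (\<Prod>_<v j. zfps ^ (?s mod q)))"
          using van_zfps_power_mod[OF p] by (intro van_prod_diff) (simp only: q_def)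
        then show "van p q (zfps ^ (?s * v j) - zfps ^ (nat (pt q n a (int t) u j) * v j))"
          unfolding nat_pt[OF j] by (simp only: prod_constant card_lessThan power_mult)
      qed
      moreover have "van p q (\<Sum>v\<in>V. c v * M (pt q n a (int t) u) v)"
        using t by (intro c1) (auto simp: T_def)
      ultimately have "van p q ((poly f (zfps ^ t) - (\<Sum>v\<in>V. c v * M (pt q n a (int t) u) v))
          + (\<Sum>v\<in>V. c v * M (pt q n a (int t) u) v))"
        by (rule van_add)
      then show ?thesis by (simp only: diff_add_cancel q_def)
    qed
    note v = this
    have "2 * (D - 1) * (k + 1) \<le> card T" using D mT by (simp add: D_def)
    from van_red[OF p k Tq T0 v this] have "van p D (red f)" .
    moreover have "red f = (\<Sum>v\<in>V. fps_const (c v $ 0) * zfps ^ (\<Sum>j\<in>I. nat (u j) * v j))"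
      unfolding f_def red_sum red_monom by (simp add: prod_zfps_nth_0)
    ultimately show ?thesis using mq by simp
  qed
  have "(\<lambda>j\<in>I. if j = i then 1 else 0) \<in> chart q n i 1"
    unfolding chart_def I_def using q2 by (intro restrict_PiE_iff[THEN iffD2]) auto
  with redv have mq: "m \<le> q" by blast
  have "2 * (D - 1) * (k + 1) \<le> q" using D mq by (simp add: D_def)
  moreover have "(2 * (D - 1)) * 2 \<le> (2 * (D - 1)) * (k + 1)" using k by (intro mult_left_mono) auto
  ultimately have "4 * (D - 1) \<le> q" by linarith
  then have Dq: "D \<le> q" using q2 by linarith
  have finJ: "finite J" and iJ: "i \<notin> J" and IJ: "I = insert i J" and cJ: "card J = n - 1"
    using i by (auto simp: I_def J_def)
  \<comment> \<open>Since \<open>u i = 1\<close>, coordinate \<open>i\<close> contributes the fixed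
    power \<open>zfps ^ e\<close>. It is kept inside the coefficient, and only the other coordinates
    of \<open>u\<close> act as variables.\<close>
  define A where "A v = (\<Sum>e\<le>d. fps_const (c (v(i := e)) $ 0) * zfps ^ e)" for v
  have split: "(\<Sum>v\<in>V. F v) = (\<Sum>e\<le>d. \<Sum>v\<in>J \<rightarrow>\<^sub>E {..d}. F (v(i := e)))"
    for F :: "_ \<Rightarrow> int fps"
    unfolding PiE_insert_eq sum.cartesian_product V_def IJ
    by (subst sum.reindex[OF inj_combinator[OF iJ]]) (simp add: case_prod_unfold)
  have vA: "van p (D - card J * (d * (k + 1))) (A v)" if v: "v \<in> J \<rightarrow>\<^sub>E {..d}" for v
  proof (rule coeffs_van_interpolation_multi[OF p finJ _ _ _ v])
    show "D \<le> p ^ k" using Dq by (simp add: q_def)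
    show "card J * (d * (k + 1)) < D" by (simp add: cJ D_def)
    fix w assume w: "w \<in> J \<rightarrow>\<^sub>E {..<p ^ k}"
    define u where "u = (\<lambda>j\<in>I. if j = i then 1 else int (w j))"
    have "u \<in> chart q n i 1" unfolding chart_def u_def I_def[symmetric]
    proof (rule restrict_PiE_iff[THEN iffD2], intro ballI)
      fix j assume "j \<in> I"
      then have "w j < p ^ k" if "j \<noteq> i" using w that IJ by (auto dest: PiE_mem)
      then show "(if j = i then 1 else int (w j)) \<in> (if j = i then {1} else {0..<int q})"
        by (auto simp: q_def simp flip: of_nat_power)
    qed
    then have "van p D (\<Sum>v\<in>V. fps_const (c v $ 0) * zfps ^ (\<Sum>j\<in>I. nat (u j) * v j))" using redv by blast
    also have "(\<Sum>v\<in>V. fps_const (c v $ 0) * zfps ^ (\<Sum>j\<in>I. nat (u j) * v j)) =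
       (\<Sum>v\<in>J \<rightarrow>\<^sub>E {..d}. A v * (\<Prod>j\<in>J. zfps ^ (w j * v j)))"
      unfolding split A_def sum_distrib_right
    proof (subst sum.swap, intro sum.cong refl)
      fix e v
      have "(\<Sum>j\<in>I. nat (u j) * (v(i := e)) j) = e + (\<Sum>j\<in>J. nat (u j) * (v(i := e)) j)"
        using finJ iJ unfolding IJ by (simp add: u_def IJ)
      also have "(\<Sum>j\<in>J. nat (u j) * (v(i := e)) j) = (\<Sum>j\<in>J. w j * v j)"
        using iJ by (intro sum.cong) (auto simp: u_def IJ)
      finally show "fps_const (c (v(i := e)) $ 0) * zfps ^ (\<Sum>j\<in>I. nat (u j) * (v(i := e)) j) =
         fps_const (c (v(i := e)) $ 0) * zfps ^ e * (\<Prod>j\<in>J. zfps ^ (w j * v j))"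
        by (simp only: power_add power_sum mult.assoc)
    qed
    finally show "van p D (\<Sum>v\<in>J \<rightarrow>\<^sub>E {..d}. A v * (\<Prod>j\<in>J. zfps ^ (w j * v j)))" .
  qed
  have D': "D - card J * (d * (k + 1)) = d + 1" by (simp add: D_def cJ)
  from c2 obtain v where v: "v \<in> V" "\<not> int p dvd c v $ 0" by blast
  from v(1) obtain v' e where v': "v = v'(i := e)" "v' \<in> J \<rightarrow>\<^sub>E {..d}" "e \<le> d"
    unfolding V_def IJ PiE_insert_eq by auto
  have "van p (d + 1) (\<Sum>e\<le>d. fps_const (c (v'(i := e)) $ 0) * zfps ^ e)"
    using vA[OF v'(2)] unfolding D' A_def .
  from dvd_coeffs_zfps_expansion[OF this v'(3)] have "int p dvd c (v'(i := e)) $ 0" .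
  then have "int p dvd c v $ 0" by (simp only: v'(1))
  with v(2) show False by contradiction
qed

text \<open>The least \<open>d\<close> that leaves room for the auxiliary polynomial has
  \<open>d ^ n \<le> 2 * card E\<close>. For this \<open>d\<close> the size condition of
  \<open>kakeya_box_aux\<close> must fail, which bounds \<open>m\<close> by
  \<open>2 * n * (k + 1) ^ 2 * d\<close>.\<close>

lemma kakeya_prime_power:
  assumes p: "prime p" and k: "1 \<le> k" and i: "i < n" and E: "E \<subseteq> vecs (p ^ k) n"
    and line: "\<And>u. u \<in> chart (p ^ k) n i 1 \<Longrightarrow>
      \<exists>a\<in>vecs (p ^ k) n. m \<le> card {t\<in>{0..<int (p ^ k)}. pt (p ^ k) n a t u \<in> E}"
  shows "m ^ n \<le> 2 * (2 * n * (k + 1) ^ 2) ^ n * card E"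
proof (cases "m = 0")
  case True then show ?thesis using i by (simp add: power_0_left)
next
  case False
  have ex: "\<exists>d. 2 * card E < (d + 1) ^ n"
  proof
    have "2 * card E < (2 * card E + 1) ^ 1" by simp
    also have "\<dots> \<le> (2 * card E + 1) ^ n" using i by (intro power_increasing) auto
    finally show "2 * card E < (2 * card E + 1) ^ n" .
  qed
  define d where "d = (LEAST d. 2 * card E < (d + 1) ^ n)"
  have d: "2 * card E < (d + 1) ^ n" unfolding d_def by (rule LeastI_ex[OF ex])
  have d2: "d ^ n \<le> 2 * card E"
  proof (cases d)
    case 0 then show ?thesis using i by (simp add: power_0_left)
  next
    case (Suc d')
    then have "\<not> 2 * card E < (d' + 1) ^ n" 
      using not_less_Least[of d' "\<lambda>d. 2 * card E < (d + 1) ^ n"] unfolding d_def[symmetric] by simp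
    then show ?thesis by (simp add: Suc)
  qed
  have "\<not> 2 * ((n - 1) * (d * (k + 1)) + d) * (k + 1) \<le> m"
  proof
    assume *: "2 * ((n - 1) * (d * (k + 1)) + d) * (k + 1) \<le> m"
    have "1 \<le> m" using False by simp
    from kakeya_box_aux[OF p k i E d this * line] show False .
  qed
  then have "m \<le> 2 * ((n - 1) * (d * (k + 1)) + d) * (k + 1)" by simp
  also have "\<dots> \<le> 2 * ((n - 1) * (d * (k + 1)) + d * (k + 1)) * (k + 1)"
    by (intro mult_right_mono mult_left_mono add_left_mono) auto
  also have "(n - 1) * (d * (k + 1)) + d * (k + 1) = n * (d * (k + 1))"
    using i by (cases n) auto
  also have "2 * (n * (d * (k + 1))) * (k + 1) = (2 * n * (k + 1) ^ 2) * d"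
    by (simp only: power2_eq_square mult_ac)
  finally have "m ^ n \<le> ((2 * n * (k + 1) ^ 2) * d) ^ n" by (intro power_mono) auto
  also have "\<dots> = (2 * n * (k + 1) ^ 2) ^ n * d ^ n" by (simp only: power_mult_distrib)
  also have "\<dots> \<le> (2 * n * (k + 1) ^ 2) ^ n * (2 * card E)" using d2 by (rule mult_left_mono) simp
  finally show ?thesis by (simp only: mult_ac)
qed

section \<open>Partial sets of directions\<close>

text \<open>Double counting: every point is hit by a proportion \<alpha> of \<open>G\<close>, so
  some \<open>g\<close> hits at least that proportion of the points still uncovered.\<close>

lemma greedy_cover:
  assumes X: "finite X" and G: "finite G" "G \<noteq> {}" and \<alpha>: "0 < \<alpha>" "\<alpha> \<le> 1"
    and cov: "\<And>x. x \<in> X \<Longrightarrow> \<alpha> * real (card G) \<le> real (card {g\<in>G. Rel g x})"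
  shows "\<exists>S\<subseteq>G. card S \<le> t \<and> real (card {x\<in>X. \<forall>g\<in>S. \<not> Rel g x}) \<le> (1 - \<alpha>) ^ t * real (card X)"
proof (induction t)
  case 0
  show ?case by (intro exI[of _ "{}"]) auto
next
  case (Suc t)
  then obtain S where S: "S \<subseteq> G" "card S \<le> t"
    and le: "real (card {x\<in>X. \<forall>g\<in>S. \<not> Rel g x}) \<le> (1 - \<alpha>) ^ t * real (card X)" by blast
  define Y where "Y = {x\<in>X. \<forall>g\<in>S. \<not> Rel g x}"
  have finY: "finite Y" using X by (simp add: Y_def)
  have "\<exists>g\<in>G. \<alpha> * real (card Y) \<le> real (card {x\<in>Y. Rel g x})"
  proof (rule ccontr)
    assume "\<not> (\<exists>g\<in>G. \<alpha> * real (card Y) \<le> real (card {x\<in>Y. Rel g x}))"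
    then have "(\<Sum>g\<in>G. real (card {x\<in>Y. Rel g x})) < (\<Sum>g\<in>G. \<alpha> * real (card Y))"
      using G by (intro sum_strict_mono) (auto simp: not_le)
    moreover have "(\<Sum>g\<in>G. card {x\<in>Y. Rel g x}) = (\<Sum>x\<in>Y. card {g\<in>G. Rel g x})"
    proof -
      have "(\<Sum>g\<in>G. card {x\<in>Y. Rel g x}) = (\<Sum>g\<in>G. \<Sum>x\<in>Y. if Rel g x then 1 else 0)"
        using finY by (intro sum.cong refl) (simp add: sum.inter_filter[symmetric])
      also have "\<dots> = (\<Sum>x\<in>Y. \<Sum>g\<in>G. if Rel g x then 1 else 0)" by (rule sum.swap)
      also have "\<dots> = (\<Sum>x\<in>Y. card {g\<in>G. Rel g x})"
        using G by (intro sum.cong refl) (simp add: sum.inter_filter[symmetric])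
      finally show ?thesis .
    qed
    then have "(\<Sum>g\<in>G. real (card {x\<in>Y. Rel g x})) = (\<Sum>x\<in>Y. real (card {g\<in>G. Rel g x}))"
      by (simp only: of_nat_sum[symmetric])
    moreover have "(\<Sum>x\<in>Y. \<alpha> * real (card G)) \<le> (\<Sum>x\<in>Y. real (card {g\<in>G. Rel g x}))"
      by (intro sum_mono cov) (auto simp: Y_def)
    ultimately show False by (simp add: mult.commute mult.left_commute)
  qed
  then obtain g where g: "g \<in> G" "\<alpha> * real (card Y) \<le> real (card {x\<in>Y. Rel g x})" by blast
  have eq: "{x\<in>X. \<forall>h\<in>insert g S. \<not> Rel h x} = Y - {x\<in>Y. Rel g x}" by (auto simp: Y_def)
  have "card (Y - {x\<in>Y. Rel g x}) = card Y - card {x\<in>Y. Rel g x}"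
    using finY by (intro card_Diff_subset) auto
  moreover have "card {x\<in>Y. Rel g x} \<le> card Y" using finY by (intro card_mono) auto
  ultimately have "real (card (Y - {x\<in>Y. Rel g x})) = real (card Y) - real (card {x\<in>Y. Rel g x})"
    by simp
  also have "\<dots> \<le> (1 - \<alpha>) * real (card Y)" using g(2) by (simp add: algebra_simps)
  also have "\<dots> \<le> (1 - \<alpha>) * ((1 - \<alpha>) ^ t * real (card X))"
    using le \<alpha> unfolding Y_def by (intro mult_left_mono) auto
  finally have "real (card {x\<in>X. \<forall>h\<in>insert g S. \<not> Rel h x}) \<le> (1 - \<alpha>) ^ Suc t * real (card X)"
    unfolding eq by simp
  moreover have "card (insert g S) \<le> Suc t" using card_insert_le_m1[of "Suc t" S g] S by simp
  ultimately show ?case using S g by (intro exI[of _ "insert g S"]) auto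
qed

lemma small_cover:
  assumes X: "finite X" "X \<noteq> {}" and G: "finite G" "G \<noteq> {}" and \<alpha>: "0 < \<alpha>" "\<alpha> \<le> 1"
    and cov: "\<And>x. x \<in> X \<Longrightarrow> \<alpha> * real (card G) \<le> real (card {g\<in>G. Rel g x})"
  shows "\<exists>S\<subseteq>G. real (card S) \<le> (ln (real (card X)) + 2) / \<alpha> \<and> (\<forall>x\<in>X. \<exists>g\<in>S. Rel g x)"
proof -
  have cX: "1 \<le> real (card X)" using X by (simp add: Suc_le_eq card_gt_0_iff)
  \<comment> \<open>Enough rounds to push \<open>(1 - \<alpha>) ^ t * card X\<close> below 1; the
    \<open>+ 1\<close> makes the inequality strict, so that no point is left.\<close>
  define t where "t = nat \<lceil>ln (real (card X)) / \<alpha>\<rceil> + 1"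
  have pos: "0 \<le> ln (real (card X)) / \<alpha>" using cX \<alpha> by simp
  have t1: "ln (real (card X)) / \<alpha> < real t" unfolding t_def using pos by linarith
  have "real t \<le> ln (real (card X)) / \<alpha> + 2" unfolding t_def using pos by linarith
  also have "\<dots> \<le> ln (real (card X)) / \<alpha> + 2 / \<alpha>" using \<alpha> by (simp add: field_simps)
  finally have t2: "real t \<le> (ln (real (card X)) + 2) / \<alpha>" by (simp add: add_divide_distrib)
  from greedy_cover[where Rel = Rel and t = t, OF X(1) G \<alpha> cov] obtain S where S: "S \<subseteq> G" "card S \<le> t"
    and le: "real (card {x\<in>X. \<forall>g\<in>S. \<not> Rel g x}) \<le> (1 - \<alpha>) ^ t * real (card X)" by auto
  have "(1 - \<alpha>) ^ t \<le> exp (- \<alpha>) ^ t"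
    using \<alpha> exp_ge_add_one_self[of "- \<alpha>"] by (intro power_mono) auto
  also have "\<dots> = exp (- \<alpha> * real t)" by (simp add: exp_of_nat_mult[symmetric] mult.commute)
  also have "\<dots> < exp (- ln (real (card X)))" using t1 \<alpha> by (simp add: field_simps)
  also have "\<dots> = 1 / real (card X)" using cX by (simp add: exp_minus inverse_eq_divide)
  finally have "(1 - \<alpha>) ^ t * real (card X) < 1" using cX by (simp add: field_simps)
  with le have "card {x\<in>X. \<forall>g\<in>S. \<not> Rel g x} = 0" by simp
  then have "{x\<in>X. \<forall>g\<in>S. \<not> Rel g x} = {}" using X by auto
  moreover have "real (card S) \<le> (ln (real (card X)) + 2) / \<alpha>" using S t2 by linarith
  ultimately show ?thesis using S by blast
qed

section \<open>Charts of directions and shears\<close>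

lemma chart_subset_vecs: "0 \<le> c \<Longrightarrow> c < int N \<Longrightarrow> chart N n i c \<subseteq> vecs N n"
  unfolding chart_def vecs_eq by (intro PiE_mono) auto

lemma finite_vecs [simp]: "finite (vecs N n)"
  unfolding vecs_eq by (intro finite_PiE) auto

lemma finite_chart [simp]: "finite (chart N n i c)"
  unfolding chart_def by (intro finite_PiE) auto

lemma card_chart:
  assumes "i < n" shows "card (chart N n i c) = N ^ (n - 1)"
proof -
  have "card (chart N n i c) = (\<Prod>j<n. card (if j = i then {c} else {0..<int N}))"
    unfolding chart_def by (subst card_PiE) auto
  also have "\<dots> = (\<Prod>j\<in>{..<n} - {i}. card (if j = i then {c} else {0..<int N}))"
    using assms by (subst prod.remove[of _ i]) auto
  also have "\<dots> = (\<Prod>j\<in>{..<n} - {i}. N)" by (intro prod.cong) auto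
  finally show ?thesis using assms by simp
qed

lemma pt_in_vecs: "1 \<le> N \<Longrightarrow> pt N n a t u \<in> vecs N n"
  unfolding pt_def vecs_eq by (intro restrict_PiE_iff[THEN iffD2]) auto

text \<open>A linear map that acts on vectors with \<open>x i = 1\<close> as translation by
  \<open>g\<close>. It translates normalised directions and at the same time carries lines to lines,
  which a translation of the directions alone would not do.\<close>

definition shear :: "nat \<Rightarrow> nat \<Rightarrow> nat \<Rightarrow> (nat \<Rightarrow> int) \<Rightarrow> (nat \<Rightarrow> int) \<Rightarrow> nat \<Rightarrow> int" where
  "shear N n i g x = (\<lambda>j\<in>{..<n}. (x j + x i * g j) mod int N)"

lemma shear_in_vecs: "1 \<le> N \<Longrightarrow> shear N n i g x \<in> vecs N n"
  unfolding shear_def vecs_eq by (intro restrict_PiE_iff[THEN iffD2]) auto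

lemma pt_shear:
  assumes "i < n"
  shows "pt N n (shear N n i g a) t (shear N n i g w) = shear N n i g (pt N n a t w)"
proof (rule ext)
  fix j
  show "pt N n (shear N n i g a) t (shear N n i g w) j = shear N n i g (pt N n a t w) j"
  proof (cases "j < n")
    case True
    define r where "r = (a j + t * w j) + (a i + t * w i) * g j"
    have r': "r = (a j + a i * g j) + t * (w j + w i * g j)" by (simp add: r_def algebra_simps)
    have "pt N n (shear N n i g a) t (shear N n i g w) j =
        ((a j + a i * g j) mod int N + t * ((w j + w i * g j) mod int N)) mod int N"
      using True by (simp only: pt_def shear_def restrict_apply lessThan_iff if_True)
    also have "\<dots> = r mod int N"
      unfolding r' by (rule mod_add_cong) (simp_all add: mod_mult_right_eq)
    also have "r mod int N = ((a j + t * w j) mod int N + (a i + t * w i) mod int N * g j) mod int N"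
      unfolding r_def by (rule mod_add_cong) (simp_all add: mod_mult_left_eq)
    also have "\<dots> = shear N n i g (pt N n a t w) j"
      using True assms by (simp only: pt_def shear_def restrict_apply lessThan_iff if_True)
    finally show ?thesis .
  qed (simp add: pt_def shear_def)
qed

text \<open>The union of the sheared copies of \<open>E\<close> meets the hypothesis for all
  directions of the chart and is larger than \<open>E\<close> by at most the size of the cover. That
  size is proportional to \<open>q ^ (n - 1) / card D\<close>, which puts \<open>card D\<close> on
  the left-hand side.\<close>

lemma kakeya_weak_type:
  assumes p: "prime p" and k: "1 \<le> k" and i: "i < n" and E: "E \<subseteq> vecs (p ^ k) n"
    and D: "D \<subseteq> chart (p ^ k) n i 1"
    and line: "\<And>u. u \<in> D \<Longrightarrow>
      \<exists>a\<in>vecs (p ^ k) n. m \<le> card {t\<in>{0..<int (p ^ k)}. pt (p ^ k) n a t u \<in> E}"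
  shows "real (card D) * real m ^ n \<le> 2 * (2 * real n * (real k + 1) ^ 2) ^ n *
           (real n * ln (real (p ^ k)) + 2) * (real (p ^ k) ^ (n - 1) * real (card E))"
proof (cases "D = {}")
  case True
  have "1 \<le> real (p ^ k)" using prime_power_ge_2[OF p k] by linarith
  then have "0 \<le> ln (real (p ^ k))" by simp
  with True show ?thesis by simp
next
  case False
  define q where "q = p ^ k"
  have q2: "2 \<le> q" unfolding q_def using p k by (rule prime_power_ge_2)
  define X where "X = chart q n i 1"
  define G where "G = chart q n i 0"
  define Rel where "Rel g u \<longleftrightarrow> (\<exists>w\<in>D. u = shear q n i g w)" for g u
  have cX: "card X = q ^ (n - 1)" and cG: "card G = q ^ (n - 1)"
    using i by (simp_all add: X_def G_def card_chart)
  have c0: "0 < q ^ (n - 1)" using q2 by simp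
  have X0: "X \<noteq> {}" "G \<noteq> {}" using c0 cX cG by auto
  have finD: "finite D" using D finite_chart by (rule finite_subset)
  have cD: "0 < card D" "card D \<le> q ^ (n - 1)"
  proof -
    show "0 < card D" using False finD by (simp only: card_gt_0_iff simp_thms)
    show "card D \<le> q ^ (n - 1)" using card_mono[OF finite_chart D] by (simp only: card_chart[OF i] q_def)
  qed
  define \<alpha> where "\<alpha> = real (card D) / real (q ^ (n - 1))"
  have \<alpha>: "0 < \<alpha>" "\<alpha> \<le> 1"
  proof -
    have pos: "0 < real (q ^ (n - 1))" "0 < real (card D)"
      using c0 cD(1) unfolding of_nat_0_less_iff .
    then show "0 < \<alpha>" unfolding \<alpha>_def by (intro divide_pos_pos)
    show "\<alpha> \<le> 1" unfolding \<alpha>_def divide_le_eq_1_pos[OF pos(1)] using cD(2) by (rule of_nat_mono)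
  qed
  have Wi: "w i = 1" "w \<in> vecs q n" if "w \<in> chart q n i 1" for w
  proof -
    from PiE_mem[OF that[unfolded chart_def], of i] i show "w i = 1" by simp
    have "chart q n i 1 \<subseteq> vecs q n" using q2 by (intro chart_subset_vecs) auto
    then show "w \<in> vecs q n" using that by blast
  qed
  \<comment> \<open>Each \<open>w\<close> in \<open>D\<close> provides its own
    \<open>g = u - w\<close>, so at least \<open>card D\<close> of the shears carry some direction
    of \<open>D\<close> to \<open>u\<close>.\<close>
  have cov: "\<alpha> * real (card G) \<le> real (card {g\<in>G. Rel g u})" if u: "u \<in> X" for u
  proof -
    define \<phi> where "\<phi> w = (\<lambda>j\<in>{..<n}. (u j - w j) mod int q)" for w
    have range: "w j \<in> {0..<int q}" if "w \<in> D" "j < n" for w j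
    proof -
      have "w \<in> vecs q n" using that(1) D by (intro Wi(2)) (auto simp: q_def)
      from PiE_mem[OF this[unfolded vecs_eq], of j] that(2) show ?thesis by simp
    qed
    have uv: "u j \<in> {0..<int q}" if "j < n" for j
    proof -
      have "u \<in> vecs q n" using u unfolding X_def by (rule Wi(2))
      from PiE_mem[OF this[unfolded vecs_eq], of j] that show ?thesis by simp
    qed
    have "card D \<le> card {g\<in>G. Rel g u}"
    proof (rule card_inj_on_le[of \<phi>])
      show "inj_on \<phi> D"
      proof (rule inj_onI)
        fix w w' assume w: "w \<in> D" "w' \<in> D" and eq: "\<phi> w = \<phi> w'"
        have "w j = w' j" if j: "j < n" for j
        proof -
          have "(u j - w j) mod int q = (u j - w' j) mod int q"
            using fun_cong[OF eq, of j] j by (simp add: \<phi>_def)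
          then have "int q dvd (u j - w j) - (u j - w' j)" by (simp only: mod_eq_dvd_iff)
          also have "(u j - w j) - (u j - w' j) = w' j - w j" by simp
          finally have "w' j mod int q = w j mod int q" by (simp only: mod_eq_dvd_iff)
          then show ?thesis using range[OF w(1) j] range[OF w(2) j] by simp
        qed
        moreover have "w \<in> vecs q n" "w' \<in> vecs q n" using w D Wi(2) unfolding q_def by auto
        ultimately show "w = w'" unfolding vecs_eq by (intro PiE_ext) auto
      qed
      show "\<phi> ` D \<subseteq> {g\<in>G. Rel g u}"
      proof (intro image_subsetI CollectI conjI)
        fix w assume w: "w \<in> D"
        have wi: "w i = 1" "u i = 1" using w D u Wi(1) by (auto simp: q_def X_def)
        show "\<phi> w \<in> G" unfolding \<phi>_def G_def chart_def
          by (intro restrict_PiE_iff[THEN iffD2] ballI) (use wi q2 in auto)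
        have "u = shear q n i (\<phi> w) w"
        proof (rule ext)
          fix j show "u j = shear q n i (\<phi> w) w j"
          proof (cases "j < n")
            case True
            have "shear q n i (\<phi> w) w j = (w j + (u j - w j) mod int q) mod int q"
              using True wi by (simp add: shear_def \<phi>_def)
            also have "\<dots> = u j" using uv[OF True] by (simp add: mod_add_right_eq)
            finally show ?thesis by simp
          next
            case False
            then show ?thesis using u Wi(2)[of u]
              by (auto simp: shear_def X_def vecs_eq PiE_def extensional_def)
          qed
        qed
        then show "Rel (\<phi> w) u" using w by (auto simp: Rel_def)
      qed
    qed (auto simp: G_def)
    then show ?thesis using c0 by (simp add: \<alpha>_def cG)
  qed
  have finX: "finite X" "finite G" by (simp_all add: X_def G_def)
  from small_cover[where Rel = Rel, OF finX(1) X0(1) finX(2) X0(2) \<alpha> cov] obtain S where S: "S \<subseteq> G"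
    and cS: "real (card S) \<le> (ln (real (card X)) + 2) / \<alpha>"
    and Scov: "\<And>u. u \<in> X \<Longrightarrow> \<exists>g\<in>S. Rel g u" by blast
  have finS: "finite S" using S finX finite_subset by blast
  define E' where "E' = (\<Union>g\<in>S. shear q n i g ` E)"
  have E': "E' \<subseteq> vecs (p ^ k) n" using q2 by (auto simp: E'_def q_def shear_in_vecs)
  have finE: "finite E" using E finite_vecs finite_subset by blast
  have "card E' \<le> (\<Sum>g\<in>S. card (shear q n i g ` E))"
    unfolding E'_def by (rule card_UN_le[OF finS])
  also have "\<dots> \<le> (\<Sum>g\<in>S. card E)" by (intro sum_mono card_image_le finE)
  finally have cE': "card E' \<le> card S * card E" by simp
  have "m ^ n \<le> 2 * (2 * n * (k + 1) ^ 2) ^ n * card E'"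
  proof (rule kakeya_prime_power[OF p k i E'])
    fix u assume "u \<in> chart (p ^ k) n i 1"
    then have "u \<in> X" by (simp add: X_def q_def)
    from Scov[OF this] obtain g w where g: "g \<in> S" and w: "w \<in> D" "u = shear q n i g w"
      unfolding Rel_def by blast
    from line[OF w(1)] obtain a where a: "m \<le> card {t\<in>{0..<int q}. pt q n a t w \<in> E}"
      unfolding q_def by blast
    have "m \<le> card {t\<in>{0..<int q}. pt q n (shear q n i g a) t u \<in> E'}"
    proof (rule order_trans[OF a], rule card_mono)
      show "{t\<in>{0..<int q}. pt q n a t w \<in> E} \<subseteq> {t\<in>{0..<int q}. pt q n (shear q n i g a) t u \<in> E'}"
        unfolding w(2) using g by (auto simp: pt_shear[OF i] E'_def)
      show "finite {t\<in>{0..<int q}. pt q n (shear q n i g a) t u \<in> E'}"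
        by (rule finite_subset[of _ "{0..<int q}"]) auto
    qed
    then show "\<exists>a\<in>vecs (p ^ k) n. m \<le> card {t\<in>{0..<int (p ^ k)}. pt (p ^ k) n a t u \<in> E'}"
      unfolding q_def[symmetric] using shear_in_vecs[of q n i g a] q2 by auto
  qed
  then have "real (m ^ n) \<le> real (2 * (2 * n * (k + 1) ^ 2) ^ n * card E')" by (rule of_nat_mono)
  also have "\<dots> \<le> real (2 * (2 * n * (k + 1) ^ 2) ^ n * (card S * card E))"
    using cE' by (intro of_nat_mono mult_left_mono) auto
  also have "\<dots> = 2 * (2 * real n * (real k + 1) ^ 2) ^ n * real (card E) * real (card S)" by (simp add: add.commute)
  also have "\<dots> \<le> 2 * (2 * real n * (real k + 1) ^ 2) ^ n * real (card E) *
      ((real n * ln (real q) + 2) / \<alpha>)"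
  proof (intro mult_left_mono)
    have "ln (real (card X)) = real (n - 1) * ln (real q)" unfolding cX using q2 by (simp add: ln_realpow)
    also have "\<dots> \<le> real n * ln (real q)" using q2 by (intro mult_right_mono) auto
    finally have "(ln (real (card X)) + 2) / \<alpha> \<le> (real n * ln (real q) + 2) / \<alpha>"
      using \<alpha> by (intro divide_right_mono) auto
    then show "real (card S) \<le> (real n * ln (real q) + 2) / \<alpha>" using cS by linarith
  qed auto
  finally have "real m ^ n \<le> 2 * (2 * real n * (real k + 1) ^ 2) ^ n * real (card E) *
      ((real n * ln (real q) + 2) / \<alpha>)" by simp
  then have "real (card D) * real m ^ n \<le> real (card D) * (2 * (2 * real n * (real k + 1) ^ 2) ^ n * real (card E) *
      ((real n * ln (real q) + 2) / \<alpha>))" by (rule mult_left_mono) simp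
  also have "\<dots> = 2 * (2 * real n * (real k + 1) ^ 2) ^ n *
           (real n * ln (real q) + 2) * (real q ^ (n - 1) * real (card E))"
    using cD by (simp add: \<alpha>_def field_simps)
  finally show ?thesis by (simp only: q_def)
qed

section \<open>From weak type to strong type\<close>

lemma sum_inverse_le_ln:
  assumes "1 \<le> q" shows "(\<Sum>j\<in>{1..q}. 1 / real j) \<le> 1 + ln (real q)"
  using assms
proof (induction q rule: dec_induct)
  case (step q)
  have "ln (real q / real (Suc q)) \<le> real q / real (Suc q) - 1"
    using step by (intro ln_le_minus_one) auto
  also have "\<dots> = - (1 / real (Suc q))" by (simp add: field_simps)
  finally have "1 / real (Suc q) \<le> ln (real (Suc q)) - ln (real q)"
    using step by (simp add: ln_div)
  then show ?case using step.IH by simp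
qed simp

lemma power_le_sum_powers:
  assumes "1 \<le> n"
  shows "real m ^ n \<le> (\<Sum>j\<in>{1..m}. real n * real j ^ (n - 1))"
proof (induction m)
  case 0 then show ?case using assms by (simp add: power_0_left)
next
  case (Suc m)
  have "real (Suc m) ^ n - real m ^ n \<le> real n * real (Suc m) ^ (n - 1)"
  proof -
    have "real (Suc m) ^ n - real m ^ n = (real (Suc m) - real m) * (\<Sum>i<n. real m ^ (n - Suc i) * real (Suc m) ^ i)"
      by (rule power_diff_sumr2)
    also have "\<dots> = (\<Sum>i<n. real m ^ (n - Suc i) * real (Suc m) ^ i)" by simp
    also have "\<dots> \<le> (\<Sum>i<n. real (Suc m) ^ (n - 1))"
    proof (rule sum_mono)
      fix i assume i: "i \<in> {..<n}"
      have "real m ^ (n - Suc i) * real (Suc m) ^ i \<le> real (Suc m) ^ (n - Suc i) * real (Suc m) ^ i"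
        by (intro mult_right_mono power_mono) auto
      also have "\<dots> = real (Suc m) ^ (n - 1)" using i by (simp flip: power_add)
      finally show "real m ^ (n - Suc i) * real (Suc m) ^ i \<le> real (Suc m) ^ (n - 1)" .
    qed
    finally show ?thesis by simp
  qed
  then show ?case using Suc.IH by simp
qed

text \<open>Layer cake: \<open>m ^ n\<close> is at most the sum of \<open>n * j ^ (n - 1)\<close>
  over \<open>j \<le> m\<close>. The bound \<open>W / j ^ n\<close> for the level sets then leaves a
  harmonic sum, hence the logarithm.\<close>

lemma strong_from_weak:
  fixes m :: "'a \<Rightarrow> nat"
  assumes fin: "finite X" and n: "1 \<le> n" and q: "1 \<le> q" and mq: "\<And>u. u \<in> X \<Longrightarrow> m u \<le> q"
    and W: "\<And>j. real (card {u\<in>X. j \<le> m u}) * real j ^ n \<le> W"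
  shows "(\<Sum>u\<in>X. real (m u) ^ n) \<le> real n * (1 + ln (real q)) * W"
proof -
  have W0: "0 \<le> W" using W[of 0] n by (simp add: power_0_left)
  have "(\<Sum>u\<in>X. real (m u) ^ n) \<le> (\<Sum>u\<in>X. \<Sum>j\<in>{1..q}. if j \<le> m u then real n * real j ^ (n - 1) else 0)"
  proof (rule sum_mono)
    fix u assume u: "u \<in> X"
    have "(\<Sum>j\<in>{1..q}. if j \<le> m u then real n * real j ^ (n - 1) else 0) =
          (\<Sum>j\<in>{1..m u}. real n * real j ^ (n - 1))"
      using mq[OF u] by (intro sum.mono_neutral_cong_right) auto
    then show "real (m u) ^ n \<le> (\<Sum>j\<in>{1..q}. if j \<le> m u then real n * real j ^ (n - 1) else 0)"
      using power_le_sum_powers[OF n, of "m u"] by simp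
  qed
  also have "\<dots> = (\<Sum>j\<in>{1..q}. \<Sum>u\<in>X. if j \<le> m u then real n * real j ^ (n - 1) else 0)" by (rule sum.swap)
  also have "\<dots> = (\<Sum>j\<in>{1..q}. real (card {u\<in>X. j \<le> m u}) * (real n * real j ^ (n - 1)))"
    using fin by (intro sum.cong refl) (simp add: sum.inter_filter[symmetric])
  also have "\<dots> \<le> (\<Sum>j\<in>{1..q}. real n * W * (1 / real j))"
  proof (rule sum_mono)
    fix j assume j: "j \<in> {1..q}"
    have "real j ^ n = real j * real j ^ (n - 1)" using n by (cases n) auto
    then have "real (card {u\<in>X. j \<le> m u}) * real j ^ (n - 1) \<le> W / real j"
      using W[of j] j by (simp add: field_simps)
    then have "real n * (real (card {u\<in>X. j \<le> m u}) * real j ^ (n - 1)) \<le> real n * (W / real j)"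
      by (rule mult_left_mono) simp
    then show "real (card {u\<in>X. j \<le> m u}) * (real n * real j ^ (n - 1)) \<le> real n * W * (1 / real j)"
      by (simp add: mult.left_commute)
  qed
  also have "\<dots> = real n * W * (\<Sum>j\<in>{1..q}. 1 / real j)" by (simp only: sum_distrib_left)
  also have "\<dots> \<le> real n * W * (1 + ln (real q))"
    using sum_inverse_le_ln[OF q] W0 by (intro mult_left_mono) auto
  finally show ?thesis by (simp only: mult_ac)
qed

text \<open>The harmonic loss \<open>n * (1 + ln q)\<close> times the weak-type constant;
  restricted, because it serves indicator functions of sets only.\<close>

definition restricted_const :: "nat \<Rightarrow> nat \<Rightarrow> nat \<Rightarrow> real" where
  "restricted_const n k q = real n * (1 + ln (real q)) *
     (2 * (2 * real n * (real k + 1) ^ 2) ^ n * (real n * ln (real q) + 2))"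

lemma kakeya_restricted_strong_type:
  assumes p: "prime p" and k: "1 \<le> k" and i: "i < n" and q: "q = p ^ k" and E: "E \<subseteq> vecs q n"
    and a: "\<And>u. u \<in> chart q n i 1 \<Longrightarrow> a u \<in> vecs q n"
  shows "(\<Sum>u\<in>chart q n i 1. real (card {t\<in>{0..<int q}. pt q n (a u) t u \<in> E}) ^ n)
    \<le> restricted_const n k q * (real q ^ (n - 1) * real (card E))"
proof -
  define m where "m u = card {t\<in>{0..<int q}. pt q n (a u) t u \<in> E}" for u
  have q1: "1 \<le> q" using prime_power_ge_2[OF p k] q by simp
  have "m u \<le> q" for u
  proof -
    have "m u \<le> card {0..<int q}" unfolding m_def by (intro card_mono) auto
    then show ?thesis by simp
  qed
  moreover have "real (card {u\<in>chart q n i 1. j \<le> m u}) * real j ^ n \<le>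
      2 * (2 * real n * (real k + 1) ^ 2) ^ n * (real n * ln (real q) + 2) * (real q ^ (n - 1) * real (card E))" for j
    unfolding q
  proof (rule kakeya_weak_type[OF p k i])
    show "E \<subseteq> vecs (p ^ k) n" using E q by simp
    fix u assume "u \<in> {u \<in> chart (p ^ k) n i 1. j \<le> m u}"
    then have "a u \<in> vecs (p ^ k) n" "j \<le> m u" using a q by auto
    then show "\<exists>a\<in>vecs (p ^ k) n. j \<le> card {t \<in> {0..<int (p ^ k)}. pt (p ^ k) n a t u \<in> E}"
      unfolding m_def q by blast
  qed auto
  ultimately have "(\<Sum>u\<in>chart q n i 1. real (m u) ^ n) \<le> real n * (1 + ln (real q)) *
     (2 * (2 * real n * (real k + 1) ^ 2) ^ n * (real n * ln (real q) + 2) * (real q ^ (n - 1) * real (card E)))"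
    using i q1 by (intro strong_from_weak) auto
  then show ?thesis unfolding m_def restricted_const_def by (simp only: mult.assoc)
qed

section \<open>From indicator functions to nonnegative functions\<close>

lemma convex_on_power_nonneg: "convex_on {0::real..} (\<lambda>x. x ^ n)"
proof (cases "even n")
  case True
  then show ?thesis using convex_on_subset[OF convex_power_even] by blast
next
  case False
  then show ?thesis by (rule convex_power_odd)
qed

text \<open>Jensen's inequality, or Hoelder's inequality against the constant 1; it serves for the
  dyadic layers and again for the sum over directions.\<close>

lemma power_sum_le:
  fixes b :: "'a \<Rightarrow> real"
  assumes "finite A" "1 \<le> n" "\<And>x. x \<in> A \<Longrightarrow> 0 \<le> b x"
  shows "sum b A ^ n \<le> real (card A) ^ (n - 1) * (\<Sum>x\<in>A. b x ^ n)"
proof (cases "A = {}")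
  case True then show ?thesis using assms(2) by (simp add: power_0_left)
next
  case False
  define m where "m = real (card A)"
  have m: "0 < m" using assms(1) False by (simp add: m_def card_gt_0_iff)
  have "(\<Sum>x\<in>A. (1 / m) *\<^sub>R b x) ^ n \<le> (\<Sum>x\<in>A. (1 / m) * b x ^ n)"
    by (rule convex_on_sum[OF assms(1) False convex_on_power_nonneg]) (use m assms(3) in \<open>auto simp: m_def\<close>)
  then have "(sum b A / m) ^ n \<le> (\<Sum>x\<in>A. b x ^ n) / m"
    by (simp add: sum_divide_distrib)
  then have "sum b A ^ n \<le> m ^ n * ((\<Sum>x\<in>A. b x ^ n) / m)"
    using m by (simp add: power_divide field_simps)
  also have "m ^ n = m ^ (n - 1) * m" using assms(2) by (cases n) auto
  finally show ?thesis using m by (simp add: m_def)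
qed

text \<open>The first level \<open>M / 2 ^ j\<close> not exceeding \<open>y\<close> is at least half
  of \<open>y\<close>; if no level up to \<open>J\<close> qualifies, \<open>y\<close> is below the
  remainder \<open>M / 2 ^ J\<close>.\<close>

lemma dyadic_layer_bound:
  fixes y :: real
  assumes "0 \<le> y" "y \<le> M"
  shows "y \<le> M / 2 ^ J + (\<Sum>j\<le>J. if M / 2 ^ j \<le> y then 2 * (M / 2 ^ j) else 0)"
proof -
  have M: "0 \<le> M" using assms by simp
  have nn: "0 \<le> (\<Sum>j\<le>J. if M / 2 ^ j \<le> y then 2 * (M / 2 ^ j) else 0)"
    using M by (intro sum_nonneg) auto
  show ?thesis
  proof (cases "M / 2 ^ J \<le> y")
    case False then show ?thesis using nn by linarith
  next
    case True
    define j where "j = (LEAST j. M / 2 ^ j \<le> y)"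
    have j: "M / 2 ^ j \<le> y" unfolding j_def using True by (rule LeastI)
    have jJ: "j \<le> J" unfolding j_def using True by (rule Least_le)
    have "y \<le> 2 * (M / 2 ^ j)"
    proof (cases j)
      case 0 then show ?thesis using assms M by simp
    next
      case (Suc i)
      then have "\<not> M / 2 ^ i \<le> y" using not_less_Least[of i "\<lambda>j. M / 2 ^ j \<le> y"] unfolding j_def[symmetric] by simp
      then show ?thesis by (simp add: Suc)
    qed
    also have "2 * (M / 2 ^ j) = (if M / 2 ^ j \<le> y then 2 * (M / 2 ^ j) else 0)" using j by simp
    also have "\<dots> \<le> (\<Sum>j\<le>J. if M / 2 ^ j \<le> y then 2 * (M / 2 ^ j) else 0)"
      using jJ M by (intro member_le_sum) auto
    also have "\<dots> \<le> M / 2 ^ J + \<dots>" using M by simp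
    finally show ?thesis .
  qed
qed

lemma kakeya_chart_strong_type:
  assumes p: "prime p" and k: "1 \<le> k" and i: "i < n" and q: "q = p ^ k" and J: "real q \<le> 2 ^ J"
    and a: "\<And>u. u \<in> chart q n i 1 \<Longrightarrow> a u \<in> vecs q n"
    and f: "\<And>x. x \<in> vecs q n \<Longrightarrow> 0 \<le> (f x :: real)"
  shows "(\<Sum>u\<in>chart q n i 1. (\<Sum>t\<in>{0..<int q}. f (pt q n (a u) t u)) ^ n)
    \<le> (real J + 2) ^ n * (1 + 2 ^ n * (real J + 1) * restricted_const n k q) *
       (real q ^ (n - 1) * (\<Sum>x\<in>vecs q n. f x ^ n))"
proof -
  have q2: "2 \<le> q" using prime_power_ge_2[OF p k] q by simp
  define S where "S = (\<Sum>x\<in>vecs q n. f x ^ n)"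
  \<comment> \<open>The \<open>n\<close>-norm of \<open>f\<close>: it bounds \<open>f\<close>
    pointwise, and its \<open>n\<close>-th power is again the sum \<open>S\<close>.\<close>
  define M where "M = root n S"
  define C where "C = chart q n i 1"
  define K where "K = restricted_const n k q"
  have n: "0 < n" using i by simp
  have S0: "0 \<le> S" unfolding S_def using f by (intro sum_nonneg zero_le_power) auto
  have M0: "0 \<le> M" and Mn: "M ^ n = S" using S0 n by (auto simp: M_def)
  have K0: "0 \<le> K" unfolding K_def restricted_const_def using q2
    by (intro mult_nonneg_nonneg add_nonneg_nonneg) auto
  have fM: "f x \<le> M" if "x \<in> vecs q n" for x
  proof -
    have "f x ^ n \<le> S" unfolding S_def using f that by (intro member_le_sum) auto
    then show ?thesis using f[OF that] n S0 unfolding M_def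
      by (metis real_root_le_iff real_root_power_cancel)
  qed
  define E where "E j = {x\<in>vecs q n. M / 2 ^ j \<le> f x}" for j
  define m where "m j u = card {t\<in>{0..<int q}. pt q n (a u) t u \<in> E j}" for j u
  have ptv: "pt q n b t u \<in> vecs q n" for b t u using q2 by (intro pt_in_vecs) auto
  \<comment> \<open>Index \<open>J + 1\<close> stands for the remainder of \<open>f\<close> below
    \<open>M / 2 ^ J\<close>. Along a line it sums to at most
    \<open>q * (M / 2 ^ J) \<le> M\<close>, which is the purpose of
    \<open>q \<le> 2 ^ J\<close>.\<close>
  define b where "b u j = (if j = J + 1 then M else 2 * (M / 2 ^ j) * real (m j u))" for u and j :: nat
  have b0: "0 \<le> b u j" for u j using M0 by (simp add: b_def)
  have h: "(\<Sum>t\<in>{0..<int q}. f (pt q n (a u) t u)) \<le> (\<Sum>j\<le>J + 1. b u j)" for u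
  proof -
    have "(\<Sum>t\<in>{0..<int q}. f (pt q n (a u) t u)) \<le> (\<Sum>t\<in>{0..<int q}. M / 2 ^ J +
        (\<Sum>j\<le>J. if M / 2 ^ j \<le> f (pt q n (a u) t u) then 2 * (M / 2 ^ j) else 0))"
      using ptv f fM by (intro sum_mono dyadic_layer_bound) auto
    also have "\<dots> = real q * (M / 2 ^ J) + (\<Sum>j\<le>J. \<Sum>t\<in>{0..<int q}.
        if M / 2 ^ j \<le> f (pt q n (a u) t u) then 2 * (M / 2 ^ j) else 0)"
      unfolding sum.distrib by (subst (2) sum.swap) simp
    also have "(\<Sum>j\<le>J. \<Sum>t\<in>{0..<int q}. if M / 2 ^ j \<le> f (pt q n (a u) t u) then 2 * (M / 2 ^ j) else 0)
        = (\<Sum>j\<le>J. 2 * (M / 2 ^ j) * real (m j u))"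
      unfolding m_def E_def using ptv
      by (intro sum.cong refl) (simp add: sum.inter_filter[symmetric])
    also have "\<dots> = (\<Sum>j\<le>J. b u j)" by (intro sum.cong) (auto simp: b_def)
    also have "real q * (M / 2 ^ J) \<le> 2 ^ J * (M / 2 ^ J)" using J M0 by (intro mult_right_mono) auto
    also have "2 ^ J * (M / 2 ^ J) = b u (J + 1)" by (simp add: b_def)
    finally show ?thesis by simp
  qed
  have level: "(\<Sum>u\<in>C. b u j ^ n) \<le> 2 ^ n * K * (real q ^ (n - 1) * S)" if "j \<le> J" for j
  proof -
    have "(\<Sum>u\<in>C. b u j ^ n) = (2 * (M / 2 ^ j)) ^ n * (\<Sum>u\<in>C. real (m j u) ^ n)"
      unfolding sum_distrib_left
      by (intro sum.cong refl) (use that in \<open>simp add: b_def flip: power_mult_distrib\<close>)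
    also have "\<dots> \<le> (2 * (M / 2 ^ j)) ^ n * (K * (real q ^ (n - 1) * real (card (E j))))"
      unfolding m_def C_def K_def using M0
      by (intro mult_left_mono kakeya_restricted_strong_type[OF p k i q _ a]) (auto simp: E_def)
    also have "\<dots> = 2 ^ n * K * (real q ^ (n - 1) * ((M / 2 ^ j) ^ n * real (card (E j))))"
      by (simp only: power_mult_distrib mult_ac)
    also have "(M / 2 ^ j) ^ n * real (card (E j)) = (\<Sum>x\<in>E j. (M / 2 ^ j) ^ n)" by simp
    also have "\<dots> \<le> (\<Sum>x\<in>E j. f x ^ n)"
      using M0 by (intro sum_mono power_mono) (auto simp: E_def)
    also have "\<dots> \<le> S" unfolding S_def using f by (intro sum_mono2) (auto simp: E_def)
    finally show ?thesis using K0 by (simp add: mult_left_mono)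
  qed
  have top: "(\<Sum>u\<in>C. b u (J + 1) ^ n) = real q ^ (n - 1) * S"
    by (simp add: b_def Mn C_def card_chart[OF i])
  have "(\<Sum>u\<in>C. (\<Sum>t\<in>{0..<int q}. f (pt q n (a u) t u)) ^ n) \<le> (\<Sum>u\<in>C. (\<Sum>j\<le>J + 1. b u j) ^ n)"
    using f ptv by (intro sum_mono power_mono h sum_nonneg) auto
  also have "\<dots> \<le> (\<Sum>u\<in>C. (real J + 2) ^ n * (\<Sum>j\<le>J + 1. b u j ^ n))"
  proof (rule sum_mono)
    fix u
    have "(\<Sum>j\<le>J + 1. b u j) ^ n \<le> real (card {..J + 1}) ^ (n - 1) * (\<Sum>j\<le>J + 1. b u j ^ n)"
      using b0 n by (intro power_sum_le) auto
    also have "\<dots> \<le> real (card {..J + 1}) ^ n * (\<Sum>j\<le>J + 1. b u j ^ n)"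
      using b0 by (intro mult_right_mono power_increasing sum_nonneg zero_le_power) auto
    also have "real (card {..J + 1}) = real J + 2" by simp
    finally show "(\<Sum>j\<le>J + 1. b u j) ^ n \<le> (real J + 2) ^ n * (\<Sum>j\<le>J + 1. b u j ^ n)" .
  qed
  also have "\<dots> = (real J + 2) ^ n * (\<Sum>j\<le>J + 1. \<Sum>u\<in>C. b u j ^ n)"
    by (subst sum.swap) (simp only: sum_distrib_left)
  also have "(\<Sum>j\<le>J + 1. \<Sum>u\<in>C. b u j ^ n) = (\<Sum>j\<le>J. \<Sum>u\<in>C. b u j ^ n) + real q ^ (n - 1) * S"
    using top by simp
  also have "(\<Sum>j\<le>J. \<Sum>u\<in>C. b u j ^ n) \<le> (\<Sum>j\<le>J. 2 ^ n * K * (real q ^ (n - 1) * S))"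
    by (intro sum_mono level) auto
  also have "(\<Sum>j\<le>J. 2 ^ n * K * (real q ^ (n - 1) * S)) + real q ^ (n - 1) * S =
      (1 + 2 ^ n * (real J + 1) * K) * (real q ^ (n - 1) * S)"
    by (simp add: algebra_simps)
  finally have "(\<Sum>u\<in>C. (\<Sum>t\<in>{0..<int q}. f (pt q n (a u) t u)) ^ n) \<le>
      (real J + 2) ^ n * ((1 + 2 ^ n * (real J + 1) * K) * (real q ^ (n - 1) * S))" by simp
  then show ?thesis unfolding C_def K_def S_def by (simp only: mult.assoc)
qed

section \<open>The maximal operator modulo a prime power\<close>

lemma polylog_le_powr:
  fixes \<delta> :: real
  assumes \<delta>: "0 < \<delta>" and n: "1 \<le> n"
  shows "\<exists>A\<ge>1. \<forall>p k. prime p \<longrightarrow> 1 \<le> k \<longrightarrow> (\<exists>J. real (p ^ k) \<le> 2 ^ J \<and>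
    real n * ((real J + 2) ^ n * (1 + 2 ^ n * (real J + 1) * restricted_const n k (p ^ k)))
      \<le> A * real (p ^ k) powr \<delta>)"
proof -
  \<comment> \<open>Powers of \<open>l = 1 + ln q\<close>: \<open>n\<close> from
    \<open>(J + 2) ^ n\<close>, one from \<open>J + 1\<close>, and \<open>2 * n + 2\<close> from
    \<open>restricted_const\<close>.\<close>
  define e where "e = 3 * n + 3"
  define a where "a = \<delta> / real e"
  have a0: "0 < a" using \<delta> by (simp add: a_def e_def)
  define c1 where "c1 = real n * (2 * (8 * real n) ^ n * (real n + 2))"
  define c where "c = real n * (3 ^ n * (1 + 2 ^ n * 3 * c1))"
  define A where "A = max 1 (c * (1 + 1 / a) ^ e)"
  have c10: "0 \<le> c1" by (simp add: c1_def)
  have c0: "0 \<le> c" using c10 by (simp add: c_def)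
  have "\<exists>J. real (p ^ k) \<le> 2 ^ J \<and>
    real n * ((real J + 2) ^ n * (1 + 2 ^ n * (real J + 1) * restricted_const n k (p ^ k)))
      \<le> A * real (p ^ k) powr \<delta>" if p: "prime p" and k: "1 \<le> k" for p k
  proof -
    define q where "q = p ^ k"
    have "2 \<le> q" unfolding q_def using p k by (rule prime_power_ge_2)
    then have q2: "2 \<le> real q" by linarith
    define l where "l = 1 + ln (real q)"
    have l1: "1 \<le> l" using q2 by (simp add: l_def)
    define J where "J = nat \<lceil>log 2 (real q)\<rceil>"
    have lg0: "0 \<le> log 2 (real q)" using q2 by simp
    have "real q = 2 powr log 2 (real q)" using q2 by simp
    also have "\<dots> \<le> 2 powr real J" unfolding J_def using lg0 by (intro powr_mono) linarith+
    finally have qJ: "real q \<le> 2 ^ J" by (simp add: powr_realpow)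
    have ln2: "1 / 2 \<le> ln (2::real)" using ln2_ge_two_thirds by simp
    have "log 2 (real q) \<le> 2 * ln (real q)"
    proof -
      have "ln (real q) * (1 / 2) \<le> ln (real q) * ln 2" using ln2 q2 by (intro mult_left_mono) auto
      then show ?thesis using ln2 by (simp add: log_def field_simps)
    qed
    then have "real J \<le> 2 * ln (real q) + 1" unfolding J_def using lg0 by linarith
    then have J2: "real J + 2 \<le> 3 * l" "real J + 1 \<le> 3 * l"
      using l1 unfolding l_def by auto
    \<comment> \<open>The interpolation losses \<open>k + 1\<close> become logarithmic here, because
      \<open>2 ^ k \<le> q\<close>.\<close>
    have "real k * (1 / 2) \<le> real k * ln (real p)"
      using ln2 prime_ge_2_nat[OF p] by (intro mult_left_mono order_trans[OF ln2]) auto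
    also have "\<dots> = ln (real q)" using prime_gt_0_nat[OF p] by (simp add: q_def ln_realpow)
    finally have k2: "real k + 1 \<le> 2 * l" by (simp add: l_def)
    have n2: "real n * ln (real q) + 2 \<le> (real n + 2) * l"
      using l1 by (simp add: l_def algebra_simps)
    have lnq: "0 \<le> ln (real q)" using q2 by simp
    have "restricted_const n k q \<le> real n * l * (2 * (2 * real n * (2 * l) ^ 2) ^ n * ((real n + 2) * l))"
      unfolding restricted_const_def l_def[symmetric] using k2 n2 l1 lnq
      by (intro mult_mono power_mono order_refl mult_nonneg_nonneg add_nonneg_nonneg zero_le_power) auto
    also have "\<dots> = c1 * l ^ (2 * n + 2)"
    proof -
      have "(2 * real n * (2 * l) ^ 2) ^ n = (8 * real n) ^ n * l ^ (2 * n)"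
      proof -
        have "2 * real n * (2 * l) ^ 2 = (8 * real n) * l ^ 2" by (simp add: power2_eq_square)
        then show ?thesis by (simp only: power_mult_distrib power_mult[symmetric])
      qed
      then show ?thesis by (simp add: c1_def power_add power2_eq_square)
    qed
    finally have rc: "restricted_const n k q \<le> c1 * l ^ (2 * n + 2)" .
    have rc0: "0 \<le> restricted_const n k q" unfolding restricted_const_def using lnq
      by (intro mult_nonneg_nonneg add_nonneg_nonneg) auto
    have "1 + 2 ^ n * (real J + 1) * restricted_const n k q \<le> l ^ (2 * n + 3) + 2 ^ n * (3 * l) * (c1 * l ^ (2 * n + 2))"
      using J2 rc rc0 l1 by (intro add_mono mult_mono one_le_power) auto
    also have "\<dots> = (1 + 2 ^ n * 3 * c1) * l ^ (2 * n + 3)"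
    proof -
      have "l ^ (2 * n + 3) = l * l ^ (2 * n + 2)" by (simp add: numeral_3_eq_3)
      then show ?thesis by (simp add: algebra_simps)
    qed
    finally have "real n * ((real J + 2) ^ n * (1 + 2 ^ n * (real J + 1) * restricted_const n k q))
        \<le> real n * ((3 * l) ^ n * ((1 + 2 ^ n * 3 * c1) * l ^ (2 * n + 3)))"
      using J2 rc0 l1 by (intro mult_left_mono mult_mono power_mono) auto
    also have "\<dots> = c * l ^ e"
    proof -
      have "l ^ e = l ^ n * l ^ (2 * n + 3)" unfolding e_def by (simp flip: power_add)
      then show ?thesis by (simp add: c_def power_mult_distrib)
    qed
    also have "\<dots> \<le> c * ((1 + 1 / a) * real q powr a) ^ e"
    proof (intro mult_left_mono power_mono c0)
      have "ln (real q) \<le> real q powr a / a" using q2 a0 by (intro ln_powr_bound) auto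
      moreover have "1 \<le> real q powr a" using q2 a0 by (intro ge_one_powr_ge_zero) auto
      ultimately show "l \<le> (1 + 1 / a) * real q powr a" by (simp add: l_def algebra_simps)
    qed (use l1 in auto)
    also have "\<dots> = c * (1 + 1 / a) ^ e * (real q powr a) ^ e" by (simp only: power_mult_distrib mult.assoc)
    also have "(real q powr a) ^ e = real q powr \<delta>"
      using q2 by (simp add: powr_power a_def e_def)
    also have "c * (1 + 1 / a) ^ e * real q powr \<delta> \<le> A * real q powr \<delta>"
      unfolding A_def by (intro mult_right_mono) auto
    finally show ?thesis using qJ unfolding q_def by blast
  qed
  then show ?thesis by (intro exI[of _ A]) (auto simp: A_def)
qed

text \<open>
  The sum runs over the parameter \<open>t\<close>, so it is a sum over the points of a line only for unimodular \<open>u\<close>.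
\<close>

definition fstar :: "nat \<Rightarrow> nat \<Rightarrow> ((nat \<Rightarrow> int) \<Rightarrow> real) \<Rightarrow> (nat \<Rightarrow> int) \<Rightarrow> real" where
  "fstar N n f u = Max ((\<lambda>a. \<Sum>t\<in>{0..<int N}. f (pt N n a t u)) ` vecs N n)"

lemma vecs_nonempty: "1 \<le> N \<Longrightarrow> vecs N n \<noteq> {}"
  using pt_in_vecs by blast

lemma fstar_attained:
  assumes "1 \<le> N"
  shows "\<exists>a\<in>vecs N n. fstar N n f u = (\<Sum>t\<in>{0..<int N}. f (pt N n a t u))"
proof -
  have "fstar N n f u \<in> (\<lambda>a. \<Sum>t\<in>{0..<int N}. f (pt N n a t u)) ` vecs N n"
    unfolding fstar_def by (rule Max_in) (use vecs_nonempty[OF assms] in auto)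
  then show ?thesis by auto
qed

lemma fstar_ge: "a \<in> vecs N n \<Longrightarrow> (\<Sum>t\<in>{0..<int N}. f (pt N n a t u)) \<le> fstar N n f u"
  unfolding fstar_def by (intro Max_ge) auto

lemma fstar_nonneg:
  assumes "1 \<le> N" "\<And>x. x \<in> vecs N n \<Longrightarrow> 0 \<le> f x"
  shows "0 \<le> fstar N n f u"
proof -
  obtain a where "fstar N n f u = (\<Sum>t\<in>{0..<int N}. f (pt N n a t u))" using fstar_attained[OF assms(1)] by blast
  then show ?thesis using assms pt_in_vecs by (simp add: sum_nonneg)
qed

section \<open>Unimodular vectors and their unit multiples\<close>

definition uscale :: "nat \<Rightarrow> nat \<Rightarrow> int \<Rightarrow> (nat \<Rightarrow> int) \<Rightarrow> nat \<Rightarrow> int" where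
  "uscale N n c u = (\<lambda>i\<in>{..<n}. (c * u i) mod int N)"

definition zunits :: "nat \<Rightarrow> int set" where
  "zunits N = {c\<in>{0..<int N}. coprime c (int N)}"

definition uvecs :: "nat \<Rightarrow> nat \<Rightarrow> (nat \<Rightarrow> int) set" where
  "uvecs N n = {u\<in>vecs N n. \<forall>p. prime p \<longrightarrow> p dvd N \<longrightarrow> (\<exists>i<n. \<not> int p dvd u i)}"

lemma finite_uvecs [simp]: "finite (uvecs N n)"
  by (auto simp: uvecs_def)

lemma finite_zunits [simp]: "finite (zunits N)"
  unfolding zunits_def by (rule finite_subset[of _ "{0..<int N}"]) auto

lemma card_zunits:
  assumes "2 \<le> N" shows "card (zunits N) = totient N"
proof -
  have "bij_betw int (totatives N) (zunits N)"
  proof (rule bij_betw_byWitness[of _ nat])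
    show "int ` totatives N \<subseteq> zunits N"
    proof (rule image_subsetI)
      fix k assume k: "k \<in> totatives N"
      then have "k \<noteq> N" using assms by (auto simp: totatives_def)
      then show "int k \<in> zunits N" using k by (auto simp: totatives_def zunits_def)
    qed
    show "nat ` zunits N \<subseteq> totatives N"
    proof (rule image_subsetI)
      fix c assume c: "c \<in> zunits N"
      then have "c \<noteq> 0" using assms by (auto simp: zunits_def)
      then have "0 < nat c" "nat c \<le> N" "coprime (int (nat c)) (int N)" using c by (auto simp: zunits_def)
      then show "nat c \<in> totatives N" 
        unfolding totatives_def coprime_int_iff by (simp only: mem_Collect_eq greaterThanAtMost_iff simp_thms)
    qed
  qed (auto simp: zunits_def)
  then show ?thesis using bij_betw_same_card totient_def by metis
qed

lemma pt_uscale: "pt N n a t (uscale N n c u) = pt N n a ((t * c) mod int N) u"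
proof (rule ext)
  fix j
  have "(a j + t * (c * u j mod int N)) mod int N = (a j + t * (c * u j)) mod int N"
    by (rule mod_add_cong) (simp_all add: mod_mult_right_eq)
  moreover have "(a j + t * c mod int N * u j) mod int N = (a j + t * c * u j) mod int N"
    by (rule mod_add_cong) (simp_all add: mod_mult_left_eq)
  ultimately show "pt N n a t (uscale N n c u) j = pt N n a ((t * c) mod int N) u j"
    by (cases "j < n") (simp_all add: pt_def uscale_def mult.assoc)
qed

lemma bij_betw_mult_unit:
  assumes "1 \<le> N" "coprime c (int N)"
  shows "bij_betw (\<lambda>t. (t * c) mod int N) {0..<int N} {0..<int N}"
proof -
  have "inj_on (\<lambda>t. (t * c) mod int N) {0..<int N}"
  proof (rule inj_onI)
    fix s t assume st: "s \<in> {0..<int N}" "t \<in> {0..<int N}" "(s * c) mod int N = (t * c) mod int N"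
    then have "[s * c = t * c] (mod int N)" by (simp add: unique_euclidean_semiring_class.cong_def)
    then have "[s = t] (mod int N)" using assms(2) by (simp add: cong_mult_rcancel)
    then show "s = t" using st by (simp add: unique_euclidean_semiring_class.cong_def)
  qed
  moreover have "(\<lambda>t. (t * c) mod int N) ` {0..<int N} \<subseteq> {0..<int N}" using assms by auto
  ultimately show ?thesis unfolding bij_betw_def using endo_inj_surj[of "{0..<int N}"] by auto
qed

text \<open>Scaling the direction by a unit merely permutes the parameters \<open>t\<close>.\<close>

lemma fstar_uscale:
  assumes "1 \<le> N" "coprime c (int N)"
  shows "fstar N n f (uscale N n c u) = fstar N n f u"
proof -
  have "(\<Sum>t\<in>{0..<int N}. f (pt N n a t (uscale N n c u))) = (\<Sum>t\<in>{0..<int N}. f (pt N n a t u))" for a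
    unfolding pt_uscale
    by (rule sum.reindex_bij_betw[OF bij_betw_mult_unit[OF assms], of "\<lambda>t. f (pt N n a t u)"])
  then show ?thesis by (simp add: fstar_def)
qed

text \<open>\<open>totient N\<close> is the number of unit multiples of a unimodular direction,
  which all share the same value of \<open>fstar\<close>. The normalising factor is multiplicative
  over coprime moduli, so that only \<open>K\<close> has to be followed.\<close>

definition maximal_bound :: "nat \<Rightarrow> nat \<Rightarrow> real \<Rightarrow> bool" where
  "maximal_bound n N K \<longleftrightarrow> (\<forall>f. (\<forall>x\<in>vecs N n. 0 \<le> f x) \<longrightarrow>
     (\<Sum>u\<in>uvecs N n. fstar N n f u ^ n) \<le>
       K * (real (totient N) * real N ^ (n - 1) * (\<Sum>x\<in>vecs N n. f x ^ n)))"

lemma maximal_bound_mono: "maximal_bound n N K \<Longrightarrow> K \<le> K' \<Longrightarrow> maximal_bound n N K'"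
  unfolding maximal_bound_def
proof (intro allI impI)
  fix f :: "(nat \<Rightarrow> int) \<Rightarrow> real"
  assume *: "\<forall>f. (\<forall>x\<in>vecs N n. 0 \<le> f x) \<longrightarrow> (\<Sum>u\<in>uvecs N n. fstar N n f u ^ n)
      \<le> K * (real (totient N) * real N ^ (n - 1) * (\<Sum>x\<in>vecs N n. f x ^ n))"
    and K: "K \<le> K'" and f: "\<forall>x\<in>vecs N n. 0 \<le> f x"
  have "0 \<le> (\<Sum>x\<in>vecs N n. f x ^ n)" using f by (intro sum_nonneg) auto
  then have 1: "K * (real (totient N) * real N ^ (n - 1) * (\<Sum>x\<in>vecs N n. f x ^ n))
      \<le> K' * (real (totient N) * real N ^ (n - 1) * (\<Sum>x\<in>vecs N n. f x ^ n))"
    by (intro mult_right_mono K) auto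
  have "(\<Sum>u\<in>uvecs N n. fstar N n f u ^ n)
      \<le> K * (real (totient N) * real N ^ (n - 1) * (\<Sum>x\<in>vecs N n. f x ^ n))"
    using * f by blast
  from this 1 show "(\<Sum>u\<in>uvecs N n. fstar N n f u ^ n)
      \<le> K' * (real (totient N) * real N ^ (n - 1) * (\<Sum>x\<in>vecs N n. f x ^ n))" by (rule order_trans)
qed

text \<open>Modulo a prime power the ring is local, so a unimodular vector has a unit coordinate by
  which it can be divided. Modulo 6 the vector (2, 3) has none; charts are therefore confined to
  prime powers.\<close>

lemma uvecs_prime_power_subset:
  assumes p: "prime p" and k: "1 \<le> k"
  shows "uvecs (p ^ k) n \<subseteq> (\<lambda>(i, c, w). uscale (p ^ k) n c w) `
           (SIGMA i:{..<n}. zunits (p ^ k) \<times> chart (p ^ k) n i 1)"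
proof
  define q where "q = p ^ k"
  have q2: "2 \<le> q" using prime_power_ge_2[OF p k] by (simp add: q_def)
  fix u assume u: "u \<in> uvecs (p ^ k) n"
  have "p dvd p ^ k" using k by (intro dvd_power) auto
  then obtain i where i: "i < n" "\<not> int p dvd u i" using u p by (auto simp: uvecs_def)
  have uv: "u \<in> vecs q n" using u by (simp add: uvecs_def q_def)
  have ur: "u j \<in> {0..<int q}" if "j < n" for j
    using PiE_mem[OF uv[unfolded vecs_eq], of j] that by simp
  have "coprime (int p) (u i)" using i(2) p by (intro prime_imp_coprime) auto
  then have cop: "coprime (u i) (int q)" by (simp add: q_def coprime_commute)
  from cong_solve_coprime_int[OF this] obtain d where d: "[u i * d = 1] (mod int q)" by blast
  define w where "w = uscale q n d u"
  have "uscale q n (u i) w = u"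
  proof (rule ext)
    fix j show "uscale q n (u i) w j = u j"
    proof (cases "j < n")
      case True
      have "uscale q n (u i) w j = (u i * (d * u j mod int q)) mod int q"
        using True by (simp add: uscale_def w_def)
      also have "\<dots> = ((u i * d) * u j) mod int q" by (simp add: mod_mult_right_eq mult.assoc)
      also have "\<dots> = (1 * u j) mod int q"
        using cong_mult[OF d cong_refl[of "u j"]] unfolding unique_euclidean_semiring_class.cong_def .
      also have "\<dots> = u j" using ur[OF True] by simp
      finally show ?thesis .
    next
      case False
      then show ?thesis using uv by (auto simp: uscale_def vecs_eq PiE_def extensional_def)
    qed
  qed
  moreover have "u i \<in> zunits q" using cop ur[OF i(1)] by (simp add: zunits_def)
  moreover have "w \<in> chart q n i 1" unfolding chart_def w_def uscale_def
  proof (rule restrict_PiE_iff[THEN iffD2], intro ballI)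
    fix j assume "j \<in> {..<n}"
    have "(d * u i) mod int q = 1" using d q2 unfolding unique_euclidean_semiring_class.cong_def by (simp add: mult.commute)
    then show "(d * u j) mod int q \<in> (if j = i then {1} else {0..<int q})" using q2 by auto
  qed
  ultimately show "u \<in> (\<lambda>(i, c, w). uscale (p ^ k) n c w) `
       (SIGMA i:{..<n}. zunits (p ^ k) \<times> chart (p ^ k) n i 1)"
    using i(1) unfolding q_def by (intro rev_image_eqI[of "(i, u i, w)"]) simp_all
qed

text \<open>The \<open>n\<close> charts overlap, and adding up all of them gives the factor
  \<open>n\<close>; the unit multiples within a chart give \<open>totient\<close>.\<close>

lemma maximal_bound_prime_power:
  assumes p: "prime p" and k: "1 \<le> k" and n: "1 \<le> n" and J: "real (p ^ k) \<le> 2 ^ J"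
  shows "maximal_bound n (p ^ k)
    (real n * ((real J + 2) ^ n * (1 + 2 ^ n * (real J + 1) * restricted_const n k (p ^ k))))"
  unfolding maximal_bound_def
proof (intro allI impI)
  fix f :: "(nat \<Rightarrow> int) \<Rightarrow> real"
  assume f: "\<forall>x\<in>vecs (p ^ k) n. 0 \<le> f x"
  define q where "q = p ^ k"
  define c where "c = (real J + 2) ^ n * (1 + 2 ^ n * (real J + 1) * restricted_const n k q)"
  define S where "S = real q ^ (n - 1) * (\<Sum>x\<in>vecs q n. f x ^ n)"
  have q2: "2 \<le> q" using prime_power_ge_2[OF p k] by (simp add: q_def)
  define F where "F u = fstar q n f u ^ n" for u
  have F0: "0 \<le> F u" for u unfolding F_def using f q2
    by (intro zero_le_power fstar_nonneg) (auto simp: q_def)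
  define I where "I = (SIGMA i:{..<n}. zunits q \<times> chart q n i 1)"
  have finI: "finite I" unfolding I_def by (intro finite_SigmaI) auto
  have "(\<Sum>u\<in>uvecs q n. F u) \<le> (\<Sum>u\<in>(\<lambda>(i, c, w). uscale q n c w) ` I. F u)"
    using uvecs_prime_power_subset[OF p k, of n] finI F0 unfolding I_def q_def
    by (intro sum_mono2) auto
  also have "\<dots> \<le> (\<Sum>x\<in>I. (F \<circ> (\<lambda>(i, c, w). uscale q n c w)) x)"
    by (rule sum_image_le[OF finI]) (rule F0)
  also have "\<dots> = (\<Sum>i<n. \<Sum>x\<in>zunits q \<times> chart q n i 1. F (uscale q n (fst x) (snd x)))"
    unfolding I_def by (subst sum.Sigma) (auto simp: case_prod_unfold)
  also have "\<dots> = (\<Sum>i<n. \<Sum>c\<in>zunits q. \<Sum>w\<in>chart q n i 1. F (uscale q n c w))"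
    by (simp add: sum.cartesian_product case_prod_unfold)
  also have "\<dots> = (\<Sum>i<n. \<Sum>c\<in>zunits q. \<Sum>w\<in>chart q n i 1. F w)"
    using q2 by (intro sum.cong refl) (auto simp: F_def zunits_def fstar_uscale)
  also have "\<dots> \<le> (\<Sum>i<n. \<Sum>b\<in>zunits q. c * S)"
  proof (intro sum_mono)
    fix i assume i: "i \<in> {..<n}"
    have "\<exists>a. \<forall>u. a u \<in> vecs q n \<and> fstar q n f u = (\<Sum>t\<in>{0..<int q}. f (pt q n (a u) t u))"
    proof (rule choice, rule allI)
      fix u
      have "1 \<le> q" using q2 by simp
      from fstar_attained[OF this, of n f u]
      show "\<exists>b. b \<in> vecs q n \<and> fstar q n f u = (\<Sum>t\<in>{0..<int q}. f (pt q n b t u))" by blast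
    qed
    then obtain a where a: "\<And>u. a u \<in> vecs q n"
      "\<And>u. fstar q n f u = (\<Sum>t\<in>{0..<int q}. f (pt q n (a u) t u))" by blast
    have "(\<Sum>u\<in>chart q n i 1. (\<Sum>t\<in>{0..<int q}. f (pt q n (a u) t u)) ^ n) \<le> c * S"
      unfolding c_def S_def
    proof (rule kakeya_chart_strong_type[OF p k _ q_def])
      show "i < n" using i by simp
      show "real q \<le> 2 ^ J" using J by (simp only: q_def)
      show "0 \<le> f x" if "x \<in> vecs q n" for x using f that by (simp only: q_def)
    qed (rule a(1))
    then show "(\<Sum>w\<in>chart q n i 1. F w) \<le> c * S" unfolding F_def a(2) .
  qed
  also have "\<dots> = real n * c * (real (totient q) * S)" using q2 by (simp add: card_zunits)
  finally show "(\<Sum>u\<in>uvecs (p ^ k) n. fstar (p ^ k) n f u ^ n)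
     \<le> real n * ((real J + 2) ^ n * (1 + 2 ^ n * (real J + 1) * restricted_const n k (p ^ k))) *
       (real (totient (p ^ k)) * real (p ^ k) ^ (n - 1) * (\<Sum>x\<in>vecs (p ^ k) n. f x ^ n))"
    unfolding F_def c_def S_def q_def by (simp only: mult.assoc)
qed

section \<open>Coprime moduli\<close>

lemma obtain_crt:
  fixes m1 m2 :: nat
  assumes cop: "coprime m1 m2" and m: "1 \<le> m1" "1 \<le> m2"
  obtains cr :: "int \<Rightarrow> int \<Rightarrow> int" where
    "\<And>x y. cr x y \<in> {0..<int (m1 * m2)}"
    "\<And>x y. cr x y mod int m1 = x mod int m1"
    "\<And>x y. cr x y mod int m2 = y mod int m2"
proof -
  have c: "coprime (int m1) (int m2)" using cop by simp
  have ex: "\<exists>z. z \<in> {0..<int (m1 * m2)} \<and> z mod int m1 = x mod int m1 \<and> z mod int m2 = y mod int m2" for x y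
  proof -
    obtain z where z: "[z = x] (mod int m1)" "[z = y] (mod int m2)"
      using binary_chinese_remainder_int[OF c] by blast
    have "z mod int (m1 * m2) \<in> {0..<int (m1 * m2)}" using m by simp
    moreover have "z mod int (m1 * m2) mod int m1 = x mod int m1"
      using z(1) by (simp add: mod_mod_cancel unique_euclidean_semiring_class.cong_def)
    moreover have "z mod int (m1 * m2) mod int m2 = y mod int m2"
      using z(2) by (simp add: mod_mod_cancel unique_euclidean_semiring_class.cong_def)
    ultimately show ?thesis by blast
  qed
  then have "\<exists>cr. \<forall>x y. cr x y \<in> {0..<int (m1 * m2)} \<and> cr x y mod int m1 = x mod int m1 \<and>
      cr x y mod int m2 = y mod int m2" by metis
  then show ?thesis using that by blast
qed

lemma crt_unique:
  fixes m1 m2 :: nat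
  assumes "coprime m1 m2" "a mod int m1 = b mod int m1" "a mod int m2 = b mod int m2"
    "a \<in> {0..<int (m1 * m2)}" "b \<in> {0..<int (m1 * m2)}"
  shows "a = b"
proof -
  have "int m1 dvd a - b" "int m2 dvd a - b" using assms(2,3) by (simp_all add: mod_eq_dvd_iff)
  then have "int m1 * int m2 dvd a - b" using assms(1) by (intro divides_mult) auto
  then have "a mod int (m1 * m2) = b mod int (m1 * m2)" by (simp add: mod_eq_dvd_iff)
  then show ?thesis using assms(4,5) by simp
qed

lemma vecs_eqI:
  assumes "x \<in> vecs N n" "y \<in> vecs N n" "\<And>i. i < n \<Longrightarrow> x i = y i"
  shows "x = y"
  using assms unfolding vecs_eq by (intro PiE_ext[of x "{..<n}" "\<lambda>_. {0..<int N}" y]) auto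

lemma vecs_nth: "x \<in> vecs N n \<Longrightarrow> i < n \<Longrightarrow> x i \<in> {0..<int N}"
  unfolding vecs_eq by (drule PiE_mem[of _ _ _ i]) auto

lemma restrict_in_vecs: "(\<And>i. i < n \<Longrightarrow> f i \<in> {0..<int N}) \<Longrightarrow> (\<lambda>i\<in>{..<n}. f i) \<in> vecs N n"
  unfolding vecs_eq by (intro restrict_PiE_iff[THEN iffD2]) auto

lemma maximal_bound_mult:
  assumes cop: "coprime N1 N2" and N: "1 \<le> N1" "1 \<le> N2" and K2: "0 \<le> K2"
    and b1: "maximal_bound n N1 K1" and b2: "maximal_bound n N2 K2"
  shows "maximal_bound n (N1 * N2) (K1 * K2)"
  unfolding maximal_bound_def
proof (intro allI impI)
  fix f :: "(nat \<Rightarrow> int) \<Rightarrow> real"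
  assume f: "\<forall>x\<in>vecs (N1 * N2) n. 0 \<le> f x"
  obtain cr where cr: "\<And>x y. cr x y \<in> {0..<int (N1 * N2)}"
    "\<And>x y. cr x y mod int N1 = x mod int N1" "\<And>x y. cr x y mod int N2 = y mod int N2"
    using obtain_crt[OF cop N] by blast
  define V where "V x y = (\<lambda>i\<in>{..<n}. cr (x i) (y i))" for x y :: "nat \<Rightarrow> int"
  have N12: "1 \<le> N1 * N2" using N by simp
  have Vv: "V x y \<in> vecs (N1 * N2) n" for x y
    unfolding V_def by (intro restrict_in_vecs cr)
  have V1: "V x y i mod int N1 = x i mod int N1" and V2: "V x y i mod int N2 = y i mod int N2" if "i < n" for x y i
    using that cr by (simp_all add: V_def)
  have bij_cr: "bij_betw (\<lambda>(x, y). cr x y) ({0..<int N1} \<times> {0..<int N2}) {0..<int (N1 * N2)}"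
  proof (rule bij_betw_byWitness[of _ "\<lambda>z. (z mod int N1, z mod int N2)"])
    show "\<forall>a'\<in>{0..<int (N1 * N2)}. (case (a' mod int N1, a' mod int N2) of (x, y) \<Rightarrow> cr x y) = a'"
    proof
      fix z assume z: "z \<in> {0..<int (N1 * N2)}"
      have "cr (z mod int N1) (z mod int N2) = z"
        by (rule crt_unique[OF cop _ _ cr(1) z]) (simp_all add: cr)
      then show "(case (z mod int N1, z mod int N2) of (x, y) \<Rightarrow> cr x y) = z" by simp
    qed
    show "(\<lambda>(x, y). cr x y) ` ({0..<int N1} \<times> {0..<int N2}) \<subseteq> {0..<int (N1 * N2)}"
      using cr(1) by (auto simp only: split: prod.splits)
  qed (use N cr in auto)
  define U where "U M z = (\<lambda>i\<in>{..<n}. z i mod int M)" for M and z :: "nat \<Rightarrow> int"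
  have Uv: "U M z \<in> vecs M n" if "1 \<le> M" for M z
    unfolding U_def using that by (intro restrict_in_vecs) auto
  have VU: "V (U N1 z) (U N2 z) = z" if z: "z \<in> vecs (N1 * N2) n" for z
  proof (rule vecs_eqI[OF Vv z])
    fix i assume i: "i < n"
    show "V (U N1 z) (U N2 z) i = z i"
      by (rule crt_unique[OF cop _ _ vecs_nth[OF Vv i] vecs_nth[OF z i]])
        (simp_all add: V1[OF i] V2[OF i], simp_all add: U_def i)
  qed
  have UV1: "U N1 (V x y) = x" if x: "x \<in> vecs N1 n" for x y
    by (rule vecs_eqI[OF Uv[OF N(1)] x]) (use vecs_nth[OF x] in \<open>simp add: U_def V1\<close>)
  have UV2: "U N2 (V x y) = y" if y: "y \<in> vecs N2 n" for x y
    by (rule vecs_eqI[OF Uv[OF N(2)] y]) (use vecs_nth[OF y] in \<open>simp add: U_def V2\<close>)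
  have bij_V: "bij_betw (\<lambda>(x, y). V x y) (vecs N1 n \<times> vecs N2 n) (vecs (N1 * N2) n)"
  proof (rule bij_betw_byWitness[of _ "\<lambda>z. (U N1 z, U N2 z)"])
    show "(\<lambda>(x, y). V x y) ` (vecs N1 n \<times> vecs N2 n) \<subseteq> vecs (N1 * N2) n"
      using Vv by (auto simp only: split: prod.splits)
    show "(\<lambda>z. (U N1 z, U N2 z)) ` vecs (N1 * N2) n \<subseteq> vecs N1 n \<times> vecs N2 n" using Uv N by blast
    show "\<forall>z\<in>vecs (N1 * N2) n. (case (U N1 z, U N2 z) of (x, y) \<Rightarrow> V x y) = z" using VU by simp
    show "\<forall>a\<in>vecs N1 n \<times> vecs N2 n. (U N1 (case a of (x, y) \<Rightarrow> V x y), U N2 (case a of (x, y) \<Rightarrow> V x y)) = a"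
      using UV1 UV2 by auto
  qed
  have dvd1: "int p dvd V x y i \<longleftrightarrow> int p dvd x i" if "p dvd N1" "i < n" for p x y i
    using V1[OF that(2), of x y] that(1) by (metis dvd_mod_iff of_nat_dvd_iff)
  have dvd2: "int p dvd V x y i \<longleftrightarrow> int p dvd y i" if "p dvd N2" "i < n" for p x y i
    using V2[OF that(2), of x y] that(1) by (metis dvd_mod_iff of_nat_dvd_iff)
  have Vu: "V x y \<in> uvecs (N1 * N2) n \<longleftrightarrow> x \<in> uvecs N1 n \<and> y \<in> uvecs N2 n"
    if xy: "x \<in> vecs N1 n" "y \<in> vecs N2 n" for x y
  proof
    assume v: "V x y \<in> uvecs (N1 * N2) n"
    have "\<exists>i<n. \<not> int p dvd x i" if pp: "prime p" "p dvd N1" for p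
    proof -
      have "p dvd N1 * N2" using pp(2) by simp
      then obtain i where "i < n" "\<not> int p dvd V x y i" using v pp(1) unfolding uvecs_def by blast
      then show ?thesis using dvd1[OF pp(2)] by blast
    qed
    moreover have "\<exists>i<n. \<not> int p dvd y i" if pp: "prime p" "p dvd N2" for p
    proof -
      have "p dvd N1 * N2" using pp(2) by simp
      then obtain i where "i < n" "\<not> int p dvd V x y i" using v pp(1) unfolding uvecs_def by blast
      then show ?thesis using dvd2[OF pp(2)] by blast
    qed
    ultimately show "x \<in> uvecs N1 n \<and> y \<in> uvecs N2 n" using xy by (simp add: uvecs_def)
  next
    assume u: "x \<in> uvecs N1 n \<and> y \<in> uvecs N2 n"
    have "\<exists>i<n. \<not> int p dvd V x y i" if p: "prime p" "p dvd N1 * N2" for p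
    proof (cases "p dvd N1")
      case True
      then obtain i where "i < n" "\<not> int p dvd x i" using u p by (auto simp: uvecs_def)
      then show ?thesis using dvd1[OF True] by blast
    next
      case False
      then have d: "p dvd N2" using p by (simp add: prime_dvd_mult_iff)
      then obtain i where "i < n" "\<not> int p dvd y i" using u p by (auto simp: uvecs_def)
      then show ?thesis using dvd2[OF d] by blast
    qed
    then show "V x y \<in> uvecs (N1 * N2) n" using Vv by (simp add: uvecs_def)
  qed
  have bij_Vu: "bij_betw (\<lambda>(x, y). V x y) (uvecs N1 n \<times> uvecs N2 n) (uvecs (N1 * N2) n)"
  proof (rule bij_betw_subset[OF bij_V])
    show "uvecs N1 n \<times> uvecs N2 n \<subseteq> vecs N1 n \<times> vecs N2 n" by (auto simp: uvecs_def)
    show "(\<lambda>(x, y). V x y) ` (uvecs N1 n \<times> uvecs N2 n) = uvecs (N1 * N2) n"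
    proof (intro subset_antisym subsetI)
      fix z assume "z \<in> (\<lambda>(x, y). V x y) ` (uvecs N1 n \<times> uvecs N2 n)"
      then obtain x y where "z = V x y" "x \<in> uvecs N1 n" "y \<in> uvecs N2 n" by auto
      then show "z \<in> uvecs (N1 * N2) n" using Vu[of x y] by (simp add: uvecs_def)
    next
      fix z assume z: "z \<in> uvecs (N1 * N2) n"
      then have "V (U N1 z) (U N2 z) = z" by (intro VU) (simp add: uvecs_def)
      moreover from this have "U N1 z \<in> uvecs N1 n \<and> U N2 z \<in> uvecs N2 n"
        using Vu[OF Uv[OF N(1)] Uv[OF N(2)], of z z] z by simp
      ultimately show "z \<in> (\<lambda>(x, y). V x y) ` (uvecs N1 n \<times> uvecs N2 n)"
        by (intro rev_image_eqI[of "(U N1 z, U N2 z)"]) auto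
    qed
  qed
  have ptV: "pt (N1 * N2) n (V a1 a2) (cr t1 t2) (V u1 u2) = V (pt N1 n a1 t1 u1) (pt N2 n a2 t2 u2)"
    for a1 a2 t1 t2 u1 u2
  proof (rule vecs_eqI[OF pt_in_vecs[OF N12] Vv])
    fix i assume i: "i < n"
    have p: "pt (N1 * N2) n (V a1 a2) (cr t1 t2) (V u1 u2) i =
        (V a1 a2 i + cr t1 t2 * V u1 u2 i) mod int (N1 * N2)" using i by (simp add: pt_def)
    show "pt (N1 * N2) n (V a1 a2) (cr t1 t2) (V u1 u2) i = V (pt N1 n a1 t1 u1) (pt N2 n a2 t2 u2) i"
    proof (rule crt_unique[OF cop _ _ vecs_nth[OF pt_in_vecs[OF N12] i] vecs_nth[OF Vv i]])
      have "(V a1 a2 i + cr t1 t2 * V u1 u2 i) mod int N1 = (a1 i + t1 * u1 i) mod int N1"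
        by (intro mod_add_cong mod_mult_cong V1[OF i] cr)
      then show "pt (N1 * N2) n (V a1 a2) (cr t1 t2) (V u1 u2) i mod int N1 =
          V (pt N1 n a1 t1 u1) (pt N2 n a2 t2 u2) i mod int N1"
        unfolding p V1[OF i] using i by (simp add: pt_def mod_mod_cancel)
      have "(V a1 a2 i + cr t1 t2 * V u1 u2 i) mod int N2 = (a2 i + t2 * u2 i) mod int N2"
        by (intro mod_add_cong mod_mult_cong V2[OF i] cr)
      then show "pt (N1 * N2) n (V a1 a2) (cr t1 t2) (V u1 u2) i mod int N2 =
          V (pt N1 n a1 t1 u1) (pt N2 n a2 t2 u2) i mod int N2"
        unfolding p V2[OF i] using i by (simp add: pt_def mod_mod_cancel)
    qed
  qed
  define g where "g u1 x2 = fstar N1 n (\<lambda>x1. f (V x1 x2)) u1" for u1 x2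
  have g0: "0 \<le> g u1 x2" for u1 x2 unfolding g_def using f Vv by (intro fstar_nonneg N) auto
  \<comment> \<open>For fixed \<open>t2\<close> the sum over \<open>t1\<close> runs along a line
    modulo \<open>N1\<close> inside one slice of \<open>f\<close>. Its base point is the same for
    all \<open>t2\<close>, whereas \<open>g u1\<close> may choose another one in every slice; hence
    only an inequality.\<close>
  have fs: "fstar (N1 * N2) n f (V u1 u2) \<le> fstar N2 n (g u1) u2" for u1 u2
  proof -
    obtain a where a: "a \<in> vecs (N1 * N2) n"
      "fstar (N1 * N2) n f (V u1 u2) = (\<Sum>t\<in>{0..<int (N1 * N2)}. f (pt (N1 * N2) n a t (V u1 u2)))"
      using fstar_attained[OF N12] by blast
    have "fstar (N1 * N2) n f (V u1 u2) =
        (\<Sum>t\<in>{0..<int (N1 * N2)}. f (pt (N1 * N2) n (V (U N1 a) (U N2 a)) t (V u1 u2)))"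
      unfolding a(2) VU[OF a(1)] ..
    also have "\<dots> = (\<Sum>(t1, t2)\<in>{0..<int N1} \<times> {0..<int N2}.
        f (V (pt N1 n (U N1 a) t1 u1) (pt N2 n (U N2 a) t2 u2)))"
      by (subst sum.reindex_bij_betw[OF bij_cr, symmetric]) (simp add: case_prod_unfold ptV)
    also have "\<dots> = (\<Sum>t2\<in>{0..<int N2}. \<Sum>t1\<in>{0..<int N1}.
        f (V (pt N1 n (U N1 a) t1 u1) (pt N2 n (U N2 a) t2 u2)))"
      by (subst sum.swap) (simp add: sum.cartesian_product)
    also have "\<dots> \<le> (\<Sum>t2\<in>{0..<int N2}. g u1 (pt N2 n (U N2 a) t2 u2))"
      unfolding g_def
      by (intro sum_mono fstar_ge[of "U N1 a" N1 n "\<lambda>x1. f (V x1 y)" u1 for y] Uv N)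
    also have "\<dots> \<le> fstar N2 n (g u1) u2" by (intro fstar_ge Uv N)
    finally show ?thesis .
  qed
  have fs0: "0 \<le> fstar (N1 * N2) n f u" for u using f by (intro fstar_nonneg N12) auto
  define c1 where "c1 = real (totient N1) * real N1 ^ (n - 1)"
  define c2 where "c2 = real (totient N2) * real N2 ^ (n - 1)"
  have "(\<Sum>u\<in>uvecs (N1 * N2) n. fstar (N1 * N2) n f u ^ n) =
      (\<Sum>u1\<in>uvecs N1 n. \<Sum>u2\<in>uvecs N2 n. fstar (N1 * N2) n f (V u1 u2) ^ n)"
    by (subst sum.reindex_bij_betw[OF bij_Vu, symmetric])
      (simp add: case_prod_unfold sum.cartesian_product)
  also have "\<dots> \<le> (\<Sum>u1\<in>uvecs N1 n. \<Sum>u2\<in>uvecs N2 n. fstar N2 n (g u1) u2 ^ n)"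
    by (intro sum_mono power_mono fs fs0)
  \<comment> \<open>\<open>b2\<close> is applied to \<open>g u1\<close> with \<open>u1\<close>
    fixed; after the swap, \<open>b1\<close> is applied to the slice of \<open>f\<close> at a fixed
    \<open>x2\<close>.\<close>
  also have "\<dots> \<le> (\<Sum>u1\<in>uvecs N1 n. K2 * (c2 * (\<Sum>x2\<in>vecs N2 n. g u1 x2 ^ n)))"
  proof (rule sum_mono)
    fix u1
    show "(\<Sum>u2\<in>uvecs N2 n. fstar N2 n (g u1) u2 ^ n) \<le> K2 * (c2 * (\<Sum>x2\<in>vecs N2 n. g u1 x2 ^ n))"
      using b2[unfolded maximal_bound_def, rule_format, of "g u1"] g0 by (simp only: c2_def)
  qed
  also have "\<dots> = K2 * (c2 * (\<Sum>x2\<in>vecs N2 n. \<Sum>u1\<in>uvecs N1 n. g u1 x2 ^ n))"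
    by (subst sum.swap) (simp only: sum_distrib_left)
  also have "\<dots> \<le> K2 * (c2 * (\<Sum>x2\<in>vecs N2 n. K1 * (c1 * (\<Sum>x1\<in>vecs N1 n. f (V x1 x2) ^ n))))"
  proof (intro mult_left_mono sum_mono K2)
    fix x2
    show "(\<Sum>u1\<in>uvecs N1 n. g u1 x2 ^ n) \<le> K1 * (c1 * (\<Sum>x1\<in>vecs N1 n. f (V x1 x2) ^ n))"
      unfolding g_def using b1[unfolded maximal_bound_def, rule_format, of "\<lambda>x1. f (V x1 x2)"] f Vv
      by (simp only: c1_def)
  qed (simp add: c2_def)
  also have "\<dots> = K1 * K2 * (c1 * c2 * (\<Sum>x2\<in>vecs N2 n. \<Sum>x1\<in>vecs N1 n. f (V x1 x2) ^ n))"
    by (simp add: sum_distrib_left mult_ac)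
  also have "(\<Sum>x2\<in>vecs N2 n. \<Sum>x1\<in>vecs N1 n. f (V x1 x2) ^ n) = (\<Sum>x\<in>vecs (N1 * N2) n. f x ^ n)"
    by (subst sum.swap, subst sum.reindex_bij_betw[OF bij_V, symmetric])
      (simp add: case_prod_unfold sum.cartesian_product)
  also have "c1 * c2 = real (totient (N1 * N2)) * real (N1 * N2) ^ (n - 1)"
    by (simp add: c1_def c2_def totient_mult_coprime[OF cop] power_mult_distrib)
  finally show "(\<Sum>u\<in>uvecs (N1 * N2) n. fstar (N1 * N2) n f u ^ n) \<le>
      K1 * K2 * (real (totient (N1 * N2)) * real (N1 * N2) ^ (n - 1) * (\<Sum>x\<in>vecs (N1 * N2) n. f x ^ n))" .
qed

lemma maximal_bound_1: "maximal_bound n 1 1"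
  unfolding maximal_bound_def
proof (intro allI impI)
  fix f :: "(nat \<Rightarrow> int) \<Rightarrow> real"
  define z where "z = (\<lambda>i\<in>{..<n}. 0::int)"
  have v: "vecs 1 n = {z}"
  proof (intro subset_antisym subsetI)
    have z: "z \<in> vecs 1 n" unfolding z_def by (intro restrict_in_vecs) auto
    fix x
    show "x \<in> {z}" if x: "x \<in> vecs 1 n"
    proof -
      have "x = z" by (rule vecs_eqI[OF x z]) (use vecs_nth[OF x] in \<open>fastforce simp: z_def\<close>)
      then show ?thesis by simp
    qed
    show "x \<in> vecs 1 n" if "x \<in> {z}" using that z by simp
  qed
  have u: "uvecs 1 n = {z}" unfolding uvecs_def v by auto
  have "fstar 1 n f u = f z" for u
  proof -
    obtain a where "fstar 1 n f u = (\<Sum>t\<in>{0..<int 1}. f (pt 1 n a t u))"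
      using fstar_attained[OF order_refl] by blast
    moreover have "pt 1 n a t u = z" for t using pt_in_vecs[OF order_refl, of n a t u] v by blast
    ultimately show ?thesis by simp
  qed
  then show "(\<Sum>u\<in>uvecs 1 n. fstar 1 n f u ^ n) \<le>
      1 * (real (totient 1) * real 1 ^ (n - 1) * (\<Sum>x\<in>vecs 1 n. f x ^ n))"
    unfolding u v by simp
qed

text \<open>The constants multiply over the prime factors of \<open>N\<close>, whose number is
  unbounded, so a constant \<open>A\<close> per prime is not affordable as such. For
  \<open>p > Q\<close> it is absorbed by \<open>p powr d\<close>; the primes up to \<open>Q\<close>
  contribute at most \<open>A ^ Q\<close>, independently of \<open>N\<close>.\<close>

lemma maximal_bound_general:
  fixes \<delta> :: real
  assumes \<delta>: "0 < \<delta>" and n: "1 \<le> n"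
  shows "\<exists>C\<ge>0. \<forall>N\<ge>1. maximal_bound n N (C * real N powr \<delta>)"
proof -
  \<comment> \<open>One half of the exponent bounds the polylogarithm, the other half absorbs
    \<open>A\<close> at large primes.\<close>
  define d where "d = \<delta> / 2"
  have d0: "0 < d" using \<delta> by (simp add: d_def)
  from polylog_le_powr[OF d0 n] obtain A where A: "1 \<le> A"
    and AJ: "\<And>p k. prime p \<Longrightarrow> 1 \<le> k \<Longrightarrow> \<exists>J. real (p ^ k) \<le> 2 ^ J \<and>
    real n * ((real J + 2) ^ n * (1 + 2 ^ n * (real J + 1) * restricted_const n k (p ^ k)))
      \<le> A * real (p ^ k) powr d" by blast
  define Q where "Q = nat \<lceil>A powr (1 / d)\<rceil>"
  define c where "c p = (if p \<le> Q then A else 1)" for p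
  have c1: "1 \<le> c p" for p using A by (simp add: c_def)
  have pp: "maximal_bound n (p ^ k) (c p * real (p ^ k) powr \<delta>)" if p: "prime p" and k: "1 \<le> k" for p k
  proof -
    have q1: "1 \<le> real (p ^ k)" using prime_power_ge_2[OF p k] by linarith
    obtain J where J: "real (p ^ k) \<le> 2 ^ J"
      "real n * ((real J + 2) ^ n * (1 + 2 ^ n * (real J + 1) * restricted_const n k (p ^ k)))
      \<le> A * real (p ^ k) powr d" using AJ[OF p k] by blast
    have "A \<le> c p * real (p ^ k) powr d"
    proof (cases "p \<le> Q")
      case True
      have "A * 1 \<le> A * real (p ^ k) powr d"
        using A q1 d0 by (intro mult_left_mono ge_one_powr_ge_zero) auto
      then show ?thesis using True by (simp add: c_def)
    next
      case False
      then have "A powr (1 / d) \<le> real p" unfolding Q_def by linarith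
      then have "(A powr (1 / d)) powr d \<le> real p powr d" using d0 by (intro powr_mono2) auto
      then have "A \<le> real p powr d" using A d0 by (simp add: powr_powr)
      also have "\<dots> \<le> real (p ^ k) powr d"
      proof (intro powr_mono2)
        have "p ^ 1 \<le> p ^ k" using k prime_gt_0_nat[OF p] by (intro power_increasing) auto
        then show "real p \<le> real (p ^ k)" by (simp only: power_one_right of_nat_le_iff)
      qed (use d0 in auto)
      finally show ?thesis using False by (simp add: c_def)
    qed
    then have "A * real (p ^ k) powr d \<le> c p * real (p ^ k) powr d * real (p ^ k) powr d"
      by (intro mult_right_mono) auto
    also have "\<dots> = c p * real (p ^ k) powr \<delta>"
      by (simp add: d_def mult.assoc flip: powr_add)
    finally show ?thesis
      using maximal_bound_mono[OF maximal_bound_prime_power[OF p k n J(1)]] J(2) by (meson order_trans)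
  qed
  have main: "1 \<le> N \<Longrightarrow> maximal_bound n N ((\<Prod>p\<in>prime_factors N. c p) * real N powr \<delta>)" for N
  proof (induction N rule: less_induct)
    case (less N)
    show ?case
    proof (cases "N = 1")
      case True then show ?thesis using maximal_bound_1 by simp
    next
      case False
      then obtain p where p: "prime p" "p dvd N" using prime_factor_nat by blast
      define k where "k = multiplicity p N"
      have N0: "N \<noteq> 0" using less.prems by simp
      have "\<not> is_unit p" using p by auto
      from multiplicity_decompose'[OF N0 this] obtain N' where N': "N = p ^ k * N'" "\<not> p dvd N'"
        unfolding k_def by blast
      have N'1: "1 \<le> N'" using N' N0 by (cases N') auto
      have k1: "1 \<le> k" using N' p by (cases k) auto
      have "2 \<le> p ^ k" using prime_power_ge_2[OF p(1) k1] .
      then have lt: "N' < N" using N' N'1 by simp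
      have cop: "coprime (p ^ k) N'" using p(1) N'(2) by (simp add: prime_imp_coprime)
      have pf: "prime_factors N = insert p (prime_factors N')"
        unfolding N'(1) using p(1) k1 N'1
        by (subst prime_factors_product) (auto simp: prime_factors_power prime_prime_factors)
      have "maximal_bound n (p ^ k * N')
          (c p * real (p ^ k) powr \<delta> * ((\<Prod>p\<in>prime_factors N'. c p) * real N' powr \<delta>))"
      proof (rule maximal_bound_mult[OF cop _ N'1 _ pp[OF p(1) k1] less.IH[OF lt N'1]])
        show "1 \<le> p ^ k" using \<open>2 \<le> p ^ k\<close> by simp
        show "0 \<le> (\<Prod>p\<in>prime_factors N'. c p) * real N' powr \<delta>"
          using c1 by (intro mult_nonneg_nonneg prod_nonneg) (auto intro: order_trans[OF zero_le_one])
      qed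
      also have "c p * real (p ^ k) powr \<delta> * ((\<Prod>p\<in>prime_factors N'. c p) * real N' powr \<delta>)
          = (\<Prod>p\<in>prime_factors N. c p) * real N powr \<delta>"
      proof -
        have "p \<notin> prime_factors N'" using N'(2) by auto
        then have "(\<Prod>p\<in>prime_factors N. c p) = c p * (\<Prod>p\<in>prime_factors N'. c p)"
          unfolding pf by simp
        moreover have "real N powr \<delta> = real (p ^ k) powr \<delta> * real N' powr \<delta>"
          unfolding N'(1) of_nat_mult by (rule powr_mult)
        ultimately show ?thesis by simp
      qed
      finally show ?thesis using N'(1) by simp
    qed
  qed
  have "maximal_bound n N (A ^ Q * real N powr \<delta>)" if "1 \<le> N" for N
  proof (rule maximal_bound_mono[OF main[OF that]], rule mult_right_mono)
    have "(\<Prod>p\<in>prime_factors N. c p) = (\<Prod>p\<in>{p\<in>prime_factors N. p \<le> Q}. A)"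
      unfolding c_def by (subst prod.inter_filter) simp_all
    also have "\<dots> = A ^ card {p\<in>prime_factors N. p \<le> Q}" by simp
    also have "\<dots> \<le> A ^ Q"
    proof (rule power_increasing[OF _ A])
      have "{p\<in>prime_factors N. p \<le> Q} \<subseteq> {1..Q}"
        by (auto simp: in_prime_factors_iff prime_gt_0_nat Suc_le_eq)
      then have "card {p\<in>prime_factors N. p \<le> Q} \<le> card {1..Q}" by (intro card_mono) auto
      then show "card {p\<in>prime_factors N. p \<le> Q} \<le> Q" by simp
    qed
    finally show "(\<Prod>p\<in>prime_factors N. c p) \<le> A ^ Q" .
  qed auto
  then show ?thesis using A by (intro exI[of _ "A ^ Q"]) auto
qed

section \<open>Projective space\<close>

lemma Units_ZN:
  assumes "2 \<le> N" shows "Units (ZN N) = zunits N"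
proof -
  have "residues (int N)" using assms by unfold_locales auto
  from residues.res_units_eq[OF this] have U: "Units (ZN N) = {x. 0 < x \<and> x < int N \<and> coprime x (int N)}" .
  have "\<not> coprime 0 (int N)" using assms by simp
  then have "0 < c" if "0 \<le> c" "coprime c (int N)" for c using that by (cases "c = 0") auto
  then show ?thesis unfolding U zunits_def by auto
qed

lemma vadd_vscale: "vadd N n a (vscale N n t u) = pt N n a t u"
  by (rule ext) (simp add: vadd_def vscale_def pt_def residue_ring_def mod_add_right_eq)

lemma vscale_eq_uscale: "vscale N n c u = uscale N n c u"
  by (rule ext) (simp add: vscale_def uscale_def residue_ring_def)

lemma proj_vecs_eq_uvecs:
  assumes N: "2 \<le> N"
  shows "proj_vecs N n = uvecs N n"
proof -
  have "u i mod int (p ^ multiplicity p N) \<in> Units (ZN (p ^ multiplicity p N)) \<longleftrightarrow> \<not> int p dvd u i"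
    if p: "p \<in> prime_factors N" for p i and u :: "nat \<Rightarrow> int"
  proof -
    define k where "k = multiplicity p N"
    have pr: "prime p" "p dvd N" using p by auto
    have k: "1 \<le> k" unfolding k_def using p by (simp add: prime_factors_multiplicity Suc_le_eq)
    have q: "2 \<le> p ^ k" using prime_power_ge_2[OF pr(1) k] .
    have "u i mod int (p ^ k) \<in> zunits (p ^ k) \<longleftrightarrow> coprime (u i mod int (p ^ k)) (int (p ^ k))"
      using q pr(1) by (auto simp: zunits_def prime_gt_0_nat)
    also have "\<dots> \<longleftrightarrow> coprime (u i) (int (p ^ k))"
      by (metis coprime_commute coprime_iff_gcd_eq_1 gcd_red_int)
    also have "\<dots> \<longleftrightarrow> coprime (u i) (int p)" using k by (simp)
    also have "\<dots> \<longleftrightarrow> \<not> int p dvd u i"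
      using pr(1) by (metis coprime_commute coprime_common_divisor dvd_refl not_prime_unit prime_imp_coprime prime_nat_int_transfer)
    finally show ?thesis unfolding Units_ZN[OF q[unfolded k_def]] k_def .
  qed
  moreover have "p \<in> prime_factors N \<longleftrightarrow> prime p \<and> p dvd N" for p
    using N by (auto simp: in_prime_factors_iff)
  ultimately show ?thesis unfolding proj_vecs_def uvecs_def by (intro Collect_cong) meson
qed

text \<open>Otherwise \<open>N / gcd d N\<close> is a non-unit dividing all coordinates of
  \<open>u\<close>, and a prime factor of it contradicts unimodularity. This makes the unit
  multiples of \<open>u\<close>, and the points of a line in direction \<open>u\<close>, pairwise
  distinct.\<close>

lemma uvecs_cancel:
  assumes N: "1 \<le> N" and u: "u \<in> uvecs N n" and d: "\<And>i. i < n \<Longrightarrow> int N dvd d * u i"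
  shows "int N dvd d"
proof (rule ccontr)
  assume nd: "\<not> int N dvd d"
  define g where "g = gcd d (int N)"
  have g0: "g \<noteq> 0" using N by (simp add: g_def)
  obtain d' e where de: "d = g * d'" "int N = g * e" "coprime d' e"
    using gcd_coprime_exists[of d "int N"] g0 unfolding g_def by (metis mult.commute)
  have "\<not> is_unit e"
  proof
    assume "is_unit e"
    then have "int N dvd g" using de(2) by (simp add: mult_unit_dvd_iff)
    then show False using nd unfolding g_def by (meson dvd_trans gcd_dvd1)
  qed
  moreover have "e \<noteq> 0" using de(2) N by auto
  ultimately obtain p where p: "prime p" "p dvd e" using prime_divisor_exists by blast
  have pN: "p dvd int N" using p(2) de(2) by simp
  define p' where "p' = nat p"
  have p': "prime p'" "int p' = p" using p(1) prime_gt_0_int[OF p(1)] by (auto simp: p'_def prime_nat_iff_prime)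
  have "p' dvd N" using pN p'(2) by (metis of_nat_dvd_iff)
  then obtain i where i: "i < n" "\<not> p dvd u i" using u p' by (auto simp: uvecs_def)
  have "g * e dvd g * (d' * u i)" using d[OF i(1)] de by (simp add: mult.assoc)
  then have "e dvd d' * u i" using g0 by simp
  then have "e dvd u i" using de(3) by (simp add: coprime_commute coprime_dvd_mult_right_iff)
  then show False using p(2) i(2) dvd_trans by blast
qed

lemma uscale_uscale: "uscale N n c (uscale N n d u) = uscale N n ((c * d) mod int N) u"
  by (rule ext) (simp add: uscale_def mod_mult_right_eq mod_mult_left_eq mult.assoc)

lemma uscale_1:
  assumes "u \<in> vecs N n" shows "uscale N n 1 u = u"
proof (rule ext)
  fix j show "uscale N n 1 u j = u j"
    using vecs_nth[OF assms, of j] assms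
    by (cases "j < n") (auto simp: uscale_def vecs_eq PiE_def extensional_def)
qed

lemma uscale_in_uvecs:
  assumes N: "1 \<le> N" and c: "c \<in> zunits N" and u: "u \<in> uvecs N n"
  shows "uscale N n c u \<in> uvecs N n"
proof -
  have "\<exists>i<n. \<not> int p dvd uscale N n c u i" if p: "prime p" "p dvd N" for p
  proof -
    obtain i where i: "i < n" "\<not> int p dvd u i" using u p by (auto simp: uvecs_def)
    have pN: "int p dvd int N" using p by simp
    have "\<not> int p dvd c"
    proof
      assume "int p dvd c"
      then have "is_unit (int p)" using c pN unfolding zunits_def
        by (metis (mono_tags, lifting) coprime_common_divisor mem_Collect_eq)
      then show False using p(1) by simp
    qed
    then have "\<not> int p dvd c * u i" using i p(1) by (simp add: prime_dvd_mult_iff)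
    then have "\<not> int p dvd uscale N n c u i" using pN i(1) by (simp add: uscale_def dvd_mod_iff)
    then show ?thesis using i by blast
  qed
  moreover have "uscale N n c u \<in> vecs N n"
    unfolding uscale_def using N by (intro restrict_in_vecs) auto
  ultimately show ?thesis by (simp add: uvecs_def)
qed

lemma uscale_inj:
  assumes N: "1 \<le> N" and u: "u \<in> uvecs N n" and c: "c \<in> {0..<int N}" "d \<in> {0..<int N}"
    and eq: "uscale N n c u = uscale N n d u"
  shows "c = d"
proof -
  have "int N dvd c - d"
  proof (rule uvecs_cancel[OF N u])
    fix i assume "i < n"
    then have "(c * u i) mod int N = (d * u i) mod int N" using fun_cong[OF eq, of i] by (simp add: uscale_def)
    then show "int N dvd (c - d) * u i" by (simp add: mod_eq_dvd_iff left_diff_distrib)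
  qed
  then have "c mod int N = d mod int N" by (simp add: mod_eq_dvd_iff)
  then show ?thesis using c by simp
qed

lemma pt_inj:
  assumes N: "1 \<le> N" and u: "u \<in> uvecs N n" and st: "s \<in> {0..<int N}" "t \<in> {0..<int N}"
    and eq: "pt N n a s u = pt N n a t u"
  shows "s = t"
proof (rule uscale_inj[OF N u st])
  show "uscale N n s u = uscale N n t u"
  proof (rule ext)
    fix i
    show "uscale N n s u i = uscale N n t u i"
    proof (cases "i < n")
      case True
      then have "(a i + s * u i) mod int N = (a i + t * u i) mod int N"
        using fun_cong[OF eq, of i] by (simp add: pt_def)
      then show ?thesis using True by (simp add: uscale_def mod_eq_dvd_iff)
    qed (simp add: uscale_def)
  qed
qed

lemma zunits_inverse:
  assumes "2 \<le> N" "c \<in> zunits N"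
  shows "\<exists>d\<in>zunits N. (d * c) mod int N = 1"
proof -
  have "coprime c (int N)" using assms by (simp add: zunits_def)
  from cong_solve_coprime_int[OF this] obtain d where d: "[c * d = 1] (mod int N)" by blast
  then have "coprime d (int N)" using coprime_iff_invertible_int by (metis mult.commute)
  then have "coprime (d mod int N) (int N)" by (metis coprime_commute coprime_iff_gcd_eq_1 gcd_red_int)
  then have "d mod int N \<in> zunits N" using assms by (simp add: zunits_def)
  moreover have "(d mod int N * c) mod int N = 1"
    using d assms by (simp add: unique_euclidean_semiring_class.cong_def mod_mult_right_eq mult.commute)
  ultimately show ?thesis by blast
qed

lemma zunits_mult:
  assumes "1 \<le> N" "c \<in> zunits N" "d \<in> zunits N" shows "(c * d) mod int N \<in> zunits N"
proof -
  have "coprime (c * d) (int N)" using assms by (simp add: zunits_def)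
  then have "coprime ((c * d) mod int N) (int N)" by (metis coprime_commute coprime_iff_gcd_eq_1 gcd_red_int)
  then show ?thesis using assms by (simp add: zunits_def)
qed

section \<open>Projective classes as orbits of the units\<close>

lemma proj_rel_iff:
  assumes "2 \<le> N"
  shows "(u, v) \<in> proj_rel N n \<longleftrightarrow> u \<in> uvecs N n \<and> v \<in> uvecs N n \<and> (\<exists>c\<in>zunits N. v = uscale N n c u)"
  by (simp add: proj_rel_def proj_vecs_eq_uvecs[OF assms] Units_ZN[OF assms] vscale_eq_uscale)

lemma equiv_proj_rel:
  assumes N: "2 \<le> N" shows "equiv (uvecs N n) (proj_rel N n)"
proof (rule equivI)
  have N1: "1 \<le> N" using N by simp
  show "proj_rel N n \<subseteq> uvecs N n \<times> uvecs N n" using proj_rel_iff[OF N] by auto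
  show "refl_on (uvecs N n) (proj_rel N n)"
  proof (rule refl_onI)
    fix u assume u: "u \<in> uvecs N n"
    have "1 \<in> zunits N" using N by (simp add: zunits_def)
    moreover have "u = uscale N n 1 u" using u uscale_1[of u N n] by (simp add: uvecs_def)
    ultimately show "(u, u) \<in> proj_rel N n" using u proj_rel_iff[OF N] by blast
  qed
  show "sym (proj_rel N n)"
  proof (rule symI)
    fix u v assume uv: "(u, v) \<in> proj_rel N n"
    then obtain c where c: "c \<in> zunits N" "v = uscale N n c u" and u: "u \<in> uvecs N n" "v \<in> uvecs N n"
      using proj_rel_iff[OF N] by blast
    obtain d where d: "d \<in> zunits N" "(d * c) mod int N = 1" using zunits_inverse[OF N c(1)] by blast
    have "u = uscale N n d v" unfolding c(2) uscale_uscale d(2) using u uscale_1[of u N n] by (simp add: uvecs_def)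
    then show "(v, u) \<in> proj_rel N n" using u d proj_rel_iff[OF N] by blast
  qed
  show "trans (proj_rel N n)"
  proof (rule transI)
    fix u v w assume "(u, v) \<in> proj_rel N n" "(v, w) \<in> proj_rel N n"
    then obtain c d where c: "c \<in> zunits N" "v = uscale N n c u" "u \<in> uvecs N n"
      and d: "d \<in> zunits N" "w = uscale N n d v" "w \<in> uvecs N n"
      using proj_rel_iff[OF N] by blast
    have "w = uscale N n ((d * c) mod int N) u" using c d by (simp add: uscale_uscale)
    then show "(u, w) \<in> proj_rel N n" using c d zunits_mult[OF N1 d(1) c(1)] proj_rel_iff[OF N] by blast
  qed
qed

section \<open>The theorem\<close>

lemma lines_eq: "lines N n u = (\<lambda>a. (\<lambda>t. pt N n a t u) ` {0..<int N}) ` vecs N n"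
proof -
  have "carrier (ZN N) = {0..<int N}" by (auto simp: residue_ring_def)
  then show ?thesis by (simp only: lines_def vadd_vscale Setcompr_eq_image)
qed

text \<open>A unimodular vector with one coordinate is a unit, and any two units are unit multiples
  of each other: for \<open>n = 1\<close> the projective space is a single point.\<close>

lemma card_proj_space_1:
  assumes N: "2 \<le> N" and A: "A \<in> proj_space N 1" and B: "B \<in> proj_space N 1"
    and u: "u \<in> A" and v: "v \<in> B" and uv: "u \<in> uvecs N 1" "v \<in> uvecs N 1"
  shows "A = B"
proof -
  have cop: "coprime (w 0) (int N)" if w: "w \<in> uvecs N 1" for w
  proof (rule ccontr)
    assume "\<not> coprime (w 0) (int N)"
    then obtain c where c: "c dvd w 0" "c dvd int N" "\<not> is_unit c" by (rule not_coprimeE)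
    have "c \<noteq> 0" using c(2) N by auto
    with c(3) obtain p where "prime p" "p dvd c" using prime_divisor_exists by blast
    with c have p: "prime p" "p dvd w 0" "p dvd int N" using dvd_trans by blast+
    have p': "prime (nat p)" "int (nat p) = p" using p(1) prime_gt_0_int[OF p(1)] by (auto simp: prime_nat_iff_prime)
    then have "nat p dvd N" using p(3) by (metis of_nat_dvd_iff)
    then have "\<not> int (nat p) dvd w 0" using w p'(1) by (auto simp: uvecs_def simp del: int_nat_eq)
    then show False using p(2) unfolding p'(2) by contradiction
  qed
  have rng: "w 0 \<in> {0..<int N}" if "w \<in> uvecs N 1" for w
    using that vecs_nth[of w N 1 0] by (simp add: uvecs_def)
  have z: "u 0 \<in> zunits N" "v 0 \<in> zunits N" using uv cop rng by (simp_all add: zunits_def)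
  obtain d where d: "d \<in> zunits N" "(d * u 0) mod int N = 1" using zunits_inverse[OF N z(1)] by blast
  define c where "c = (v 0 * d) mod int N"
  have c: "c \<in> zunits N" unfolding c_def using N z(2) d(1) by (intro zunits_mult) auto
  have uc: "uscale N 1 c u \<in> uvecs N 1" using N c uv by (intro uscale_in_uvecs) auto
  have "v = uscale N 1 c u"
  proof (rule vecs_eqI[of v N 1 "uscale N 1 c u"])
    fix i :: nat assume "i < 1"
    then have i: "i = 0" by simp
    have "uscale N 1 c u i = ((v 0 * d) * u 0) mod int N"
      by (simp add: uscale_def i c_def mod_mult_left_eq)
    also have "\<dots> = (v 0 * ((d * u 0) mod int N)) mod int N" by (simp add: mod_mult_right_eq mult.assoc)
    also have "\<dots> = v 0" using d(2) rng[OF uv(2)] by simp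
    finally show "v i = uscale N 1 c u i" by (simp add: i)
  qed (use uv uc in \<open>simp_all add: uvecs_def\<close>)
  then have "(u, v) \<in> proj_rel N 1" using proj_rel_iff[OF N] uv c by blast
  then show ?thesis
    using quotient_eq_iff[OF equiv_proj_rel[OF N] A[unfolded proj_space_def proj_vecs_eq_uvecs[OF N]]
      B[unfolded proj_space_def proj_vecs_eq_uvecs[OF N]] u v] by simp
qed

theorem mainTheorem6:
  fixes \<epsilon> :: real and n :: nat
  assumes "\<epsilon> > 0" and "n \<ge> 1"
  shows "\<exists>C::real. \<forall>N::nat. N \<ge> 2 \<longrightarrow>
    (\<forall>(rep :: (nat \<Rightarrow> int) set \<Rightarrow> (nat \<Rightarrow> int)) (L :: (nat \<Rightarrow> int) set \<Rightarrow> (nat \<Rightarrow> int) set).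
      (\<forall>u \<in> proj_space N n. rep u \<in> u) \<longrightarrow>
      (\<forall>u \<in> proj_space N n. L u \<in> lines N n (rep u)) \<longrightarrow>
      ell_norm (maximal_exponent n) (vecs N n)
          (\<lambda>x. \<Sum>u \<in> proj_space N n. indicator (L u) x)
        \<le> C * real N powr \<epsilon> *
          (\<Sum>u \<in> proj_space N n. real (card (L u))) powr ((real n - 1) / real n))"
proof -
  \<comment> \<open>An \<open>n\<close>-th root at the end turns the exponent
    \<open>n * \<epsilon>\<close> into \<epsilon>.\<close>
  have "0 < real n * \<epsilon>" using assms by simp
  from maximal_bound_general[OF this assms(2)] obtain K where K: "0 \<le> K"
    and bound: "\<And>N. 1 \<le> N \<Longrightarrow> maximal_bound n N (K * real N powr (real n * \<epsilon>))" by blast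
  \<comment> \<open>The 1 serves the case \<open>n = 1\<close>, the root of \<open>K\<close> the
    other dimensions.\<close>
  define C where "C = max 1 (K powr (1 / real n))"
  show ?thesis
  proof (rule exI[of _ C], intro allI impI)
    fix N :: nat and rep :: "(nat \<Rightarrow> int) set \<Rightarrow> (nat \<Rightarrow> int)"
      and L :: "(nat \<Rightarrow> int) set \<Rightarrow> (nat \<Rightarrow> int) set"
    assume N: "2 \<le> N" and rep: "\<forall>u\<in>proj_space N n. rep u \<in> u"
      and L: "\<forall>u\<in>proj_space N n. L u \<in> lines N n (rep u)"
    have N1: "1 \<le> N" using N by simp
    define P where "P = proj_space N n"
    define h where "h x = (\<Sum>u\<in>P. indicator (L u) x :: real)" for x
    have eqv: "equiv (uvecs N n) (proj_rel N n)" by (rule equiv_proj_rel[OF N])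
    have P: "P = uvecs N n // proj_rel N n"
      by (simp add: P_def proj_space_def proj_vecs_eq_uvecs[OF N])
    have finP: "finite P" unfolding P by (rule finite_quotient[OF finite_uvecs]) (use equiv_proj_rel[OF N] equiv_type in auto)
    have repu: "rep A \<in> uvecs N n" if "A \<in> P" for A
      using that rep in_quotient_imp_subset[OF eqv] unfolding P_def[symmetric] P by blast
    have "\<forall>A\<in>P. \<exists>a\<in>vecs N n. L A = (\<lambda>t. pt N n a t (rep A)) ` {0..<int N}"
      using L unfolding lines_eq P_def by blast
    then obtain a where a: "\<And>A. A \<in> P \<Longrightarrow> a A \<in> vecs N n"
      and La: "\<And>A. A \<in> P \<Longrightarrow> L A = (\<lambda>t. pt N n (a A) t (rep A)) ` {0..<int N}" by metis
    have cardL: "card (L A) = N" if A: "A \<in> P" for A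
    proof -
      have "inj_on (\<lambda>t. pt N n (a A) t (rep A)) {0..<int N}"
        by (rule inj_onI) (rule pt_inj[OF N1 repu[OF A]])
      then show ?thesis unfolding La[OF A] by (simp add: card_image)
    qed
    have sumL: "(\<Sum>A\<in>P. real (card (L A))) = real (card P) * real N" by (simp add: cardL)
    have h0: "0 \<le> h x" for x by (simp add: h_def sum_nonneg)
    have "ell_norm (maximal_exponent n) (vecs N n) h
        \<le> C * real N powr \<epsilon> * (real (card P) * real N) powr ((real n - 1) / real n)"
    proof (cases "n = 1")
      case True
      have "A = B" if "A \<in> P" "B \<in> P" for A B
        using card_proj_space_1[OF N, of A B "rep A" "rep B"] that rep repu unfolding P_def True by blast
      then have cP: "card P \<le> 1" using card_le_Suc0_iff_eq[OF finP] by auto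
      \<comment> \<open>Since \<open>0 powr 0\<close> is 0, the last factor on the right is 1 only
        if \<open>P\<close> is nonempty.\<close>
      have "(\<lambda>i\<in>{..<n}. 1) \<in> uvecs N n"
        using N True restrict_in_vecs[of n "\<lambda>_. 1" N] by (auto simp: uvecs_def)
      then have "P \<noteq> {}" unfolding P quotient_def by blast
      then have "card P = 1" using cP finP by (metis card_0_eq le_antisym less_one not_le)
      then have rhs: "(real (card P) * real N) powr ((real n - 1) / real n) = 1" using N True by simp
      have "h x \<le> 1" for x
      proof -
        have "h x \<le> (\<Sum>A\<in>P. 1)" unfolding h_def by (intro sum_mono) (simp add: indicator_def)
        then show ?thesis using cP by simp
      qed
      then have "(SUP x\<in>vecs N n. \<bar>h x\<bar>) \<le> 1"
        using h0 vecs_nonempty[OF N1] by (intro cSUP_least) auto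
      also have "1 \<le> real N powr \<epsilon>" using N assms by (intro ge_one_powr_ge_zero) auto
      also have "1 * real N powr \<epsilon> \<le> C * real N powr \<epsilon>" by (intro mult_right_mono) (auto simp: C_def)
      finally show ?thesis unfolding rhs using True by (simp add: ell_norm_def maximal_exponent_def)
    next
      case False
      then have n2: "2 \<le> n" using assms(2) by simp
      define s where "s = real n / (real n - 1)"
      \<comment> \<open>The extremal function of the duality: \<open>f ^ n\<close> and
        \<open>h * f\<close> are both \<open>h powr s\<close>, so testing against \<open>f\<close>
        gives the norm without a supremum.\<close>
      define f where "f x = h x powr (1 / (real n - 1))" for x
      define T where "T = (\<Sum>x\<in>vecs N n. h x powr s)"
      have f0: "0 \<le> f x" for x by (simp add: f_def)
      have T0: "0 \<le> T" unfolding T_def by (intro sum_nonneg) simp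
      have fn: "f x ^ n = h x powr s" for x
        using n2 by (cases "h x = 0") (simp_all add: f_def s_def powr_power power_0_left)
      have hf: "h x powr s = h x * f x" for x
      proof (cases "h x = 0")
        case False
        have "s = 1 + 1 / (real n - 1)" using n2 by (simp add: s_def field_simps)
        then show ?thesis using False h0[of x] by (simp add: f_def powr_add)
      qed simp
      have line: "(\<Sum>x\<in>vecs N n. indicator (L A) x * f x) \<le> fstar N n f (rep A)" if A: "A \<in> P" for A
      proof -
        have "L A \<subseteq> vecs N n" unfolding La[OF A] using pt_in_vecs[OF N1] by blast
        then have "(\<Sum>x\<in>vecs N n. indicator (L A) x * f x) = sum f (L A)"
          by (simp add: indicator_def if_distrib[of "\<lambda>c. c * _"] sum.inter_restrict[symmetric] Int_absorb1 cong: if_cong)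
        also have "\<dots> \<le> (\<Sum>t\<in>{0..<int N}. (f \<circ> (\<lambda>t. pt N n (a A) t (rep A))) t)"
          unfolding La[OF A] by (rule sum_image_le) (simp_all add: f0)
        also have "\<dots> \<le> fstar N n f (rep A)" using fstar_ge[OF a[OF A], of f "rep A"] by simp
        finally show ?thesis .
      qed
      have "T = (\<Sum>x\<in>vecs N n. \<Sum>A\<in>P. indicator (L A) x * f x)"
        unfolding T_def hf by (simp add: h_def sum_distrib_right)
      also have "\<dots> = (\<Sum>A\<in>P. \<Sum>x\<in>vecs N n. indicator (L A) x * f x)" by (rule sum.swap)
      also have "\<dots> \<le> (\<Sum>A\<in>P. fstar N n f (rep A))" by (intro sum_mono line)
      finally have T1: "T \<le> (\<Sum>A\<in>P. fstar N n f (rep A))" .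
      have fs0: "0 \<le> fstar N n f u" for u by (intro fstar_nonneg N1 f0)
      \<comment> \<open>Hoelder over the directions, as an inequality of power means.\<close>
      have "T ^ n \<le> (\<Sum>A\<in>P. fstar N n f (rep A)) ^ n" using T1 T0 by (rule power_mono)
      also have "\<dots> \<le> real (card P) ^ (n - 1) * (\<Sum>A\<in>P. fstar N n f (rep A) ^ n)"
        using finP assms(2) fs0 by (intro power_sum_le) auto
      finally have T2: "T ^ n \<le> real (card P) ^ (n - 1) * (\<Sum>A\<in>P. fstar N n f (rep A) ^ n)" .
      \<comment> \<open>Distinct classes are disjoint orbits and the units act freely, so
        \<open>totient N\<close> copies of the sum over \<open>P\<close> form a part of the sum over
        unimodular vectors.\<close>
      have inj: "inj_on (\<lambda>(A, c). uscale N n c (rep A)) (P \<times> zunits N)"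
      proof (rule inj_onI, clarify)
        fix A c B d
        assume A: "A \<in> P" "c \<in> zunits N" and B: "B \<in> P" "d \<in> zunits N"
          and eq: "uscale N n c (rep A) = uscale N n d (rep B)"
        define w where "w = uscale N n c (rep A)"
        have w: "w \<in> uvecs N n" unfolding w_def using A by (intro uscale_in_uvecs N1 repu)
        have "(rep A, w) \<in> proj_rel N n" "(rep B, w) \<in> proj_rel N n"
          using proj_rel_iff[OF N] repu A B w eq unfolding w_def by blast+
        then have "(rep A, rep B) \<in> proj_rel N n"
          using eqv unfolding equiv_def by (meson symD transD)
        then have AB: "A = B"
          using quotient_eq_iff[OF eqv] A(1) B(1) rep unfolding P_def[symmetric] P by blast
        have "c = d" using uscale_inj[OF N1 repu[OF A(1)]] eq A B unfolding AB zunits_def by blast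
        with AB show "A = B \<and> c = d" by blast
      qed
      have "real (totient N) * (\<Sum>A\<in>P. fstar N n f (rep A) ^ n)
          = (\<Sum>A\<in>P. \<Sum>c\<in>zunits N. fstar N n f (uscale N n c (rep A)) ^ n)"
      proof -
        have "fstar N n f (uscale N n c (rep A)) = fstar N n f (rep A)" if "c \<in> zunits N" for c A
          using that by (intro fstar_uscale N1) (simp add: zunits_def)
        then show ?thesis by (simp add: card_zunits[OF N] sum_distrib_left)
      qed
      also have "\<dots> = (\<Sum>(A, c)\<in>P \<times> zunits N. fstar N n f (uscale N n c (rep A)) ^ n)"
        by (rule sum.cartesian_product)
      also have "\<dots> = (\<Sum>u\<in>(\<lambda>(A, c). uscale N n c (rep A)) ` (P \<times> zunits N). fstar N n f u ^ n)"
        by (subst sum.reindex[OF inj]) (simp add: case_prod_unfold)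
      also have "\<dots> \<le> (\<Sum>u\<in>uvecs N n. fstar N n f u ^ n)"
        using fs0 uscale_in_uvecs[OF N1] repu by (intro sum_mono2) auto
      also have "\<dots> \<le> K * real N powr (real n * \<epsilon>) * (real (totient N) * real N ^ (n - 1) * T)"
        using bound[OF N1] f0 unfolding maximal_bound_def T_def fn[symmetric] by blast
      finally have "real (totient N) * (\<Sum>A\<in>P. fstar N n f (rep A) ^ n)
          \<le> real (totient N) * (K * real N powr (real n * \<epsilon>) * (real N ^ (n - 1) * T))"
        by (simp only: mult_ac)
      then have T3: "(\<Sum>A\<in>P. fstar N n f (rep A) ^ n) \<le> K * real N powr (real n * \<epsilon>) * (real N ^ (n - 1) * T)"
        using N by simp
      define R where "R = real (card P) * real N"
      have R0: "0 \<le> R" by (simp add: R_def)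
      have "T ^ n \<le> real (card P) ^ (n - 1) * (K * real N powr (real n * \<epsilon>) * (real N ^ (n - 1) * T))"
        using T2 mult_left_mono[OF T3, of "real (card P) ^ (n - 1)"] by simp
      also have "\<dots> = K * real N powr (real n * \<epsilon>) * R ^ (n - 1) * T"
        by (simp add: R_def power_mult_distrib)
      finally have T4: "T ^ n \<le> K * real N powr (real n * \<epsilon>) * R ^ (n - 1) * T" .
      \<comment> \<open>\<open>T\<close> is on both sides because \<open>f ^ n\<close> sums to
        \<open>T\<close>. Cancelling one factor leaves \<open>T ^ (n - 1)\<close>, whose
        \<open>n\<close>-th root is the norm of \<open>h\<close>, while \<open>R\<close> is the
        total size of the lines.\<close>
      have "T ^ (n - 1) \<le> K * real N powr (real n * \<epsilon>) * R ^ (n - 1)"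
      proof (cases "T = 0")
        case True
        then show ?thesis using n2 K R0 by (simp add: power_0_left)
      next
        case False
        have "T ^ n = T ^ (n - 1) * T" using n2 by (cases n) auto
        then show ?thesis using T4 False T0 by simp
      qed
      then have "(T ^ (n - 1)) powr (1 / real n) \<le> (K * real N powr (real n * \<epsilon>) * R ^ (n - 1)) powr (1 / real n)"
        using T0 by (intro powr_mono2) auto
      also have "\<dots> = K powr (1 / real n) * (real N powr (real n * \<epsilon>)) powr (1 / real n) * (R ^ (n - 1)) powr (1 / real n)"
        using K R0 by (simp add: powr_mult)
      also have "(real N powr (real n * \<epsilon>)) powr (1 / real n) = real N powr \<epsilon>"
        using n2 by (simp add: powr_powr)
      finally have "(T ^ (n - 1)) powr (1 / real n) \<le> K powr (1 / real n) * real N powr \<epsilon> * (R ^ (n - 1)) powr (1 / real n)" .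
      also have "\<dots> \<le> C * real N powr \<epsilon> * (R ^ (n - 1)) powr (1 / real n)"
        by (intro mult_right_mono) (auto simp: C_def)
      finally have *: "(T ^ (n - 1)) powr (1 / real n) \<le> C * real N powr \<epsilon> * (R ^ (n - 1)) powr (1 / real n)" .
      have pw: "(x ^ (n - 1)) powr (1 / real n) = x powr ((real n - 1) / real n)" if "0 \<le> x" for x :: real
      proof (cases "x = 0")
        case True then show ?thesis using n2 by (simp add: power_0_left)
      next
        case False
        then have "x ^ (n - 1) = x powr (real n - 1)" using that n2 powr_realpow[of x "n - 1"] by simp
        then show ?thesis by (simp add: powr_powr)
      qed
      have "ell_norm (maximal_exponent n) (vecs N n) h = T powr ((real n - 1) / real n)"
        using False h0 by (simp add: ell_norm_def maximal_exponent_def T_def s_def)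
      then show ?thesis using *[unfolded pw[OF T0] pw[OF R0]] by (simp only: R_def)
    qed
    then show "ell_norm (maximal_exponent n) (vecs N n) (\<lambda>x. \<Sum>u\<in>proj_space N n. indicator (L u) x)
        \<le> C * real N powr \<epsilon> * (\<Sum>u\<in>proj_space N n. real (card (L u))) powr ((real n - 1) / real n)"
      unfolding sumL[unfolded P_def] h_def P_def .
  qed
qed

end
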